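(* Let $k$ be an algebraically closed field of characteristic $0$. Let $v_{n,2}:\mathbb{P}(V)\to\mathbb{P}(\mathrm{Sym}^2 V)$ be a degree $2$ Veronese embedding, where $V$ is a $k$-vector space of dimension $n+1$ and $n\ge 2$. Let $X$ denote the image of $v_{n,2}$ and let $L\subset\mathbb{P}(V)$ be a line. Then, identifying $X$ with $\mathbb{P}(V)$ via $v_{n,2}$ and $L$ with $\mathbb{P}^1$, $$\mathcal{N}_{X/\mathbb{P}(\mathrm{Sym}^2 V)}|_L\cong \mathcal{O}_{\mathbb{P}^1}(2)^{\oplus \frac{n(n-1)}{2}}\oplus\mathcal{O}_{\mathbb{P}^1}(3)^{\oplus (n-1)}\oplus\mathcal{O}_{\mathbb{P}^1}(4).$$
   Context: $\mathbb{P}(V)$ denotes the projective space of one-dimensional subspaces of $V$. A degree $2$ Veronese embedding is an embedding $\mathbb{P}(V)\hookrightarrow\mathbb{P}(\mathrm{Sym}^2 V)$ given by the complete linear series $|\mathcal{O}_{\mathbb{P}(V)}(2)|$ (for instance $[L]\mapsto[L^2]$ for one-dimensional subspaces $L \subset V$). $\mathcal{N}_{X/\mathbb{P}(\mathrm{Sym}^2 V)}$ is the normal bundle of $X$ in $\mathbb{P}(\mathrm{Sym}^2 V)$, viewed as a vector bundle on $\mathbb{P}(V)$ through $v_{n,2}$. *)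

theory Defs
  imports "HOL-Analysis.Cartesian_Space" "HOL-Computational_Algebra.Polynomial"
begin

text \<open>
  Varieties are treated classically, over an algebraically closed field, as spaces of closed
  points with a sheaf of functions with values in the field. Vector bundles on them are geometric
  vector bundles, i.e. families of vector spaces together with the sheaf of regular sections.
\<close>


section \<open>The symmetric square\<close>

definition symmetric_bilinear ::
  "('k::field \<Rightarrow> 'v::ab_group_add \<Rightarrow> 'v) \<Rightarrow> ('k \<Rightarrow> 'w::ab_group_add \<Rightarrow> 'w) \<Rightarrow> ('v \<Rightarrow> 'v \<Rightarrow> 'w) \<Rightarrow> bool" where
  "symmetric_bilinear sV sW b \<longleftrightarrow>
     (\<forall>y. Vector_Spaces.linear sV sW (\<lambda>x. b x y)) \<and> (\<forall>x y. b x y = b y x)"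

text \<open>
  The pair of \<open>W\<close> and \<open>mul\<close> is a model of \<open>Sym\<^sup>2 V\<close> with its multiplication \<open>V \<times> V \<rightarrow> Sym\<^sup>2 V\<close>.
  A definition cannot quantify over the type of the target, so the universal property is
  required for scalar-valued forms; the lemma \<open>symmetric_square_universal\<close> derives it for
  all targets.
\<close>

definition symmetric_square ::
  "('k::field \<Rightarrow> 'v::ab_group_add \<Rightarrow> 'v) \<Rightarrow> ('k \<Rightarrow> 'w::ab_group_add \<Rightarrow> 'w) \<Rightarrow> ('v \<Rightarrow> 'v \<Rightarrow> 'w) \<Rightarrow> bool" where
  "symmetric_square sV sW mul \<longleftrightarrow>
     symmetric_bilinear sV sW mul \<and>
     (\<forall>b :: 'v \<Rightarrow> 'v \<Rightarrow> 'k. symmetric_bilinear sV (*) b \<longrightarrow>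
        (\<exists>!f. Vector_Spaces.linear sW (*) f \<and> (\<forall>x y. f (mul x y) = b x y)))"


lemma linear_comp:
  assumes "Vector_Spaces.linear s1 s2 f" "Vector_Spaces.linear s2 s3 g"
  shows "Vector_Spaces.linear s1 s3 (\<lambda>x. g (f x))"
  using assms by (auto simp: Vector_Spaces.linear_iff)

lemma symmetric_square_universal:
  fixes sV :: "'k::field \<Rightarrow> 'v::ab_group_add \<Rightarrow> 'v"
    and sW :: "'k \<Rightarrow> 'w::ab_group_add \<Rightarrow> 'w"
    and sU :: "'k \<Rightarrow> 'u::ab_group_add \<Rightarrow> 'u"
  assumes sq: "symmetric_square sV sW mul" and b: "symmetric_bilinear sV sU b"
  shows "\<exists>!f. Vector_Spaces.linear sW sU f \<and> (\<forall>x y. f (mul x y) = b x y)"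
proof -
  have lm: "Vector_Spaces.linear sV sW (\<lambda>x. mul x y)" for y
    using sq by (auto simp: symmetric_square_def symmetric_bilinear_def)
  have lb: "Vector_Spaces.linear sV sU (\<lambda>x. b x y)" for y
    using b by (auto simp: symmetric_bilinear_def)
  interpret W: vector_space sW using lm[of 0] by (simp add: Vector_Spaces.linear_iff)
  interpret U: vector_space sU using lb[of 0] by (simp add: Vector_Spaces.linear_iff)
  interpret K: vector_space "(*) :: 'k \<Rightarrow> 'k \<Rightarrow> 'k" by unfold_locales
  interpret WK: vector_space_pair sW "(*) :: 'k \<Rightarrow> 'k \<Rightarrow> 'k" ..
  interpret UK: vector_space_pair sU "(*) :: 'k \<Rightarrow> 'k \<Rightarrow> 'k" ..
  interpret WU: vector_space_pair sW sU ..
  define M where "M = {mul x y |x y. True}"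
  have uniqK: "f = g" if "Vector_Spaces.linear sW (*) f" "Vector_Spaces.linear sW (*) g"
    "\<And>x y. f (mul x y) = g (mul x y)" for f g :: "'w \<Rightarrow> 'k"
  proof -
    have "symmetric_bilinear sV (*) (\<lambda>x y. g (mul x y))"
      using linear_comp[OF lm that(2)] sq
      by (auto simp: symmetric_bilinear_def symmetric_square_def)
    then have "\<exists>!h. Vector_Spaces.linear sW (*) h \<and> (\<forall>x y. h (mul x y) = g (mul x y))"
      using sq by (auto simp: symmetric_square_def)
    with that show ?thesis by blast
  qed
  obtain B where B: "B \<subseteq> M" "W.independent B" "W.span B = W.span M"
    using W.basis_exists[of M] by (metis W.span_subspace W.subspace_span W.span_mono
        W.span_superset W.span_span subset_antisym)
  have spanB: "W.span B = UNIV"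
  proof (rule ccontr)
    assume "W.span B \<noteq> UNIV"
    then obtain w where w: "w \<notin> W.span B" by auto
    then have ind: "W.independent (insert w B)" using B(2) W.independent_insertI by blast
    obtain f where f: "Vector_Spaces.linear sW (*) f"
      "\<forall>x\<in>insert w B. f x = (if x = w then 1 else (0::'k))"
      using WK.linear_independent_extend[OF ind, of "\<lambda>x. if x = w then 1 else 0"] by blast
    have "w \<notin> B" using w W.span_base by blast
    then have "f x = 0" if "x \<in> B" for x using f that by auto
    then have "f x = 0" if "x \<in> W.span B" for x
      using WK.linear_eq_0_on_span[OF f(1) _ that] by blast
    then have "f (mul x y) = (\<lambda>_. 0) (mul x y)" for x y
      using B(3) W.span_base[of "mul x y" M] by (auto simp: M_def)
    then have "f = (\<lambda>_. 0)"
      by (rule uniqK[OF f(1) WK.linear_zero])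
    then show False using f(2) by auto
  qed
  have "\<forall>m\<in>B. \<exists>x y. m = mul x y" using B(1) by (auto simp: M_def)
  then obtain p q where pq: "\<And>m. m \<in> B \<Longrightarrow> m = mul (p m) (q m)" by metis
  obtain f where f: "Vector_Spaces.linear sW sU f" "\<forall>m\<in>B. f m = b (p m) (q m)"
    using WU.linear_independent_extend[OF B(2), of "\<lambda>m. b (p m) (q m)"] by blast
  have fm: "f (mul x y) = b x y" for x y
  proof (rule ccontr)
    assume ne: "f (mul x y) \<noteq> b x y"
    let ?d = "f (mul x y) - b x y"
    have "U.independent {?d}" using ne by (simp add: U.dependent_single)
    then obtain g where g: "Vector_Spaces.linear sU (*) g" "g ?d = (1::'k)"
      using UK.linear_independent_extend[of "{?d}" "\<lambda>_. 1"] by auto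
    have "symmetric_bilinear sV (*) (\<lambda>x y. g (b x y))"
      using linear_comp[OF lb g(1)] b by (auto simp: symmetric_bilinear_def)
    then obtain h where h: "Vector_Spaces.linear sW (*) h" "\<And>x y. h (mul x y) = g (b x y)"
      using sq unfolding symmetric_square_def by metis
    have "h z = g (f z)" for z
    proof (rule WK.linear_eq_on[OF h(1) linear_comp[OF f(1) g(1)], of z B])
      show "z \<in> W.span B" using spanB by simp
      show "h m = g (f m)" if "m \<in> B" for m
        using f(2) h(2)[of "p m" "q m"] pq[OF that] that by metis
    qed
    then have "g (f (mul x y)) = g (b x y)" using h(2) by metis
    then have "g ?d = 0" using UK.linear_diff[OF g(1)] by simp
    then show False using g(2) by simp
  qed
  show ?thesis
  proof (rule ex1I[of _ f])
    show "Vector_Spaces.linear sW sU f \<and> (\<forall>x y. f (mul x y) = b x y)" using f fm by blast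
    fix g assume g: "Vector_Spaces.linear sW sU g \<and> (\<forall>x y. g (mul x y) = b x y)"
    have "g z = f z" for z
    proof (rule WU.linear_eq_on[of g f z B])
      show "g m = f m" if "m \<in> B" for m
        using g fm pq[OF that] by metis
    qed (use g f spanB in auto)
    then show "g = f" by auto
  qed
qed

section \<open>Spaces with functions and projective spaces\<close>

text \<open>
  Functions on subsets are total functions whose values outside the subset are irrelevant.
\<close>

record ('p, 'k) fspace =
  points :: "'p set"
  opens :: "'p set \<Rightarrow> bool"
  regular :: "'p set \<Rightarrow> ('p \<Rightarrow> 'k) \<Rightarrow> bool"

definition subspace_of :: "('p, 'k) fspace \<Rightarrow> 'p set \<Rightarrow> ('p, 'k) fspace" where
  "subspace_of B X =
     \<lparr> points = points B \<inter> X,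
       opens = (\<lambda>U. \<exists>V. opens B V \<and> U = V \<inter> X),
       regular = (\<lambda>U f. \<forall>p\<in>U. \<exists>V g. opens B V \<and> p \<in> V \<and> V \<inter> X \<subseteq> U \<and> regular B V g \<and>
                                  (\<forall>q\<in>V \<inter> X. f q = g q)) \<rparr>"

inductive poly_fun :: "('k::field \<Rightarrow> 'v::ab_group_add \<Rightarrow> 'v) \<Rightarrow> ('v \<Rightarrow> 'k) \<Rightarrow> bool"
  for sV :: "'k \<Rightarrow> 'v \<Rightarrow> 'v" where
  const: "poly_fun sV (\<lambda>_. c)"
| linear: "Vector_Spaces.linear sV (*) f \<Longrightarrow> poly_fun sV f"
| add: "poly_fun sV f \<Longrightarrow> poly_fun sV g \<Longrightarrow> poly_fun sV (\<lambda>x. f x + g x)"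
| mult: "poly_fun sV f \<Longrightarrow> poly_fun sV g \<Longrightarrow> poly_fun sV (\<lambda>x. f x * g x)"

text \<open>
  Since the field is infinite, these are exactly the functions of homogeneous polynomials of
  degree \<open>d\<close> (including the zero polynomial).
\<close>

definition homogeneous ::
  "('k::field \<Rightarrow> 'v::ab_group_add \<Rightarrow> 'v) \<Rightarrow> nat \<Rightarrow> ('v \<Rightarrow> 'k) \<Rightarrow> bool" where
  "homogeneous sV d f \<longleftrightarrow> poly_fun sV f \<and> (\<forall>c x. f (sV c x) = c ^ d * f x)"

definition proj_points :: "('k::field \<Rightarrow> 'v::ab_group_add \<Rightarrow> 'v) \<Rightarrow> 'v set set" where
  "proj_points sV = {l. module.subspace sV l \<and> vector_space.dim sV l = 1}"

definition zariski_closed :: "('k::field \<Rightarrow> 'v::ab_group_add \<Rightarrow> 'v) \<Rightarrow> 'v set set \<Rightarrow> bool" where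
  "zariski_closed sV Z \<longleftrightarrow>
     (\<exists>S. (\<forall>f\<in>S. \<exists>d. homogeneous sV d f) \<and>
          Z = {l \<in> proj_points sV. \<forall>f\<in>S. \<forall>x\<in>l - {0}. f x = 0})"

definition zariski_open :: "('k::field \<Rightarrow> 'v::ab_group_add \<Rightarrow> 'v) \<Rightarrow> 'v set set \<Rightarrow> bool" where
  "zariski_open sV U \<longleftrightarrow> U \<subseteq> proj_points sV \<and> zariski_closed sV (proj_points sV - U)"

definition proj_space :: "('k::field \<Rightarrow> 'v::ab_group_add \<Rightarrow> 'v) \<Rightarrow> ('v set, 'k) fspace" where
  "proj_space sV =
     \<lparr> points = proj_points sV,
       opens = zariski_open sV,
       regular = (\<lambda>U f. \<forall>l\<in>U. \<exists>U' d P Q. zariski_open sV U' \<and> l \<in> U' \<and> U' \<subseteq> U \<and>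
                     homogeneous sV d P \<and> homogeneous sV d Q \<and>
                     (\<forall>m\<in>U'. \<forall>x\<in>m - {0}. Q x \<noteq> 0 \<and> f m = P x / Q x)) \<rparr>"

definition is_line :: "('k::field \<Rightarrow> 'v::ab_group_add \<Rightarrow> 'v) \<Rightarrow> 'v set set \<Rightarrow> bool" where
  "is_line sV L \<longleftrightarrow>
     (\<exists>E. module.subspace sV E \<and> vector_space.dim sV E = 2 \<and> L = {l \<in> proj_points sV. l \<subseteq> E})"

abbreviation P1 :: "(('k::field ^ 2) set, 'k) fspace" where
  "P1 \<equiv> proj_space (*s)"

definition line_identification ::
  "('k::field \<Rightarrow> 'v::ab_group_add \<Rightarrow> 'v) \<Rightarrow> 'v set set \<Rightarrow> (('k ^ 2) set \<Rightarrow> 'v set) \<Rightarrow> bool" where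
  "line_identification sV L \<phi> \<longleftrightarrow>
     (\<exists>e. Vector_Spaces.linear (*s) sV e \<and> inj e \<and> (\<forall>p\<in>points P1. \<phi> p = e ` p)) \<and>
     \<phi> ` points P1 = L"


section \<open>Vector bundles\<close>

text \<open>
  Every vector space embeds into a space of \<open>k\<close>-valued functions. Fibres are therefore taken to be
  linear subspaces of some \<open>'x \<Rightarrow> 'k\<close>, with the pointwise operations. In \<open>sections E U s\<close>, the
  values of \<open>s\<close> outside the open set \<open>U\<close> are irrelevant.
\<close>

record ('p, 'k, 'x) vbundle =
  base :: "('p, 'k) fspace"
  fibre :: "'p \<Rightarrow> ('x \<Rightarrow> 'k) set"
  sections :: "'p set \<Rightarrow> ('p \<Rightarrow> 'x \<Rightarrow> 'k) \<Rightarrow> bool"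

definition bundle_iso ::
  "('p, 'k::field, 'x) vbundle \<Rightarrow> ('p, 'k, 'y) vbundle \<Rightarrow> bool" where
  "bundle_iso E F \<longleftrightarrow> base E = base F \<and>
     (\<exists>\<Phi> :: 'p \<Rightarrow> ('x \<Rightarrow> 'k) \<Rightarrow> ('y \<Rightarrow> 'k).
        (\<forall>p\<in>points (base E).
           bij_betw (\<Phi> p) (fibre E p) (fibre F p) \<and>
           (\<forall>a\<in>fibre E p. \<forall>b\<in>fibre E p. \<Phi> p (\<lambda>x. a x + b x) = (\<lambda>y. \<Phi> p a y + \<Phi> p b y)) \<and>
           (\<forall>c. \<forall>a\<in>fibre E p. \<Phi> p (\<lambda>x. c * a x) = (\<lambda>y. c * \<Phi> p a y))) \<and>
        (\<forall>U s. opens (base E) U \<longrightarrow> (\<forall>p\<in>U. s p \<in> fibre E p) \<longrightarrow>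
           (sections E U s \<longleftrightarrow> sections F U (\<lambda>p. \<Phi> p (s p)))))"

text \<open>
  The regular sections of \<open>f\<^sup>* E\<close> are the ones generated, locally and over the regular functions, by
  the pulled back regular sections of \<open>E\<close>.
\<close>

definition pullback ::
  "('q, 'k::field) fspace \<Rightarrow> ('q \<Rightarrow> 'p) \<Rightarrow> ('p, 'k, 'x) vbundle \<Rightarrow> ('q, 'k, 'x) vbundle" where
  "pullback B f E =
     \<lparr> base = B,
       fibre = (\<lambda>q. fibre E (f q)),
       sections = (\<lambda>U s. \<forall>q\<in>U. \<exists>U' V m a t.
          opens B U' \<and> q \<in> U' \<and> U' \<subseteq> U \<and> opens (base E) V \<and> f ` U' \<subseteq> V \<and>
          (\<forall>i<(m::nat). regular B U' (a i) \<and> sections E V (t i)) \<and>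
          (\<forall>r\<in>U'. s r = (\<lambda>x. \<Sum>i<m. a i r * t i (f r) x))) \<rparr>"

abbreviation restrict_bundle ::
  "('p, 'k::field, 'x) vbundle \<Rightarrow> 'p set \<Rightarrow> ('p, 'k, 'x) vbundle" where
  "restrict_bundle E L \<equiv> pullback (subspace_of (base E) L) (\<lambda>p. p) E"

text \<open>The \<open>i\<close>-th component of an element \<open>h\<close> of a direct sum is \<open>\<lambda>x. h (i, x)\<close>.\<close>

definition direct_sum ::
  "('p, 'k::field) fspace \<Rightarrow> ('p, 'k, 'x) vbundle list \<Rightarrow> ('p, 'k, nat \<times> 'x) vbundle" where
  "direct_sum B Es =
     \<lparr> base = B,
       fibre = (\<lambda>p. {h. (\<forall>i<length Es. (\<lambda>x. h (i, x)) \<in> fibre (Es ! i) p) \<and>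
                       (\<forall>i x. length Es \<le> i \<longrightarrow> h (i, x) = 0)}),
       sections = (\<lambda>U s. (\<forall>i<length Es. sections (Es ! i) U (\<lambda>p x. s p (i, x))) \<and>
                       (\<forall>p\<in>U. \<forall>i x. length Es \<le> i \<longrightarrow> s p (i, x) = 0)) \<rparr>"

text \<open>
  \<open>\<O>(d)\<close> on \<open>\<P>(V)\<close> has as fibre over a line \<open>l \<subseteq> V\<close> the \<open>d\<close>-th power of the dual of \<open>l\<close>, i.e. the
  functions on \<open>l\<close> that are homogeneous of degree \<open>d\<close> (extended by zero to \<open>V\<close>).
\<close>

definition twisting_bundle ::
  "('k::field \<Rightarrow> 'v::ab_group_add \<Rightarrow> 'v) \<Rightarrow> nat \<Rightarrow> ('v set, 'k, 'v) vbundle" where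
  "twisting_bundle sV d =
     \<lparr> base = proj_space sV,
       fibre = (\<lambda>l. {g. (\<forall>c. \<forall>x\<in>l. g (sV c x) = c ^ d * g x) \<and> (\<forall>x. x \<notin> l \<longrightarrow> g x = 0)}),
       sections = (\<lambda>U s.
          (\<forall>l\<in>U. (\<forall>c. \<forall>x\<in>l. s l (sV c x) = c ^ d * s l x) \<and> (\<forall>x. x \<notin> l \<longrightarrow> s l x = 0)) \<and>
          (\<forall>l\<in>U. \<exists>U' e P Q. zariski_open sV U' \<and> l \<in> U' \<and> U' \<subseteq> U \<and>
             homogeneous sV (d + e) P \<and> homogeneous sV e Q \<and>
             (\<forall>m\<in>U'. \<forall>x\<in>m - {0}. Q x \<noteq> 0 \<and> s m x = P x / Q x))) \<rparr>"

definition stalk :: "('p, 'k) fspace \<Rightarrow> 'p \<Rightarrow> ('p \<Rightarrow> 'k) set" where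
  "stalk B p = {f. \<exists>U. opens B U \<and> p \<in> U \<and> regular B U f}"

definition ideal_stalk :: "('p, 'k::zero) fspace \<Rightarrow> 'p set \<Rightarrow> 'p \<Rightarrow> ('p \<Rightarrow> 'k) set" where
  "ideal_stalk B X p =
     {f. \<exists>U. opens B U \<and> p \<in> U \<and> regular B U f \<and> (\<forall>q\<in>U \<inter> X. f q = 0)}"

text \<open>
  The normal bundle of a smooth closed subvariety \<open>X\<close> of \<open>B\<close> is the dual of the conormal bundle
  \<open>I/I\<^sup>2\<close>, where \<open>I\<close> is the ideal sheaf of \<open>X\<close>. Its sheaf of sections is
  \<open>Hom(I/I\<^sup>2, \<O>\<^sub>X) = Hom(I, \<O>\<^sub>X)\<close>, and its fibre at \<open>p\<close> is \<open>Hom(I\<^sub>p, k)\<close>, the homomorphisms over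
  \<open>\<O>\<^bsub>B,p\<^esub>\<close>, which acts on \<open>k\<close> through evaluation at \<open>p\<close>. Germs are represented by functions; the
  first condition on \<open>\<theta>\<close> says that its value depends only on the germ.
\<close>

definition normal_bundle ::
  "('p, 'k::field) fspace \<Rightarrow> 'p set \<Rightarrow> ('p, 'k, 'p \<Rightarrow> 'k) vbundle" where
  "normal_bundle B X =
     (let N = (\<lambda>p. {\<theta>.
            (\<forall>f\<in>ideal_stalk B X p. \<forall>g\<in>ideal_stalk B X p.
               (\<exists>U. opens B U \<and> p \<in> U \<and> (\<forall>q\<in>U. f q = g q)) \<longrightarrow> \<theta> f = \<theta> g) \<and>
            (\<forall>f\<in>ideal_stalk B X p. \<forall>g\<in>ideal_stalk B X p. \<theta> (\<lambda>q. f q + g q) = \<theta> f + \<theta> g) \<and>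
            (\<forall>a\<in>stalk B p. \<forall>f\<in>ideal_stalk B X p. \<theta> (\<lambda>q. a q * f q) = a p * \<theta> f) \<and>
            (\<forall>f. f \<notin> ideal_stalk B X p \<longrightarrow> \<theta> f = 0)})
      in \<lparr> base = subspace_of B X,
           fibre = N,
           sections = (\<lambda>U s.
              (\<forall>p\<in>U. s p \<in> N p) \<and>
              (\<forall>V f. opens B V \<longrightarrow> regular B V f \<longrightarrow> (\<forall>q\<in>V \<inter> X. f q = 0) \<longrightarrow>
                 regular (subspace_of B X) (U \<inter> V) (\<lambda>p. s p f))) \<rparr>)"


section \<open>Veronese embeddings of degree 2\<close>

definition global_basis :: "('p, 'k::field, 'x) vbundle \<Rightarrow> nat \<Rightarrow> (nat \<Rightarrow> 'p \<Rightarrow> 'x \<Rightarrow> 'k) \<Rightarrow> bool" where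
  "global_basis E N s \<longleftrightarrow>
     (\<forall>i<N. sections E (points (base E)) (s i)) \<and>
     (\<forall>t. sections E (points (base E)) t \<longrightarrow>
        (\<exists>!c. (\<forall>i\<ge>N. c i = 0) \<and> (\<forall>p\<in>points (base E). \<forall>x. t p x = (\<Sum>i<N. c i * s i p x))))"

text \<open>
  The map \<open>\<P>(V) \<rightarrow> \<P>(W)\<close> given by the complete linear series \<open>|\<O>(2)|\<close>: its homogeneous coordinates,
  with respect to some basis \<open>w\<close> of \<open>W\<close>, form a basis \<open>s\<close> of the global sections of \<open>\<O>(2)\<close>. Evaluation
  at a nonzero \<open>x \<in> l\<close> identifies the fibre of \<open>\<O>(2)\<close> at \<open>l\<close> with \<open>k\<close>.
\<close>

definition veronese2 ::
  "('k::field \<Rightarrow> 'v::ab_group_add \<Rightarrow> 'v) \<Rightarrow> ('k \<Rightarrow> 'w::ab_group_add \<Rightarrow> 'w) \<Rightarrow> ('v set \<Rightarrow> 'w set) \<Rightarrow> bool" where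
  "veronese2 sV sW v \<longleftrightarrow>
     (\<exists>N s w. global_basis (twisting_bundle sV 2) N s \<and>
        inj_on w {..<N} \<and> \<not> module.dependent sW (w ` {..<N}) \<and> module.span sW (w ` {..<N}) = UNIV \<and>
        (\<forall>l\<in>proj_points sV. \<forall>x\<in>l - {0}. v l = module.span sW {\<Sum>i<N. sW (s i l x) (w i)}))"

end

theory Submission
  imports Defs
begin

text \<open>
  Write \<open>xy\<close> for the product of \<open>x\<close> and \<open>y\<close> in \<open>W = Sym\<^sup>2 V\<close>. Global sections of \<open>\<O>(2)\<close> are quadratic
  forms on \<open>V\<close>, hence linear forms on \<open>W\<close>; so an embedding by the complete linear series differs
  from \<open>[x] \<mapsto> [xx]\<close> by a linear automorphism of \<open>W\<close>. Composing the multiplication with this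
  automorphism gives another model of \<open>Sym\<^sup>2 V\<close>, for which the embedding is \<open>[x] \<mapsto> [xx]\<close>
  (\<open>veronese2_symmetric_square\<close>).

  A vector \<open>u\<close> in \<open>W\<close> gives a normal vector at \<open>[xx]\<close>: differentiate the local equations of \<open>X\<close> at
  \<open>xx\<close> in the direction \<open>u\<close> (\<open>tangent\<close>). All normal vectors arise so, and exactly the \<open>u\<close> in
  \<open>xV\<close>, the tangent space of the cone over \<open>X\<close>, give zero. The fibre of the normal bundle is thus
  \<open>Sym\<^sup>2(V/x)\<close>, with a twist by 2 because a representative of \<open>[xx]\<close> is quadratic in \<open>x\<close>. Let \<open>L = \<P>(E)\<close>,
  and choose coordinates \<open>\<beta>\<^sub>0, ..., \<beta>\<^sub>n\<close> of \<open>V\<close> such that \<open>\<beta>\<^sub>2, ..., \<beta>\<^sub>n\<close> vanish on \<open>E\<close>. For \<open>x\<close> in \<open>E\<close> the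
  space \<open>V/x\<close> has the coordinates \<open>\<beta>\<^sub>0(x) \<beta>\<^sub>1 - \<beta>\<^sub>1(x) \<beta>\<^sub>0\<close>, of degree 1 in \<open>x\<close>, and \<open>\<beta>\<^sub>2, ..., \<beta>\<^sub>n\<close>, of
  degree 0. The products of two of them are coordinates on \<open>Sym\<^sup>2(V/x)\<close>. With the twist they have
  degree 4 once, degree 3 for \<open>n - 1\<close> products, and degree 2 for \<open>n(n-1)/2\<close> products. These
  coordinates are the isomorphism with the direct sum.

  The fibre of the normal bundle is defined through the ideal of \<open>X\<close>, so equations are needed.
  Where \<open>\<beta>\<^sub>0(x) \<noteq> 0\<close> the variety \<open>X\<close> is a graph: in the affine coordinates \<open>y\<^bsub>ij\<^esub>\<close> of \<open>\<P>(W)\<close> it is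
  given by \<open>y\<^bsub>ij\<^esub> = y\<^bsub>0i\<^esub> y\<^bsub>0j\<^esub>\<close> for \<open>1 \<le> i, j \<le> n\<close>. A Taylor expansion shows that these equations generate
  the stalk of the ideal (\<open>conormal_generated\<close>), so a normal vector is a free choice of
  values on them, symmetric in \<open>i\<close> and \<open>j\<close> (\<open>normal_frame\<close>, \<open>normal_vector_exists\<close>). Multiplied by the power of \<open>\<beta>\<^sub>0(x)\<close> given by the
  degrees above, these values are the coordinates on \<open>Sym\<^sup>2(V/x)\<close>, independently of the chart
  (\<open>tangent_graph_eq_invariant\<close>), and the two charts belonging to a basis of \<open>E\<close> cover \<open>L\<close>.

  Regularity is always tested on the affine cone: a regular function or section near \<open>[x]\<close> is a
  quotient of homogeneous polynomials near \<open>x\<close> (\<open>rat_germ\<close>). Sections of the pulled back normal bundle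
  have such values on the equations (\<open>NL_section_germ\<close>); conversely values of this kind
  are coefficients in a frame of pulled back sections (\<open>NL_section_local\<close>).
\<close>

section \<open>Homogeneous functions and germs along the affine cone\<close>

lemma poly_fun_uminus: "poly_fun s f \<Longrightarrow> poly_fun s (\<lambda>x. - f x)"
  using poly_fun.mult[OF poly_fun.const[of s "-1"], of f] by simp

lemma poly_fun_diff: "poly_fun s f \<Longrightarrow> poly_fun s g \<Longrightarrow> poly_fun s (\<lambda>x. f x - g x)"
  using poly_fun.add[OF _ poly_fun_uminus, of s f g] by simp

lemma poly_fun_linear_comp:
  assumes "poly_fun sW f" "Vector_Spaces.linear sV sW e"
  shows "poly_fun sV (\<lambda>x. f (e x))"
  using assms(1)
  by induction (auto intro: poly_fun.intros linear_comp[OF assms(2)])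

lemma homogeneous_const: "homogeneous s 0 (\<lambda>_. c)"
  by (auto simp: homogeneous_def intro: poly_fun.intros)

lemma homogeneous_zero: "homogeneous s d (\<lambda>_. 0)"
  by (auto simp: homogeneous_def intro: poly_fun.intros)

lemma homogeneous_linear: "Vector_Spaces.linear s (*) f \<Longrightarrow> homogeneous s 1 f"
  by (auto simp: homogeneous_def Vector_Spaces.linear_iff intro: poly_fun.intros)

lemma homogeneous_add: "homogeneous s d f \<Longrightarrow> homogeneous s d g \<Longrightarrow> homogeneous s d (\<lambda>x. f x + g x)"
  by (auto simp: homogeneous_def algebra_simps intro: poly_fun.intros)

lemma homogeneous_diff: "homogeneous s d f \<Longrightarrow> homogeneous s d g \<Longrightarrow> homogeneous s d (\<lambda>x. f x - g x)"
  by (auto simp: homogeneous_def algebra_simps intro: poly_fun_diff)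

lemma homogeneous_mult:
  "homogeneous s d f \<Longrightarrow> homogeneous s e g \<Longrightarrow> homogeneous s (d + e) (\<lambda>x. f x * g x)"
  by (auto simp: homogeneous_def algebra_simps power_add intro: poly_fun.intros)

lemma homogeneous_sum:
  "(\<And>i. i \<in> I \<Longrightarrow> homogeneous s d (f i)) \<Longrightarrow> homogeneous s d (\<lambda>x. \<Sum>i\<in>I. f i x)"
  by (induction I rule: infinite_finite_induct)
     (auto intro: homogeneous_zero homogeneous_add)

lemma homogeneous_power: "homogeneous s d f \<Longrightarrow> homogeneous s (k * d) (\<lambda>x. f x ^ k)"
  by (induction k) (auto intro: homogeneous_const homogeneous_mult)

text \<open>
  Conical Zariski neighbourhoods of \<open>x\<close>, without the requirement \<open>y \<noteq>
  0\<close>: this makes the filter functorial for homogeneous polynomial maps, and for \<open>x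
  \<noteq> 0\<close> the origin can be removed by a linear form that is nonzero at
  \<open>x\<close>.
\<close>

definition zariski_at :: "('k::field \<Rightarrow> 'v::ab_group_add \<Rightarrow> 'v) \<Rightarrow> 'v \<Rightarrow> 'v filter" where
  "zariski_at s x =
     (INF Q\<in>{Q. (\<exists>e. homogeneous s e Q) \<and> Q x \<noteq> 0}. principal {y. Q y \<noteq> 0})"

lemma eventually_zariski_at:
  "eventually P (zariski_at s x) \<longleftrightarrow>
     (\<exists>e Q. homogeneous s e Q \<and> Q x \<noteq> 0 \<and> (\<forall>y. Q y \<noteq> 0 \<longrightarrow> P y))"
proof -
  have "eventually P (zariski_at s x) \<longleftrightarrow>
     (\<exists>Q\<in>{Q. (\<exists>e. homogeneous s e Q) \<and> Q x \<noteq> 0}. eventually P (principal {y. Q y \<noteq> 0}))"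
    unfolding zariski_at_def
  proof (rule eventually_INF_base)
    show "{Q. (\<exists>e. homogeneous s e Q) \<and> Q x \<noteq> 0} \<noteq> {}"
      using homogeneous_const[of s 1] by (auto intro!: exI[of _ "\<lambda>_. 1"])
    show "\<exists>R\<in>{Q. (\<exists>e. homogeneous s e Q) \<and> Q x \<noteq> 0}.
            principal {y. R y \<noteq> 0} \<le> inf (principal {y. P y \<noteq> 0}) (principal {y. Q y \<noteq> 0})"
      if "P \<in> {Q. (\<exists>e. homogeneous s e Q) \<and> Q x \<noteq> 0}"
        "Q \<in> {Q. (\<exists>e. homogeneous s e Q) \<and> Q x \<noteq> 0}" for P Q
      using that homogeneous_mult[of s _ P _ Q]
      by (intro bexI[of _ "\<lambda>y. P y * Q y"]) auto
  qed
  then show ?thesis by (auto simp: eventually_principal)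
qed

lemma eventually_zariski_at_self: "eventually P (zariski_at s x) \<Longrightarrow> P x"
  by (auto simp: eventually_zariski_at)

lemma eventually_homogeneous_nonzero:
  "homogeneous s e Q \<Longrightarrow> Q x \<noteq> 0 \<Longrightarrow> \<forall>\<^sub>F y in zariski_at s x. Q y \<noteq> 0"
  by (auto simp: eventually_zariski_at)

lemma eventually_zariski_at_comp:
  assumes g: "\<And>e Q. homogeneous s' e Q \<Longrightarrow> \<exists>e'. homogeneous s e' (\<lambda>y. Q (g y))"
    and P: "eventually P (zariski_at s' (g x))"
  shows "\<forall>\<^sub>F y in zariski_at s x. P (g y)"
proof -
  obtain e Q where Q: "homogeneous s' e Q" "Q (g x) \<noteq> 0" "\<And>y. Q y \<noteq> 0 \<Longrightarrow> P y"
    using P by (auto simp: eventually_zariski_at)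
  obtain e' where "homogeneous s e' (\<lambda>y. Q (g y))" using g[OF Q(1)] by blast
  with Q show ?thesis by (auto simp: eventually_zariski_at)
qed

definition rat_germ ::
  "('k::field \<Rightarrow> 'v::ab_group_add \<Rightarrow> 'v) \<Rightarrow> nat \<Rightarrow> 'v \<Rightarrow> ('v \<Rightarrow> 'k) \<Rightarrow> bool" where
  "rat_germ s d x F \<longleftrightarrow>
     (\<exists>e P Q. homogeneous s (d + e) P \<and> homogeneous s e Q \<and> Q x \<noteq> 0 \<and>
        (\<forall>\<^sub>F y in zariski_at s x. F y = P y / Q y))"

lemma rat_germI:
  "homogeneous s (d + e) P \<Longrightarrow> homogeneous s e Q \<Longrightarrow> Q x \<noteq> 0 \<Longrightarrow>
   \<forall>\<^sub>F y in zariski_at s x. F y = P y / Q y \<Longrightarrow> rat_germ s d x F"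
  by (auto simp: rat_germ_def)

lemma rat_germE:
  assumes "rat_germ s d x F"
  obtains e P Q where "homogeneous s (d + e) P" "homogeneous s e Q" "Q x \<noteq> 0"
    "\<forall>\<^sub>F y in zariski_at s x. Q y \<noteq> 0 \<and> F y = P y / Q y"
proof -
  obtain e P Q where 1: "homogeneous s (d + e) P" "homogeneous s e Q" "Q x \<noteq> 0"
    "\<forall>\<^sub>F y in zariski_at s x. F y = P y / Q y"
    using assms by (auto simp: rat_germ_def)
  show thesis
    using that[OF 1(1-3)] eventually_conj[OF eventually_homogeneous_nonzero[OF 1(2,3)] 1(4)] by simp
qed

lemma rat_germ_cong:
  assumes "rat_germ s d x F" "\<forall>\<^sub>F y in zariski_at s x. G y = F y"
  shows "rat_germ s d x G"
proof -
  obtain e P Q where 1: "homogeneous s (d + e) P" "homogeneous s e Q" "Q x \<noteq> 0"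
    "\<forall>\<^sub>F y in zariski_at s x. F y = P y / Q y"
    using assms by (auto simp: rat_germ_def)
  show ?thesis
    by (rule rat_germI[OF 1(1-3)]) (use 1(4) assms(2) in eventually_elim, simp)
qed

lemma rat_germ_homogeneous: "homogeneous s d P \<Longrightarrow> rat_germ s d x P"
  by (rule rat_germI[where e=0 and Q="\<lambda>_. 1"]) (auto intro: homogeneous_const)

lemma rat_germ_const: "rat_germ s 0 x (\<lambda>_. c)"
  by (rule rat_germ_homogeneous[OF homogeneous_const])

lemma rat_germ_zero: "rat_germ s d x (\<lambda>_. 0)"
  by (rule rat_germ_homogeneous[OF homogeneous_zero])

lemma rat_germ_add:
  assumes "rat_germ s d x F" "rat_germ s d x G"
  shows "rat_germ s d x (\<lambda>y. F y + G y)"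
proof -
  obtain e P Q where 1: "homogeneous s (d + e) P" "homogeneous s e Q" "Q x \<noteq> 0"
    "\<forall>\<^sub>F y in zariski_at s x. Q y \<noteq> 0 \<and> F y = P y / Q y" by (rule rat_germE[OF assms(1)])
  obtain e' P' Q' where 2: "homogeneous s (d + e') P'" "homogeneous s e' Q'" "Q' x \<noteq> 0"
    "\<forall>\<^sub>F y in zariski_at s x. Q' y \<noteq> 0 \<and> G y = P' y / Q' y" by (rule rat_germE[OF assms(2)])
  show ?thesis
  proof (rule rat_germI)
    show "homogeneous s (d + (e + e')) (\<lambda>y. P y * Q' y + P' y * Q y)"
      using homogeneous_mult[OF 1(1) 2(2)] homogeneous_mult[OF 2(1) 1(2)]
      by (intro homogeneous_add) (simp_all add: ac_simps)
    show "homogeneous s (e + e') (\<lambda>y. Q y * Q' y)" by (rule homogeneous_mult[OF 1(2) 2(2)])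
    show "Q x * Q' x \<noteq> 0" using 1 2 by simp
    show "\<forall>\<^sub>F y in zariski_at s x. F y + G y = (P y * Q' y + P' y * Q y) / (Q y * Q' y)"
      using 1(4) 2(4) by eventually_elim (simp add: add_frac_eq)
  qed
qed

lemma rat_germ_mult:
  assumes "rat_germ s d x F" "rat_germ s d' x G"
  shows "rat_germ s (d + d') x (\<lambda>y. F y * G y)"
proof -
  obtain e P Q where 1: "homogeneous s (d + e) P" "homogeneous s e Q" "Q x \<noteq> 0"
    "\<forall>\<^sub>F y in zariski_at s x. Q y \<noteq> 0 \<and> F y = P y / Q y" by (rule rat_germE[OF assms(1)])
  obtain e' P' Q' where 2: "homogeneous s (d' + e') P'" "homogeneous s e' Q'" "Q' x \<noteq> 0"
    "\<forall>\<^sub>F y in zariski_at s x. Q' y \<noteq> 0 \<and> G y = P' y / Q' y" by (rule rat_germE[OF assms(2)])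
  show ?thesis
  proof (rule rat_germI)
    show "homogeneous s ((d + d') + (e + e')) (\<lambda>y. P y * P' y)"
      using homogeneous_mult[OF 1(1) 2(1)] by (simp add: ac_simps)
    show "homogeneous s (e + e') (\<lambda>y. Q y * Q' y)" by (rule homogeneous_mult[OF 1(2) 2(2)])
    show "Q x * Q' x \<noteq> 0" using 1 2 by simp
    show "\<forall>\<^sub>F y in zariski_at s x. F y * G y = (P y * P' y) / (Q y * Q' y)"
      using 1(4) 2(4) by eventually_elim simp
  qed
qed

lemma rat_germ_sum:
  "(\<And>i. i \<in> I \<Longrightarrow> rat_germ s d x (F i)) \<Longrightarrow> rat_germ s d x (\<lambda>y. \<Sum>i\<in>I. F i y)"
  by (induction I rule: infinite_finite_induct) (auto intro: rat_germ_zero rat_germ_add)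

lemma rat_germ_divide_homogeneous:
  assumes "rat_germ s (d + k) x F" "homogeneous s k R" "R x \<noteq> 0"
  shows "rat_germ s d x (\<lambda>y. F y / R y)"
proof -
  obtain e P Q where 1: "homogeneous s (d + k + e) P" "homogeneous s e Q" "Q x \<noteq> 0"
    "\<forall>\<^sub>F y in zariski_at s x. Q y \<noteq> 0 \<and> F y = P y / Q y" by (rule rat_germE[OF assms(1)])
  show ?thesis
  proof (rule rat_germI)
    show "homogeneous s (d + (k + e)) P" using 1(1) by (simp add: ac_simps)
    show "homogeneous s (k + e) (\<lambda>y. R y * Q y)" by (rule homogeneous_mult[OF assms(2) 1(2)])
    show "R x * Q x \<noteq> 0" using 1 assms by simp
    show "\<forall>\<^sub>F y in zariski_at s x. F y / R y = P y / (R y * Q y)"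
      using 1(4) by eventually_elim simp
  qed
qed

lemma rat_germ_comp:
  assumes g: "\<And>e Q. homogeneous s' e Q \<Longrightarrow> homogeneous s (k * e) (\<lambda>y. Q (g y))"
    and F: "rat_germ s' d (g x) F"
  shows "rat_germ s (k * d) x (\<lambda>y. F (g y))"
proof -
  obtain e P Q where 1: "homogeneous s' (d + e) P" "homogeneous s' e Q" "Q (g x) \<noteq> 0"
    "\<forall>\<^sub>F y in zariski_at s' (g x). F y = P y / Q y" using F by (auto simp: rat_germ_def)
  show ?thesis
  proof (rule rat_germI)
    show "homogeneous s (k * d + k * e) (\<lambda>y. P (g y))" using g[OF 1(1)] by (simp add: algebra_simps)
    show "homogeneous s (k * e) (\<lambda>y. Q (g y))" by (rule g[OF 1(2)])
    show "Q (g x) \<noteq> 0" by fact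
    show "\<forall>\<^sub>F y in zariski_at s x. F (g y) = P (g y) / Q (g y)"
      by (rule eventually_zariski_at_comp[where P="\<lambda>y. F y = P y / Q y" and g=g, OF _ 1(4)]) (use g in blast)
  qed
qed

locale char0_space = vector_space s
  for s :: "'k::field_char_0 \<Rightarrow> 'v::ab_group_add \<Rightarrow> 'v"
begin

lemma is_vector_space: "vector_space s" by unfold_locales

lemma nonzero_functional:
  assumes "x \<noteq> 0"
  obtains f where "Vector_Spaces.linear s (*) f" "f x = (1::'k)"
proof -
  interpret K: vector_space "(*) :: 'k \<Rightarrow> 'k \<Rightarrow> 'k" by unfold_locales (auto simp: algebra_simps)
  interpret VK: vector_space_pair s "(*) :: 'k \<Rightarrow> 'k \<Rightarrow> 'k" ..
  show thesis
    using VK.linear_independent_extend[of "{x}" "\<lambda>_. 1"] assms that by (auto simp: dependent_single)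
qed

lemma eventually_nonzero: "x \<noteq> 0 \<Longrightarrow> \<forall>\<^sub>F y in zariski_at s x. y \<noteq> 0"
proof -
  assume "x \<noteq> 0"
  then obtain f where f: "Vector_Spaces.linear s (*) f" "f x = (1::'k)" by (rule nonzero_functional)
  have "\<forall>\<^sub>F y in zariski_at s x. f y \<noteq> 0"
    by (rule eventually_homogeneous_nonzero[OF homogeneous_linear[OF f(1)]]) (simp add: f)
  then show ?thesis
    by eventually_elim (use f(1) in \<open>auto simp: Vector_Spaces.linear_iff\<close>,
      metis add_cancel_right_right)
qed

text \<open>
  This reduces statements about points of the projective space to statements about nonzero
  vectors; \<open>ball_open_iff\<close> below does the same for points of an open set.
\<close>

lemma proj_points_iff: "l \<in> proj_points s \<longleftrightarrow> (\<exists>x. x \<noteq> 0 \<and> l = span {x})"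
proof
  assume "l \<in> proj_points s"
  then have l: "subspace l" "dim l = 1" by (auto simp: proj_points_def)
  obtain B where B: "B \<subseteq> l" "independent B" "l \<subseteq> span B" "card B = dim l" using basis_exists by blast
  then obtain x where "B = {x}" using l(2) card_1_singletonE by metis
  with B l have "x \<noteq> 0" "l = span {x}"
    using span_minimal[of "{x}" l] by (auto simp: dependent_single)
  then show "\<exists>x. x \<noteq> 0 \<and> l = span {x}" by blast
next
  assume "\<exists>x. x \<noteq> 0 \<and> l = span {x}"
  then obtain x where x: "x \<noteq> 0" "l = span {x}" by blast
  have "dim {x} = card {x}" by (rule dim_eq_card_independent) (simp add: dependent_single x)
  with x show "l \<in> proj_points s" by (simp add: proj_points_def)
qed

lemma span_in_proj_points: "x \<noteq> 0 \<Longrightarrow> span {x} \<in> proj_points s"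
  by (auto simp: proj_points_iff)

lemma in_span_singleton: "y \<in> span {x} \<longleftrightarrow> (\<exists>c. y = s c x)"
  by (auto simp: span_singleton)

lemma span_scale_eq: "c \<noteq> 0 \<Longrightarrow> span {s c x} = span {x}"
proof -
  assume c: "c \<noteq> 0"
  have "s c x \<in> span {x}" by (auto simp: in_span_singleton)
  moreover have "x \<in> span {s c x}"
    using c by (auto simp: in_span_singleton intro!: exI[of _ "inverse c"])
  ultimately show ?thesis by (simp add: span_minimal subset_antisym)
qed

lemma proj_point_eq_span: "l \<in> proj_points s \<Longrightarrow> x \<in> l \<Longrightarrow> x \<noteq> 0 \<Longrightarrow> l = span {x}"
proof -
  assume l: "l \<in> proj_points s" "x \<in> l" "x \<noteq> 0"
  then obtain z where z: "l = span {z}" using proj_points_iff by blast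
  then obtain c where "x = s c z" using l(2) in_span_singleton by blast
  then show ?thesis using span_scale_eq[of c z] l(3) z by auto
qed

lemma zero_in_proj_point: "span {0} \<notin> proj_points s"
  using in_span_singleton by (metis proj_points_iff scale_zero_right span_base singletonI)

definition basic_open :: "('v \<Rightarrow> 'k) \<Rightarrow> 'v set set" where
  "basic_open Q = {span {x} |x. x \<noteq> 0 \<and> Q x \<noteq> 0}"

lemma span_in_basic_open:
  "homogeneous s e Q \<Longrightarrow> span {x} \<in> basic_open Q \<longleftrightarrow> x \<noteq> 0 \<and> Q x \<noteq> 0"
proof
  assume Q: "homogeneous s e Q" and "span {x} \<in> basic_open Q"
  then obtain y where y: "span {x} = span {y}" "y \<noteq> 0" "Q y \<noteq> 0" by (auto simp: basic_open_def)
  then obtain c where c: "y = s c x" using in_span_singleton[of y x] span_base[of y "{y}"] by auto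
  have "c \<noteq> 0" using c y by auto
  show "x \<noteq> 0 \<and> Q x \<noteq> 0" using c y Q by (auto simp: homogeneous_def)
qed (auto simp: basic_open_def)

text \<open>
  Closed sets are cut out by families of homogeneous functions. A function of the family that is
  nonzero at \<open>x\<close> provides a basic neighbourhood; for the converse, the family of all
  homogeneous functions that vanish on the complement defines it.
\<close>

lemma zariski_open_iff:
  "zariski_open s U \<longleftrightarrow> U \<subseteq> proj_points s \<and>
     (\<forall>x. x \<noteq> 0 \<longrightarrow> span {x} \<in> U \<longrightarrow> (\<forall>\<^sub>F y in zariski_at s x. span {y} \<in> U))"
proof safe
  assume U: "zariski_open s U"
  then show "l \<in> U \<Longrightarrow> l \<in> proj_points s" for l by (auto simp: zariski_open_def)
  fix x assume x: "x \<noteq> 0" "span {x} \<in> U"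
  obtain S where S: "\<And>f. f \<in> S \<Longrightarrow> \<exists>d. homogeneous s d f"
    "proj_points s - U = {l \<in> proj_points s. \<forall>f\<in>S. \<forall>x\<in>l - {0}. f x = 0}"
    using U by (auto simp: zariski_open_def zariski_closed_def)
  obtain f y where f: "f \<in> S" "y \<in> span {x}" "y \<noteq> 0" "f y \<noteq> 0"
    using S(2) x span_in_proj_points[OF x(1)] by blast
  obtain d where d: "homogeneous s d f" using S(1) f(1) by blast
  have "f x \<noteq> 0" using f(2,4) d by (auto simp: in_span_singleton homogeneous_def)
  have "\<forall>\<^sub>F z in zariski_at s x. f z \<noteq> 0"
    by (rule eventually_homogeneous_nonzero[OF d]) fact
  with eventually_nonzero[OF x(1)] show "\<forall>\<^sub>F y in zariski_at s x. span {y} \<in> U"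
  proof eventually_elim
    case (elim z)
    then show ?case using S(2) f(1) span_in_proj_points[OF elim(1)] span_base[of z "{z}"] by blast
  qed
next
  assume U: "U \<subseteq> proj_points s"
    and *: "\<forall>x. x \<noteq> 0 \<longrightarrow> span {x} \<in> U \<longrightarrow> (\<forall>\<^sub>F y in zariski_at s x. span {y} \<in> U)"
  define S where "S = {f. (\<exists>d. homogeneous s d f) \<and> (\<forall>l\<in>proj_points s - U. \<forall>x\<in>l-{0}. f x = 0)}"
  have "l \<notin> U" if l: "l \<in> proj_points s" "\<forall>f\<in>S. \<forall>x\<in>l - {0}. f x = 0" for l
  proof
    assume "l \<in> U"
    obtain x where x: "x \<noteq> 0" "l = span {x}" using l proj_points_iff by blast
    then have "\<forall>\<^sub>F y in zariski_at s x. span {y} \<in> U" using * \<open>l \<in> U\<close> by blast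
    then obtain e Q where Q: "homogeneous s e Q" "Q x \<noteq> 0" "\<And>y. Q y \<noteq> 0 \<Longrightarrow> span {y} \<in> U"
      by (auto simp: eventually_zariski_at)
    have "Q \<in> S" using Q(1,3) proj_point_eq_span by (fastforce simp: S_def)
    then show False using l(2) x Q(2) span_base[of x "{x}"] by blast
  qed
  then have "proj_points s - U = {l \<in> proj_points s. \<forall>f\<in>S. \<forall>x\<in>l - {0}. f x = 0}"
    unfolding S_def by blast
  moreover have "\<forall>f\<in>S. \<exists>d. homogeneous s d f" by (auto simp: S_def)
  ultimately show "zariski_open s U"
    unfolding zariski_open_def zariski_closed_def by (intro conjI exI[of _ S] U)
qed

lemma zariski_openD:
  "zariski_open s U \<Longrightarrow> span {x} \<in> U \<Longrightarrow> \<forall>\<^sub>F y in zariski_at s x. span {y} \<in> U"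
proof -
  assume U: "zariski_open s U" "span {x} \<in> U"
  then have "x \<noteq> 0" using zero_in_proj_point by (auto simp: zariski_open_def)
  with U show ?thesis by (simp add: zariski_open_iff)
qed

lemma basic_open_open: "homogeneous s e Q \<Longrightarrow> zariski_open s (basic_open Q)"
proof -
  assume Q: "homogeneous s e Q"
  have "\<forall>\<^sub>F y in zariski_at s x. span {y} \<in> basic_open Q"
    if x: "x \<noteq> 0" "span {x} \<in> basic_open Q" for x
  proof -
    have "Q x \<noteq> 0" using x(2) span_in_basic_open[OF Q] by blast
    from eventually_nonzero[OF x(1)] eventually_homogeneous_nonzero[OF Q this] show ?thesis
      by eventually_elim (simp add: span_in_basic_open[OF Q])
  qed
  moreover have "basic_open Q \<subseteq> proj_points s"
    using span_in_proj_points by (auto simp: basic_open_def)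
  ultimately show ?thesis by (simp add: zariski_open_iff)
qed

lemma zariski_nbhd:
  assumes "\<forall>\<^sub>F y in zariski_at s x. R y" "x \<noteq> 0"
  obtains U where "zariski_open s U" "span {x} \<in> U" "\<And>y. span {y} \<in> U \<Longrightarrow> y \<noteq> 0 \<and> R y"
    "U \<subseteq> proj_points s"
proof -
  obtain e Q where Q: "homogeneous s e Q" "Q x \<noteq> 0" "\<And>y. Q y \<noteq> 0 \<Longrightarrow> R y"
    using assms by (auto simp: eventually_zariski_at)
  show thesis
  proof (rule that[OF basic_open_open[OF Q(1)]])
    show "basic_open Q \<subseteq> proj_points s"
      using basic_open_open[OF Q(1)] by (simp add: zariski_open_def)
  qed (use Q(2,3) assms(2) in \<open>auto simp: span_in_basic_open[OF Q(1)]\<close>)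
qed

text \<open>
  The definitions of regular functions and of sections of \<open>\<O>(d)\<close> have the same
  local condition, with \<open>d = 0\<close> for functions.
\<close>

lemma local_fraction_iff:
  assumes U: "zariski_open s U" "span {x} \<in> U"
  shows "(\<exists>U' e P Q. zariski_open s U' \<and> span {x} \<in> U' \<and> U' \<subseteq> U \<and>
            homogeneous s (d + e) P \<and> homogeneous s e Q \<and>
            (\<forall>m\<in>U'. \<forall>y\<in>m - {0}. Q y \<noteq> 0 \<and> G m y = P y / Q y)) \<longleftrightarrow>
         rat_germ s d x (\<lambda>y. G (span {y}) y)" (is "?L \<longleftrightarrow> ?R")
proof
  have x0: "x \<noteq> 0" using U zero_in_proj_point by (auto simp: zariski_open_def)
  assume ?L
  then obtain U' e P Q where *: "zariski_open s U'" "span {x} \<in> U'"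
    "homogeneous s (d + e) P" "homogeneous s e Q"
    "\<forall>m\<in>U'. \<forall>y\<in>m - {0}. Q y \<noteq> 0 \<and> G m y = P y / Q y" by blast
  show ?R
  proof (rule rat_germI[OF *(3,4)])
    show "Q x \<noteq> 0" using *(2,5) x0 span_base[of x "{x}"] by blast
    show "\<forall>\<^sub>F y in zariski_at s x. G (span {y}) y = P y / Q y"
      using zariski_openD[OF *(1,2)] eventually_nonzero[OF x0]
      by eventually_elim (use *(5) span_base in blast)
  qed
next
  have x0: "x \<noteq> 0" using U zero_in_proj_point by (auto simp: zariski_open_def)
  assume ?R
  then obtain e P Q where 1: "homogeneous s (d + e) P" "homogeneous s e Q" "Q x \<noteq> 0"
    "\<forall>\<^sub>F y in zariski_at s x. Q y \<noteq> 0 \<and> G (span {y}) y = P y / Q y" by (rule rat_germE)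
  obtain U' where U': "zariski_open s U'" "span {x} \<in> U'" "U' \<subseteq> proj_points s"
     "\<And>y. span {y} \<in> U' \<Longrightarrow> y \<noteq> 0 \<and> (Q y \<noteq> 0 \<and> G (span {y}) y = P y / Q y) \<and> span {y} \<in> U"
    by (rule zariski_nbhd[OF eventually_conj[OF 1(4) zariski_openD[OF U]] x0]) (rule that)
  have "m \<in> U \<and> (\<forall>y\<in>m - {0}. Q y \<noteq> 0 \<and> G m y = P y / Q y)" if "m \<in> U'" for m
  proof -
    have m: "m \<in> proj_points s" using U' that by blast
    then obtain z where z: "m = span {z}" using proj_points_iff by blast
    have "Q y \<noteq> 0 \<and> G m y = P y / Q y" if y: "y \<in> m - {0}" for y
      using U'(4)[of y] \<open>m \<in> U'\<close> proj_point_eq_span[OF m, of y] y by auto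
    moreover have "m \<in> U" using U'(4)[of z] \<open>m \<in> U'\<close> z by simp
    ultimately show ?thesis by blast
  qed
  then have "U' \<subseteq> U" "\<forall>m\<in>U'. \<forall>y\<in>m - {0}. Q y \<noteq> 0 \<and> G m y = P y / Q y" by blast+
  with U'(1,2) 1(1,2) show ?L
    by (intro exI[of _ U'] exI[of _ e] exI[of _ P] exI[of _ Q] conjI)
qed

lemma ball_open_iff:
  assumes "zariski_open s U"
  shows "(\<forall>l\<in>U. A l) \<longleftrightarrow> (\<forall>x. span {x} \<in> U \<longrightarrow> A (span {x}))"
proof -
  have "\<exists>x. l = span {x}" if "l \<in> U" for l
    using assms that proj_points_iff[of l] by (auto simp: zariski_open_def)
  then show ?thesis by metis
qed

lemma regular_proj_space_iff:
  assumes "zariski_open s U"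
  shows "regular (proj_space s) U f \<longleftrightarrow>
    (\<forall>x. span {x} \<in> U \<longrightarrow> rat_germ s 0 x (\<lambda>y. f (span {y})))"
proof -
  have "regular (proj_space s) U f \<longleftrightarrow>
    (\<forall>x. span {x} \<in> U \<longrightarrow> (\<exists>U' e P Q. zariski_open s U' \<and> span {x} \<in> U' \<and> U' \<subseteq> U \<and>
            homogeneous s (0 + e) P \<and> homogeneous s e Q \<and>
            (\<forall>m\<in>U'. \<forall>y\<in>m - {0}. Q y \<noteq> 0 \<and> f m = P y / Q y)))"
    by (simp add: proj_space_def ball_open_iff[OF assms])
  also have "\<dots> \<longleftrightarrow> (\<forall>x. span {x} \<in> U \<longrightarrow> rat_germ s 0 x (\<lambda>y. f (span {y})))"
    by (intro all_cong1 imp_cong refl local_fraction_iff[OF assms, where d=0 and G="\<lambda>m y. f m"])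
  finally show ?thesis .
qed

lemma sections_twisting_iff:
  assumes "zariski_open s U"
  shows "sections (twisting_bundle s d) U t \<longleftrightarrow>
    (\<forall>l\<in>U. t l \<in> fibre (twisting_bundle s d) l) \<and>
    (\<forall>x. span {x} \<in> U \<longrightarrow> rat_germ s d x (\<lambda>y. t (span {y}) y))"
proof -
  have "(\<forall>l\<in>U. \<exists>U' e P Q. zariski_open s U' \<and> l \<in> U' \<and> U' \<subseteq> U \<and>
            homogeneous s (d + e) P \<and> homogeneous s e Q \<and>
            (\<forall>m\<in>U'. \<forall>y\<in>m - {0}. Q y \<noteq> 0 \<and> t m y = P y / Q y)) \<longleftrightarrow>
    (\<forall>x. span {x} \<in> U \<longrightarrow> rat_germ s d x (\<lambda>y. t (span {y}) y))"
    unfolding ball_open_iff[OF assms, of "\<lambda>l. \<exists>U' e P Q. zariski_open s U' \<and> l \<in> U' \<and> U' \<subseteq> U \<and>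
            homogeneous s (d + e) P \<and> homogeneous s e Q \<and>
            (\<forall>m\<in>U'. \<forall>y\<in>m - {0}. Q y \<noteq> 0 \<and> t m y = P y / Q y)"]
    by (intro all_cong1 imp_cong refl local_fraction_iff[OF assms])
  then show ?thesis by (simp add: twisting_bundle_def)
qed

end

section \<open>Directional derivatives of polynomial functions\<close>

lemma poly_fun_along_line:
  assumes "poly_fun s f"
  shows "\<exists>p. \<forall>t. f (x + s t u) = poly p t"
  using assms
proof induction
  case (const c)
  show ?case by (rule exI[of _ "[:c:]"]) simp
next
  case (linear f)
  then show ?case
    by (intro exI[of _ "[:f x, f u:]"]) (simp add: Vector_Spaces.linear_iff algebra_simps)
next
  case (add f g)
  then obtain p q where "\<forall>t. f (x + s t u) = poly p t" "\<forall>t. g (x + s t u) = poly q t" by blast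
  then show ?case by (intro exI[of _ "p + q"]) simp
next
  case (mult f g)
  then obtain p q where "\<forall>t. f (x + s t u) = poly p t" "\<forall>t. g (x + s t u) = poly q t" by blast
  then show ?case by (intro exI[of _ "p * q"]) simp
qed

text \<open>
  A polynomial function restricted to a line is a polynomial in one variable, so no limit is
  involved.
\<close>

definition dir_deriv :: "('k::field_char_0 \<Rightarrow> 'v::ab_group_add \<Rightarrow> 'v) \<Rightarrow> ('v \<Rightarrow> 'k) \<Rightarrow> 'v \<Rightarrow> 'v \<Rightarrow> 'k" where
  "dir_deriv s f x u = (THE c. \<exists>p. (\<forall>t. f (x + s t u) = poly p t) \<and> c = poly (pderiv p) 0)"

lemma dir_deriv_eqI:
  assumes "\<And>t. f (x + s t u) = poly p t"
  shows "dir_deriv s f x u = poly (pderiv p) 0"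
  unfolding dir_deriv_def
proof (rule the_equality)
  show "\<exists>q. (\<forall>t. f (x + s t u) = poly q t) \<and> poly (pderiv p) 0 = poly (pderiv q) 0"
    using assms by blast
next
  fix c assume "\<exists>q. (\<forall>t. f (x + s t u) = poly q t) \<and> c = poly (pderiv q) 0"
  then obtain q where q: "\<forall>t. f (x + s t u) = poly q t" "c = poly (pderiv q) 0" by blast
  then have "poly q = poly p" using assms by auto
  then show "c = poly (pderiv p) 0" using q(2) by (simp add: poly_eq_poly_eq_iff)
qed

context char0_space begin

lemma poly_line:
  assumes "poly_fun s f"
  obtains p where "\<And>t. f (x + s t u) = poly p t" "poly p 0 = f x" "dir_deriv s f x u = poly (pderiv p) 0"
proof -
  obtain p where p: "\<And>t. f (x + s t u) = poly p t" using poly_fun_along_line[OF assms] by blast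
  show thesis using that[of p] p dir_deriv_eqI[of f x s u p] p[of 0] by simp
qed

lemma dir_deriv_const: "dir_deriv s (\<lambda>_. c) x u = 0"
  using dir_deriv_eqI[of "\<lambda>_. c" x s u "[:c:]"] by (simp add: pderiv_pCons)

lemma dir_deriv_linear: "Vector_Spaces.linear s (*) f \<Longrightarrow> dir_deriv s f x u = f u"
  using dir_deriv_eqI[of f x s u "[:f x, f u:]"]
  by (simp add: Vector_Spaces.linear_iff algebra_simps pderiv_pCons)

lemma dir_deriv_add:
  assumes "poly_fun s f" "poly_fun s g"
  shows "dir_deriv s (\<lambda>y. f y + g y) x u = dir_deriv s f x u + dir_deriv s g x u"
proof -
  obtain p where p: "\<And>t. f (x + s t u) = poly p t" "poly p 0 = f x" "dir_deriv s f x u = poly (pderiv p) 0"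
    using poly_line[OF assms(1), where x=x and u=u] by blast
  obtain q where q: "\<And>t. g (x + s t u) = poly q t" "poly q 0 = g x" "dir_deriv s g x u = poly (pderiv q) 0"
    using poly_line[OF assms(2), where x=x and u=u] by blast
  show ?thesis using dir_deriv_eqI[of "\<lambda>y. f y + g y" x s u "p + q"] p q by (simp add: pderiv_add)
qed

lemma dir_deriv_mult:
  assumes "poly_fun s f" "poly_fun s g"
  shows "dir_deriv s (\<lambda>y. f y * g y) x u = dir_deriv s f x u * g x + f x * dir_deriv s g x u"
proof -
  obtain p where p: "\<And>t. f (x + s t u) = poly p t" "poly p 0 = f x" "dir_deriv s f x u = poly (pderiv p) 0"
    using poly_line[OF assms(1), where x=x and u=u] by blast
  obtain q where q: "\<And>t. g (x + s t u) = poly q t" "poly q 0 = g x" "dir_deriv s g x u = poly (pderiv q) 0"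
    using poly_line[OF assms(2), where x=x and u=u] by blast
  show ?thesis using dir_deriv_eqI[of "\<lambda>y. f y * g y" x s u "p * q"] p q
    by (simp add: pderiv_mult algebra_simps)
qed

lemma dir_deriv_diff:
  assumes "poly_fun s f" "poly_fun s g"
  shows "dir_deriv s (\<lambda>y. f y - g y) x u = dir_deriv s f x u - dir_deriv s g x u"
  using dir_deriv_add[OF assms(1) poly_fun_uminus[OF assms(2)]]
    dir_deriv_mult[OF poly_fun.const assms(2), of "-1" x u] dir_deriv_const[of "-1" x u] by simp

lemma poly_fun_dir_deriv: "poly_fun s f \<Longrightarrow> poly_fun s (\<lambda>x. dir_deriv s f x u)"
proof (induction rule: poly_fun.induct)
  case (const c)
  show ?case by (simp add: dir_deriv_const poly_fun.const)
next
  case (linear f)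
  then show ?case by (simp add: dir_deriv_linear poly_fun.const)
next
  case (add f g)
  then show ?case by (simp add: dir_deriv_add poly_fun.add)
next
  case (mult f g)
  then show ?case by (simp add: dir_deriv_mult poly_fun.intros)
qed

lemma dir_deriv_direction_add:
  "poly_fun s f \<Longrightarrow> dir_deriv s f x (u + u') = dir_deriv s f x u + dir_deriv s f x u'"
proof (induction rule: poly_fun.induct)
  case (const c)
  show ?case by (simp add: dir_deriv_const)
next
  case (linear f)
  then show ?case by (simp add: dir_deriv_linear) (simp add: Vector_Spaces.linear_iff)
next
  case (add f g)
  then show ?case by (simp add: dir_deriv_add)
next
  case (mult f g)
  then show ?case by (simp add: dir_deriv_mult algebra_simps)
qed

lemma dir_deriv_direction_scale:
  "poly_fun s f \<Longrightarrow> dir_deriv s f x (s c u) = c * dir_deriv s f x u"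
proof (induction rule: poly_fun.induct)
  case (const c)
  show ?case by (simp add: dir_deriv_const)
next
  case (linear f)
  then show ?case by (simp add: dir_deriv_linear) (simp add: Vector_Spaces.linear_iff)
next
  case (add f g)
  then show ?case by (simp add: dir_deriv_add algebra_simps)
next
  case (mult f g)
  then show ?case by (simp add: dir_deriv_mult algebra_simps)
qed

lemma dir_deriv_scale_point:
  assumes f: "homogeneous s d f" and c: "c \<noteq> 0"
  shows "c * dir_deriv s f (s c x) u = c ^ d * dir_deriv s f x u"
proof -
  obtain p where p: "\<And>t. f (x + s t u) = poly p t" "poly p 0 = f x" "dir_deriv s f x u = poly (pderiv p) 0"
    using poly_line[of f x u] f by (metis homogeneous_def)
  have "f (s c x + s t u) = poly (smult (c ^ d) (pcompose p [:0, inverse c:])) t" for t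
  proof -
    have "s c x + s t u = s c (x + s (inverse c * t) u)" using c by (simp add: scale_right_distrib)
    then have "f (s c x + s t u) = c ^ d * f (x + s (inverse c * t) u)"
      using f by (simp add: homogeneous_def)
    then show ?thesis by (simp add: p(1) poly_pcompose ac_simps)
  qed
  from dir_deriv_eqI[of f "s c x" s u, OF this] show ?thesis
    using c by (simp add: p(3) pderiv_smult pderiv_pcompose poly_pcompose pderiv_pCons field_simps)
qed

text \<open>
  The derivative has degree \<open>d - 1\<close>. The linear factor brings it back to
  \<open>d\<close> and thereby also covers constants, whose derivative vanishes.
\<close>

lemma homogeneous_linear_times_dir_deriv:
  assumes f: "homogeneous s d f" and l: "Vector_Spaces.linear s (*) l"
  shows "homogeneous s d (\<lambda>x. l x * dir_deriv s f x u)"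
proof -
  have lc: "l (s c x) = c * l x" for c x using l by (simp add: Vector_Spaces.linear_iff)
  have "l (s c x) * dir_deriv s f (s c x) u = c ^ d * (l x * dir_deriv s f x u)" for c x
  proof (cases "c = 0")
    case False
    then show ?thesis using dir_deriv_scale_point[OF f False, of x u] by (simp add: lc algebra_simps)
  next
    case True
    have "dir_deriv s f x u = 0" if "d = 0"
    proof -
      have "f y = f 0" for y using f that unfolding homogeneous_def
        by (metis power_0 mult_1 scale_zero_left)
      then have "f = (\<lambda>_. f 0)" by blast
      then show ?thesis using dir_deriv_const[of "f 0" x u] by simp
    qed
    then show ?thesis using True lc[of 0 x] by (cases "d = 0") auto
  qed
  moreover have "poly_fun s (\<lambda>x. l x * dir_deriv s f x u)"
    by (rule poly_fun.mult[OF poly_fun.linear[OF l] poly_fun_dir_deriv]) (use f in \<open>simp add: homogeneous_def\<close>)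
  ultimately show ?thesis by (simp add: homogeneous_def)
qed

text \<open>
  Since \<open>(PQ' - P'Q) R = 0\<close> for a function \<open>R\<close> with \<open>R(x) \<noteq>
  0\<close>, the derivative of \<open>PQ' - P'Q\<close> vanishes at \<open>x\<close>. The terms
  that contain \<open>P(x)\<close> or \<open>P'(x)\<close> drop out.
\<close>

lemma dir_deriv_fraction_unique:
  assumes h: "poly_fun s P" "poly_fun s Q" "poly_fun s P'" "poly_fun s Q'"
    and nz: "Q x \<noteq> 0" "Q' x \<noteq> 0" and z: "P x = 0" "P' x = 0"
    and eq: "\<forall>\<^sub>F y in zariski_at s x. Q y \<noteq> 0 \<and> Q' y \<noteq> 0 \<longrightarrow> P y / Q y = P' y / Q' y"
  shows "dir_deriv s P x u / Q x = dir_deriv s P' x u / Q' x"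
proof -
  obtain e R where R: "homogeneous s e R" "R x \<noteq> 0"
    "\<And>y. R y \<noteq> 0 \<Longrightarrow> Q y \<noteq> 0 \<and> Q' y \<noteq> 0 \<longrightarrow> P y / Q y = P' y / Q' y"
    using eq by (auto simp: eventually_zariski_at)
  let ?A = "\<lambda>y. P y * Q' y - P' y * Q y" and ?B = "\<lambda>y. R y * (Q y * Q' y)"
  have pR: "poly_fun s R" using R(1) by (simp add: homogeneous_def)
  have pA: "poly_fun s ?A" "poly_fun s ?B" using h pR by (auto intro: poly_fun.intros poly_fun_diff)
  have "?A y * ?B y = 0" for y using R(3)[of y] by (auto simp: frac_eq_eq)
  then have "(\<lambda>y. ?A y * ?B y) = (\<lambda>_. 0)" by blast
  then have "0 = dir_deriv s ?A x u * ?B x + ?A x * dir_deriv s ?B x u"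
    using dir_deriv_mult[OF pA, of x u] dir_deriv_const[of 0 x u] by simp
  then have "dir_deriv s ?A x u = 0" using z nz R(2) by simp
  moreover have "dir_deriv s ?A x u = dir_deriv s P x u * Q' x - dir_deriv s P' x u * Q x"
    using h z by (simp add: dir_deriv_diff dir_deriv_mult poly_fun.intros)
  ultimately show ?thesis using nz by (simp add: frac_eq_eq)
qed

lemma rat_germ_along_line:
  assumes "rat_germ s d (x + s t0 u) F"
  shows "\<exists>p q. poly q t0 \<noteq> 0 \<and> (\<forall>t. poly q t \<noteq> 0 \<longrightarrow> F (x + s t u) = poly p t / poly q t)"
proof -
  let ?x = "x + s t0 u"
  obtain e P Q where 1: "homogeneous s (d + e) P" "homogeneous s e Q" "Q ?x \<noteq> 0"
    "\<forall>\<^sub>F y in zariski_at s ?x. F y = P y / Q y" using assms by (auto simp: rat_germ_def)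
  obtain e' R where R: "homogeneous s e' R" "R ?x \<noteq> 0" "\<And>y. R y \<noteq> 0 \<Longrightarrow> F y = P y / Q y"
    using 1(4) by (auto simp: eventually_zariski_at)
  obtain p where p: "\<And>t. P (x + s t u) = poly p t"
    using poly_fun_along_line[of s P x u] 1(1) by (auto simp: homogeneous_def)
  obtain q where q: "\<And>t. Q (x + s t u) = poly q t"
    using poly_fun_along_line[of s Q x u] 1(2) by (auto simp: homogeneous_def)
  obtain r where r: "\<And>t. R (x + s t u) = poly r t"
    using poly_fun_along_line[of s R x u] R(1) by (auto simp: homogeneous_def)
  show ?thesis
    using 1(3) R(2) R(3)[of "x + s _ u"]
    by (intro exI[of _ "p * r"] exI[of _ "q * r"]) (simp add: p q r)
qed

end


section \<open>Global sections of \<open>\<O>(2)\<close>\<close>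

text \<open>
  Write the function as a fraction \<open>p/q\<close> off a finite set, with \<open>q\<close> of
  least degree. A root of \<open>q\<close> would be a root of \<open>p\<close> by comparison with
  a fraction that is defined there, so it could be cancelled. Hence \<open>q\<close> has no root,
  and it is constant.
\<close>

lemma rational_without_poles_is_poly:
  fixes G :: "'k::{alg_closed_field, field_char_0} \<Rightarrow> 'k"
  assumes G: "\<And>t0. \<exists>p q. poly q t0 \<noteq> 0 \<and> (\<forall>t. poly q t \<noteq> 0 \<longrightarrow> G t = poly p t / poly q t)"
  shows "\<exists>g. \<forall>t. G t = poly g t"
proof -
  define R where "R p q \<longleftrightarrow> q \<noteq> 0 \<and> finite {t. G t * poly q t \<noteq> poly p t}" for p q
  have loc: "\<exists>p q. R p q \<and> poly q t0 \<noteq> 0 \<and> G t0 * poly q t0 = poly p t0" for t0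
  proof -
    obtain p q where pq: "poly q t0 \<noteq> 0" "\<forall>t. poly q t \<noteq> 0 \<longrightarrow> G t = poly p t / poly q t"
      using G by blast
    have "{t. G t * poly q t \<noteq> poly p t} \<subseteq> {t. poly q t = 0}"
    proof
      fix t assume "t \<in> {t. G t * poly q t \<noteq> poly p t}"
      then show "t \<in> {t. poly q t = 0}" using pq(2) by (cases "poly q t = 0") simp_all
    qed
    moreover have "q \<noteq> 0" using pq(1) by auto
    ultimately have "R p q" unfolding R_def using poly_roots_finite finite_subset by blast
    then show ?thesis using pq by (intro exI[of _ p] exI[of _ q]) simp
  qed
  have unique: "p * q' = p' * q" if "R p q" "R p' q'" for p q p' q'
  proof (rule ccontr)
    assume "p * q' \<noteq> p' * q"
    then have "finite {t. poly (p * q' - p' * q) t = 0}" by (intro poly_roots_finite) simp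
    moreover have "finite ({t. G t * poly q t \<noteq> poly p t} \<union> {t. G t * poly q' t \<noteq> poly p' t})"
      using that by (simp add: R_def)
    ultimately have "finite (UNIV :: 'k set)"
    proof (rule finite_subset[rotated, OF finite_UnI])
      show "UNIV \<subseteq> {t. poly (p * q' - p' * q) t = 0} \<union>
        ({t. G t * poly q t \<noteq> poly p t} \<union> {t. G t * poly q' t \<noteq> poly p' t})"
      proof
        fix t
        have "poly (p * q' - p' * q) t = 0"
          if "G t * poly q t = poly p t" "G t * poly q' t = poly p' t"
          by (simp flip: that add: algebra_simps)
        then show "t \<in> {t. poly (p * q' - p' * q) t = 0} \<union>
        ({t. G t * poly q t \<noteq> poly p t} \<union> {t. G t * poly q' t \<noteq> poly p' t})" by blast
      qed
    qed
    then show False using infinite_UNIV_char_0 by blast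
  qed
  obtain p q where pq: "R p q" and least: "\<And>p' q'. R p' q' \<Longrightarrow> degree q \<le> degree q'"
  proof -
    define m where "m = (LEAST m. \<exists>p q. R p q \<and> degree q = m)"
    have ex: "\<exists>m p q. R p q \<and> degree q = m" using loc by blast
    obtain p q where "R p q" "degree q = m" using LeastI_ex[OF ex] unfolding m_def by blast
    moreover have "m \<le> degree q'" if "R p' q'" for p' q'
      unfolding m_def by (rule Least_le) (use that in blast)
    ultimately show thesis using that by blast
  qed
  \<comment> \<open>A root of \<open>q\<close> could be cancelled, contradicting minimality.\<close>
  have "degree q = 0"
  proof (rule ccontr)
    assume "degree q \<noteq> 0"
    then obtain t1 where t1: "poly q t1 = 0" using alg_closed_imp_poly_has_root[of q] by auto
    obtain p' q' where p': "R p' q'" "poly q' t1 \<noteq> 0" using loc by blast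
    have "poly p t1 * poly q' t1 = poly p' t1 * poly q t1"
      using unique[OF pq p'(1)] by (metis poly_mult)
    then have "poly p t1 = 0" using t1 p'(2) by simp
    then obtain p1 q1 where 1: "p = [:-t1, 1:] * p1" "q = [:-t1, 1:] * q1"
      using t1 by (auto simp: poly_eq_0_iff_dvd elim!: dvdE)
    have q1: "q1 \<noteq> 0" using pq 1 by (auto simp: R_def)
    have "{t. G t * poly q1 t \<noteq> poly p1 t} \<subseteq> insert t1 {t. G t * poly q t \<noteq> poly p t}"
    proof
      fix t assume "t \<in> {t. G t * poly q1 t \<noteq> poly p1 t}"
      moreover have "G t * poly q t - poly p t = (t - t1) * (G t * poly q1 t - poly p1 t)"
        by (simp add: 1 algebra_simps)
      ultimately show "t \<in> insert t1 {t. G t * poly q t \<noteq> poly p t}" by force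
    qed
    then have "R p1 q1" using pq q1 finite_subset by (auto simp: R_def)
    then have "degree q \<le> degree q1" by (rule least)
    moreover have "degree q = Suc (degree q1)"
      unfolding 1 using q1 degree_mult_eq[of "[:-t1, 1:]" q1] by simp
    ultimately show False by simp
  qed
  then obtain c where c: "q = [:c:]" using degree_eq_zeroE by blast
  have c0: "c \<noteq> 0" using pq c by (auto simp: R_def)
  have "G t = poly (smult (inverse c) p) t" for t
  proof -
    obtain p' q' where p': "R p' q'" "poly q' t \<noteq> 0" "G t * poly q' t = poly p' t" using loc by blast
    have "poly p t * poly q' t = poly p' t * c"
      using arg_cong[OF unique[OF pq p'(1)], of "\<lambda>r. poly r t"] c by simp
    then have "poly q' t * poly p t = poly q' t * (c * G t)"
      unfolding p'(3)[symmetric] by (simp only: ac_simps)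
    then have "poly p t = c * G t" using p'(2) by simp
    then show ?thesis using c0 by simp
  qed
  then show ?thesis by blast
qed

text \<open>
  The two polynomials express a section of \<open>\<O>(2)\<close> in the two charts of the
  projective line, which bounds their degrees by 2.
\<close>

lemma poly_reciprocal_quadratic:
  fixes g h :: "'k::field_char_0 poly"
  assumes gh: "\<And>t. t \<noteq> 0 \<Longrightarrow> poly g t = t ^ 2 * poly h (1 / t)"
  shows "\<exists>c. \<forall>t. poly g t = poly g 0 + c * t + poly h 0 * t ^ 2"
proof -
  define m where "m = degree h"
  have "poly (monom 1 (Suc m) * g) t = poly (monom 1 3 * reflect_poly h) t" for t
  proof (cases "t = 0")
    case False
    have "poly (reflect_poly h) t = t ^ m * poly h (inverse t)"
      using poly_reflect_poly_nz[OF False, of h] by (simp add: m_def)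
    then show ?thesis using gh[OF False] False
      by (simp add: poly_monom eval_nat_numeral inverse_eq_divide)
  qed (simp add: poly_monom)
  then have eq: "monom 1 (Suc m) * g = monom 1 3 * reflect_poly h"
    using poly_eq_poly_eq_iff by blast
  have deg: "degree g \<le> 2"
  proof (cases "g = 0")
    case False
    then have h: "h \<noteq> 0" using eq by (auto simp: monom_eq_0_iff)
    have "Suc m + degree g = 3 + degree (reflect_poly h)"
      using arg_cong[OF eq, of degree] False h
      by (simp add: degree_mult_eq degree_monom_eq monom_eq_0_iff)
    then show ?thesis using degree_reflect_poly_le[of h] by (simp add: m_def)
  qed simp
  have g: "g = [:coeff g 0, coeff g 1, coeff g 2:]"
  proof (rule poly_eqI)
    fix i
    show "coeff g i = coeff [:coeff g 0, coeff g 1, coeff g 2:] i"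
      using deg coeff_eq_0[of g i]
      by (cases "i = 0 \<or> i = 1 \<or> i = 2") (auto simp: coeff_pCons eval_nat_numeral split: nat.splits)
  qed
  have "poly h t = poly [:coeff g 2, coeff g 1, coeff g 0:] t" if "t \<noteq> 0" for t
  proof -
    have "poly g (1 / t) = (1 / t) ^ 2 * poly h t" using gh[of "1 / t"] that by simp
    then have "poly h t = t ^ 2 * poly g (1 / t)" using that by (simp add: field_simps power2_eq_square)
    also have "\<dots> = poly [:coeff g 2, coeff g 1, coeff g 0:] t"
      using that by (subst g) (simp add: field_simps power2_eq_square)
    finally show ?thesis .
  qed
  then have "poly ([:0, 1:] * h) t = poly ([:0, 1:] * [:coeff g 2, coeff g 1, coeff g 0:]) t" for t
    by (cases "t = 0") simp_all
  then have "[:0, 1:] * h = [:0, 1:] * [:coeff g 2, coeff g 1, coeff g 0:]"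
    using poly_eq_poly_eq_iff by blast
  then have "h = [:coeff g 2, coeff g 1, coeff g 0:]" by simp
  then have "poly h 0 = coeff g 2" by simp
  then show ?thesis
    by (intro exI[of _ "coeff g 1"] allI, subst g)
       (simp add: poly_0_coeff_0 algebra_simps power2_eq_square)
qed

text \<open>
  The Jordan-von Neumann argument. The parallelogram identity only concerns the plane spanned by
  two vectors, and it makes the polarization additive.
\<close>

lemma quadratic_on_lines_imp_bilinear:
  fixes F :: "'v::ab_group_add \<Rightarrow> 'k::field_char_0"
  assumes "vector_space s"
    and hom: "\<And>c x. F (s c x) = c ^ 2 * F x"
    and line: "\<And>a b. \<exists>c. \<forall>t. F (a + s t b) = F a + c * t + F b * t ^ 2"
  shows "\<exists>B. symmetric_bilinear s (*) B \<and> (\<forall>x. F x = B x x)"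
proof -
  interpret vector_space s by fact
  define D where "D a b = F (a + b) - F a - F b" for a b
  have lineD: "F (a + s t b) = F a + D a b * t + F b * t ^ 2" for a b t
  proof -
    obtain c where c: "\<And>t. F (a + s t b) = F a + c * t + F b * t ^ 2" using line by blast
    have "D a b = c" using c[of 1] by (simp add: D_def)
    then show ?thesis using c by simp
  qed
  have sym: "D a b = D b a" for a b by (simp add: D_def add.commute)
  have par: "F (a + b) + F (a - b) = 2 * F a + 2 * F b" for a b
    using lineD[of a 1 b] lineD[of a "-1" b] by simp
  have scale: "D a (s t b) = t * D a b" for a b t
    using lineD[of a t b] by (simp add: D_def[of a "s t b"] hom)
  have add: "D a (b + c) = D a b + D a c" for a b c
  proof -
    have "F (a + b + c) + F (a + c - b) = 2 * F (a + c) + 2 * F b"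
      using par[of "a + c" b] by (simp add: algebra_simps)
    moreover have "F (a + c - b) + F (a - b - c) = 2 * F (a - b) + 2 * F c"
      using par[of "a - b" c] by (simp add: algebra_simps)
    moreover have "F (a + b + c) + F (a - b - c) = 2 * F a + 2 * F (b + c)"
      using par[of a "b + c"] by (simp add: algebra_simps)
    moreover have "F (a + b) + F (a - b) = 2 * F a + 2 * F b" by (rule par)
    ultimately have "2 * F (a + b + c) =
        2 * (F (a + b) + F (a + c) + F (b + c) - F a - F b - F c)" by algebra
    then have "F (a + b + c) = F (a + b) + F (a + c) + F (b + c) - F a - F b - F c"
      by (metis mult_left_cancel zero_neq_numeral)
    then show ?thesis by (simp add: D_def add.assoc)
  qed
  define B where "B a b = D a b / 2" for a b
  have "Vector_Spaces.linear s (*) (\<lambda>x. B x y)" for y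
    unfolding Vector_Spaces.linear_iff
  proof (intro conjI allI)
    show "vector_space s" by fact
    show "vector_space ((*) :: 'k \<Rightarrow> _)" by unfold_locales (auto simp: algebra_simps)
    show "B (a + b) y = B a y + B b y" for a b
      using add[of y a b] by (simp add: B_def sym[of _ y] add_divide_distrib)
    show "B (s c a) y = c * B a y" for a c
      using scale[of y c a] by (simp add: B_def sym[of _ y])
  qed
  moreover have "B x y = B y x" for x y by (simp add: B_def sym[of x y])
  ultimately have "symmetric_bilinear s (*) B"
    unfolding symmetric_bilinear_def by blast
  moreover have "F x = B x x" for x
  proof -
    have "s 2 x = x + x" by (metis one_add_one scale_left_distrib scale_one)
    then have "F (x + x) = 4 * F x" using hom[of 2 x] by simp
    then show ?thesis by (simp add: B_def D_def)
  qed
  ultimately show ?thesis by blast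
qed

lemma symmetric_bilinear_simps:
  assumes "symmetric_bilinear s s' B"
  shows "B (x + y) z = B x z + B y z" "B z (x + y) = B z x + B z y"
    "B (s c x) z = s' c (B x z)" "B z (s c x) = s' c (B z x)" "B x y = B y x"
proof -
  have l: "Vector_Spaces.linear s s' (\<lambda>x. B x y)" for y
    using assms by (simp add: symmetric_bilinear_def)
  show c: "B x y = B y x" for x y using assms by (simp add: symmetric_bilinear_def)
  show 1: "B (x + y) z = B x z + B y z" for x y z using l by (simp add: Vector_Spaces.linear_iff)
  show 2: "B (s c x) z = s' c (B x z)" for c x z using l by (simp add: Vector_Spaces.linear_iff)
  show "B z (x + y) = B z x + B z y" using c 1 by metis
  show "B z (s c x) = s' c (B z x)" using c 2 by metis
qed

text \<open>
  Finitely many coordinates are what makes the quadratic form a polynomial function.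
\<close>

lemma homogeneous_quadratic:
  assumes "symmetric_bilinear s (*) (B :: 'v::ab_group_add \<Rightarrow> 'v \<Rightarrow> 'k::field_char_0)"
    and fin: "finite I" and exp: "\<And>x. x = (\<Sum>i\<in>I. s (\<beta> i x) (b i))"
    and lin: "\<And>i. i \<in> I \<Longrightarrow> Vector_Spaces.linear s (*) (\<beta> i)"
  shows "homogeneous s 2 (\<lambda>x. B x x)"
proof -
  interpret L: Vector_Spaces.linear s "(*)" "\<lambda>x. B x y" for y
    using assms by (simp add: symmetric_bilinear_def)
  have "B x x = (\<Sum>i\<in>I. \<beta> i x * B (b i) x)" for x
    using arg_cong[OF exp[of x], of "\<lambda>z. B z x"] by (simp only: L.sum L.scale)
  moreover have lB: "Vector_Spaces.linear s (*) (\<lambda>x. B y x)" for y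
  proof -
    have "(\<lambda>x. B y x) = (\<lambda>x. B x y)" using assms(1) by (auto simp: symmetric_bilinear_def)
    then show ?thesis using L.linear_axioms by simp
  qed
  ultimately have "(\<lambda>x. B x x) = (\<lambda>x. \<Sum>i\<in>I. \<beta> i x * B (b i) x)" by blast
  moreover have "homogeneous s 2 (\<lambda>x. \<Sum>i\<in>I. \<beta> i x * B (b i) x)"
  proof (rule homogeneous_sum)
    fix i assume "i \<in> I"
    show "homogeneous s 2 (\<lambda>x. \<beta> i x * B (b i) x)"
      using homogeneous_mult[OF homogeneous_linear[OF lin[OF \<open>i \<in> I\<close>]] homogeneous_linear[of s "B (b i)"]]
        lB by (simp add: numeral_2_eq_2)
  qed
  ultimately show ?thesis by simp
qed

text \<open>
  On each plane the section is polynomial in each of the two affine charts of the corresponding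
  line, hence a binary quadratic form, and the polarization of a function with this property is
  bilinear. Restricting to planes reduces everything to polynomials in one variable.
\<close>

lemma global_section_O2_is_quadratic:
  fixes s :: "'k::{alg_closed_field, field_char_0} \<Rightarrow> 'v::ab_group_add \<Rightarrow> 'v"
  assumes vs: "vector_space s"
    and sec: "sections (twisting_bundle s 2) (proj_points s) t"
  shows "\<exists>B. symmetric_bilinear s (*) B \<and> (\<forall>l\<in>proj_points s. \<forall>x\<in>l. t l x = B x x)"
proof -
  interpret char0_space s by (simp add: char0_space_def vs)
  have "zariski_open s (proj_points s)"
    by (auto simp: zariski_open_iff intro: eventually_mono[OF eventually_nonzero] span_in_proj_points)
  note sec' = sec[unfolded sections_twisting_iff[OF this]]
  define F where "F x = (if x = 0 then 0 else t (span {x}) x)" for x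
  have th: "t l (s c x) = c ^ 2 * t l x" if "l \<in> proj_points s" "x \<in> l" for l c x
    using sec' that by (simp add: twisting_bundle_def)
  have F_eq: "t l x = F x" if "l \<in> proj_points s" "x \<in> l" for l x
    using that proj_point_eq_span[OF that] th[OF that, of 0] by (auto simp: F_def)
  have hom: "F (s c x) = c ^ 2 * F x" for c x
  proof (cases "x = 0")
    case False
    have "x \<in> span {x}" by (simp add: span_base)
    moreover from this have "s c x \<in> span {x}" by (rule span_scale)
    ultimately show ?thesis using th[of "span {x}" x c] F_eq[of "span {x}"] span_in_proj_points[OF False] by simp
  qed (simp add: F_def)
  have germ: "rat_germ s 2 x F" if "x \<noteq> 0" for x
  proof (rule rat_germ_cong)
    show "rat_germ s 2 x (\<lambda>y. t (span {y}) y)" using sec' span_in_proj_points[OF that] by blast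
    show "\<forall>\<^sub>F y in zariski_at s x. F y = t (span {y}) y"
      using eventually_nonzero[OF that] by eventually_elim (simp add: F_def)
  qed
  have line: "\<exists>c. \<forall>t. F (a + s t b) = F a + c * t + F b * t ^ 2" for a b
  proof (cases "b = 0 \<or> a \<in> span {b}")
    case True
    then consider "b = 0" | k where "a = s k b" using in_span_singleton by blast
    then show ?thesis
    proof cases
      case 1
      then show ?thesis by (intro exI[of _ 0]) (simp add: F_def)
    next
      case (2 k)
      have "F (a + s t b) = F a + 2 * k * F b * t + F b * t ^ 2" for t
      proof -
        have "a + s t b = s (k + t) b" by (simp add: 2 scale_left_distrib)
        then have "F (a + s t b) = (k + t) ^ 2 * F b" by (simp only: hom)
        moreover have "F a = k ^ 2 * F b" by (simp only: 2 hom)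
        ultimately show ?thesis by (simp add: power2_eq_square algebra_simps)
      qed
      then show ?thesis by blast
    qed
  next
    case False
    then have ab: "b \<noteq> 0" "a \<notin> span {b}" by auto
    have nz: "a + s t b \<noteq> 0" for t
    proof
      assume "a + s t b = 0"
      then have "a = s (- t) b" by (simp add: eq_neg_iff_add_eq_0)
      then show False using ab in_span_singleton by blast
    qed
    have nz': "b + s t a \<noteq> 0" for t
    proof
      assume 0: "b + s t a = 0"
      show False
      proof (cases "t = 0")
        case False
        have "s (inverse t) (b + s t a) = s (inverse t) b + a" using False by (simp add: scale_right_distrib)
        then show False using 0 nz[of "inverse t"] by (simp add: add.commute)
      qed (use 0 ab in auto)
    qed
    obtain g where g: "\<And>t. F (a + s t b) = poly g t"
      using rational_without_poles_is_poly[of "\<lambda>t. F (a + s t b)"]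
        rat_germ_along_line[OF germ[OF nz]] by blast
    obtain h where h: "\<And>t. F (b + s t a) = poly h t"
      using rational_without_poles_is_poly[of "\<lambda>t. F (b + s t a)"]
        rat_germ_along_line[OF germ[OF nz']] by blast
    have "poly g t = t ^ 2 * poly h (1 / t)" if "t \<noteq> 0" for t
    proof -
      have "a + s t b = s t (b + s (1 / t) a)" using that by (simp add: scale_right_distrib add.commute)
      then show ?thesis using hom[of t "b + s (1 / t) a"] by (metis g h)
    qed
    from poly_reciprocal_quadratic[OF this] show ?thesis
      using g[of 0] h[of 0] by (simp add: g)
  qed
  from quadratic_on_lines_imp_bilinear[OF vs hom line] show ?thesis using F_eq by metis
qed

text \<open>
  The homogeneous coordinates of \<open>v\<close> are quadratic forms, hence linear forms on
  \<open>Sym\<^sup>2 V\<close>. They are the coordinates of a linear map \<open>T\<close> of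
  \<open>W\<close>, and \<open>mul'\<close> is \<open>mul\<close> followed by \<open>T\<close>.
  Existence and uniqueness of coefficients with respect to the basis of global sections are
  exactly the universal property of \<open>mul'\<close>.
\<close>

lemma veronese2_symmetric_square:
  fixes sV :: "'k::{alg_closed_field, field_char_0} \<Rightarrow> 'v::ab_group_add \<Rightarrow> 'v"
    and sW :: "'k \<Rightarrow> 'w::ab_group_add \<Rightarrow> 'w"
  assumes "vector_space sV" "vector_space sW"
    and fin: "finite I" and exp: "\<And>x. x = (\<Sum>i\<in>I. sV (\<beta> i x) (b i))"
    and lin: "\<And>i. i \<in> I \<Longrightarrow> Vector_Spaces.linear sV (*) (\<beta> i)"
    and sq: "symmetric_square sV sW mul" and ver: "veronese2 sV sW v"
  shows "\<exists>mul'. symmetric_square sV sW mul' \<and>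
     (\<forall>l\<in>proj_points sV. \<forall>x\<in>l - {0}. v l = module.span sW {mul' x x})"
proof -
  interpret V: char0_space sV by (simp add: char0_space_def assms)
  interpret W: char0_space sW by (simp add: char0_space_def assms)
  interpret K: vector_space "(*) :: 'k \<Rightarrow> 'k \<Rightarrow> 'k" by unfold_locales (auto simp: algebra_simps)
  interpret WK: vector_space_pair sW "(*) :: 'k \<Rightarrow> 'k \<Rightarrow> 'k" ..
  interpret WW: vector_space_pair sW sW ..
  have op: "zariski_open sV (proj_points sV)"
    by (auto simp: V.zariski_open_iff intro: eventually_mono[OF V.eventually_nonzero] V.span_in_proj_points)
  obtain N \<sigma> w where gb: "global_basis (twisting_bundle sV 2) N \<sigma>"
    and w: "inj_on w {..<N}" "\<not> W.dependent (w ` {..<N})" "W.span (w ` {..<N}) = UNIV"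
    and v: "\<And>l x. l \<in> proj_points sV \<Longrightarrow> x \<in> l - {0} \<Longrightarrow> v l = W.span {\<Sum>i<N. sW (\<sigma> i l x) (w i)}"
    using ver unfolding veronese2_def by blast
  have pts: "points (base (twisting_bundle sV 2)) = proj_points sV"
    by (simp add: twisting_bundle_def proj_space_def)
  have "\<forall>i<N. \<exists>B. symmetric_bilinear sV (*) B \<and> (\<forall>l\<in>proj_points sV. \<forall>x\<in>l. \<sigma> i l x = B x x)"
    using gb global_section_O2_is_quadratic[OF assms(1)] unfolding global_basis_def pts by blast
  then obtain B where B: "\<And>i. i < N \<Longrightarrow> symmetric_bilinear sV (*) (B i)"
    "\<And>i l x. i < N \<Longrightarrow> l \<in> proj_points sV \<Longrightarrow> x \<in> l \<Longrightarrow> \<sigma> i l x = B i x x" by metis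
  have "\<forall>i<N. \<exists>f. Vector_Spaces.linear sW (*) f \<and> (\<forall>x y. f (mul x y) = B i x y)"
    using sq B(1) unfolding symmetric_square_def by blast
  then obtain f where f: "\<And>i. i < N \<Longrightarrow> Vector_Spaces.linear sW (*) (f i)"
    "\<And>i x y. i < N \<Longrightarrow> f i (mul x y) = B i x y" by metis
  define T where "T u = (\<Sum>i<N. sW (f i u) (w i))" for u
  have T: "Vector_Spaces.linear sW sW T"
    unfolding Vector_Spaces.linear_iff T_def
    using f(1) W.is_vector_space by (auto simp: Vector_Spaces.linear_iff W.scale_left_distrib sum.distrib W.scale_sum_right)
  \<comment> \<open>The coordinates of \<open>v\<close> on \<open>l\<close> are now those of \<open>mul' x x\<close>.\<close>
  define mul' where "mul' x y = T (mul x y)" for x y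
  have bil: "symmetric_bilinear sV sW mul"
    using sq by (simp add: symmetric_square_def)
  then have lm: "Vector_Spaces.linear sV sW (\<lambda>x. mul x y)" and cm: "mul x y = mul y x" for x y
    by (simp_all add: symmetric_bilinear_def)
  have bil': "symmetric_bilinear sV sW mul'"
    unfolding symmetric_bilinear_def mul'_def using linear_comp[OF lm T] cm by metis
  have mul'_eq: "mul' x y = (\<Sum>i<N. sW (B i x y) (w i))" for x y
    by (simp add: mul'_def T_def f(2))
  have fw: "\<exists>g. Vector_Spaces.linear sW (*) g \<and> (\<forall>i<N. g (w i) = c i)" for c :: "nat \<Rightarrow> 'k"
    using WK.linear_independent_extend[OF w(2), of "\<lambda>z. c (the_inv_into {..<N} w z)"]
    by (auto simp: the_inv_into_f_f[OF w(1)])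
  have sumg: "g (mul' x y) = (\<Sum>i<N. g (w i) * B i x y)" if g: "Vector_Spaces.linear sW (*) g" for g x y
    unfolding mul'_eq WK.linear_sum[OF g] WK.linear_scale[OF g] by (simp add: mult.commute)
  have "\<exists>!g. Vector_Spaces.linear sW (*) g \<and> (\<forall>x y. g (mul' x y) = C x y)"
    if C: "symmetric_bilinear sV (*) C" for C :: "'v \<Rightarrow> 'v \<Rightarrow> 'k"
  proof -
    define t where "t l x = (if x \<in> l then C x x else 0)" for l x
    have C2: "homogeneous sV 2 (\<lambda>x. C x x)"
      by (rule homogeneous_quadratic[OF C fin exp lin])
    have "sections (twisting_bundle sV 2) (proj_points sV) t"
      unfolding V.sections_twisting_iff[OF op]
    proof (intro conjI ballI allI impI)
      fix l assume l: "l \<in> proj_points sV"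
      have "sV c x \<in> l" if "x \<in> l" for c x
        using l that by (auto simp: V.proj_points_iff V.span_scale)
      then show "t l \<in> fibre (twisting_bundle sV 2) l"
        using C2 by (auto simp: twisting_bundle_def t_def homogeneous_def)
    next
      fix x
      show "rat_germ sV 2 x (\<lambda>y. t (V.span {y}) y)"
        using rat_germ_homogeneous[OF C2] by (simp add: t_def V.span_base)
    qed
    then obtain c where c: "\<forall>l\<in>proj_points sV. \<forall>x. t l x = (\<Sum>i<N. c i * \<sigma> i l x)"
      using gb unfolding global_basis_def pts by blast
    have diag: "C x x = (\<Sum>i<N. c i * B i x x)" for x
    proof (cases "x = 0")
      case True
      have "C 0 0 = 0" "i < N \<Longrightarrow> B i 0 0 = 0" for i
        using symmetric_bilinear_simps(3)[OF C, of 0 0 0] symmetric_bilinear_simps(3)[OF B(1), of i 0 0 0]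
        by simp_all
      then show ?thesis using True by simp
    next
      case False
      have "x \<in> V.span {x}" by (simp add: V.span_base)
      then have "C x x = (\<Sum>i<N. c i * \<sigma> i (V.span {x}) x)"
        using c V.span_in_proj_points[OF False] by (metis t_def)
      also have "\<dots> = (\<Sum>i<N. c i * B i x x)"
        by (rule sum.cong) (simp_all add: B(2) V.span_in_proj_points[OF False] \<open>x \<in> V.span {x}\<close>)
      finally show ?thesis .
    qed
    have pol: "C x y = (\<Sum>i<N. c i * B i x y)" for x y
    proof -
      have C': "2 * C x y = C (x + y) (x + y) - C x x - C y y"
        using symmetric_bilinear_simps(1,2)[OF C] symmetric_bilinear_simps(5)[OF C, of y x] by simp
      have B': "2 * B i x y = B i (x + y) (x + y) - B i x x - B i y y" if "i < N" for i
        using symmetric_bilinear_simps(1,2)[OF B(1)[OF that]]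
          symmetric_bilinear_simps(5)[OF B(1)[OF that], of y x] by simp
      have "2 * C x y = (\<Sum>i<N. c i * (B i (x + y) (x + y) - B i x x - B i y y))"
        unfolding C' diag by (simp add: algebra_simps sum_subtractf sum.distrib)
      also have "\<dots> = (\<Sum>i<N. 2 * (c i * B i x y))"
        by (rule sum.cong) (simp_all add: B'[symmetric])
      finally show ?thesis by (simp flip: sum_distrib_left)
    qed
    obtain g where g: "Vector_Spaces.linear sW (*) g" "\<forall>i<N. g (w i) = c i" using fw by blast
    show ?thesis
    proof (rule ex1I[of _ g])
      show "Vector_Spaces.linear sW (*) g \<and> (\<forall>x y. g (mul' x y) = C x y)"
        using g by (simp add: sumg pol)
      fix h assume h: "Vector_Spaces.linear sW (*) h \<and> (\<forall>x y. h (mul' x y) = C x y)"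
      define d where "d i = (if i < N then h (w i) - g (w i) else 0)" for i
      have "(\<Sum>i<N. h (w i) * B i x x) = (\<Sum>i<N. g (w i) * B i x x)" for x
        using h sumg[of h x x] sumg[OF g(1), of x x] g(2) pol[of x x] by simp
      then have d0: "(\<Sum>i<N. d i * B i x x) = 0" for x
        by (simp add: d_def algebra_simps sum_subtractf)
      have z: "sections (twisting_bundle sV 2) (proj_points sV) (\<lambda>_ _. 0)"
        unfolding V.sections_twisting_iff[OF op]
        by (auto simp: twisting_bundle_def intro: rat_germ_zero)
      have "(\<Sum>i<N. d i * \<sigma> i l x) = 0" if l: "l \<in> proj_points sV" for l x
      proof (cases "x \<in> l")
        case True
        then show ?thesis using d0[of x] B(2)[OF _ l True] by simp
      next
        case False
        have "\<sigma> i l x = 0" if "i < N" for i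
          using gb that l False V.sections_twisting_iff[OF op, of 2 "\<sigma> i"]
          unfolding global_basis_def pts by (auto simp: twisting_bundle_def)
        then show ?thesis by simp
      qed
      moreover have "\<forall>i\<ge>N. d i = 0" by (simp add: d_def)
      moreover have ex1: "\<exists>!c. (\<forall>i\<ge>N. c i = 0) \<and>
         (\<forall>l\<in>proj_points sV. \<forall>x. (0::'k) = (\<Sum>i<N. c i * \<sigma> i l x))" (is "\<exists>!c. ?P c")
        using gb z unfolding global_basis_def pts by (elim conjE allE[of _ "\<lambda>_ _. 0"]) simp
      ultimately have "(THE c. ?P c) = d" by (intro the1_equality[OF ex1] conjI ballI allI) auto
      moreover have "(THE c. ?P c) = (\<lambda>_. 0)" by (rule the1_equality[OF ex1]) simp
      ultimately have "d = (\<lambda>_. 0)" by simp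
      then have "d i = 0" for i by metis
      then have hw: "h (w i) = g (w i)" if "i < N" for i using that unfolding d_def
        by (metis eq_iff_diff_eq_0)
      show "h = g"
      proof
        fix z
        show "h z = g z"
          by (rule WK.linear_eq_on[of h g z "w ` {..<N}"]) (use h g hw w(3) in auto)
      qed
    qed
  qed
  then have "symmetric_square sV sW mul'" using bil' by (simp add: symmetric_square_def)
  moreover have "v l = W.span {mul' x x}" if "l \<in> proj_points sV" "x \<in> l - {0}" for l x
    using v[OF that] B(2)[OF _ that(1)] that(2) by (simp add: mul'_eq)
  ultimately show ?thesis by blast
qed

section \<open>Normal vectors as derivatives of local equations\<close>

context char0_space begin

lemma zariski_at_scale: "c \<noteq> 0 \<Longrightarrow> zariski_at s (s c x) = zariski_at s x"
proof -
  assume c: "c \<noteq> 0"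
  have "(\<exists>e. homogeneous s e Q) \<and> Q (s c x) \<noteq> 0 \<longleftrightarrow> (\<exists>e. homogeneous s e Q) \<and> Q x \<noteq> 0" for Q
    using c by (auto simp: homogeneous_def)
  then show ?thesis unfolding zariski_at_def by simp
qed

lemma eventually_rat_germ: "rat_germ s d x F \<Longrightarrow> \<forall>\<^sub>F y in zariski_at s x. rat_germ s d y F"
proof -
  assume "rat_germ s d x F"
  then obtain e P Q where 1: "homogeneous s (d + e) P" "homogeneous s e Q" "Q x \<noteq> 0"
    "\<forall>\<^sub>F y in zariski_at s x. F y = P y / Q y" by (auto simp: rat_germ_def)
  then obtain e' R where R: "homogeneous s e' R" "R x \<noteq> 0" "\<And>y. R y \<noteq> 0 \<Longrightarrow> F y = P y / Q y"
    by (auto simp: eventually_zariski_at)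
  from eventually_homogeneous_nonzero[OF R(1,2)] eventually_homogeneous_nonzero[OF 1(2,3)] show ?thesis
  proof eventually_elim
    case (elim y)
    show ?case
      by (rule rat_germI[OF 1(1,2) elim(2)])
         (use eventually_homogeneous_nonzero[OF R(1) elim(1)] in eventually_elim, simp add: R(3))
  qed
qed

lemma opens_proj_space [simp]: "opens (proj_space s) = zariski_open s"
  and points_proj_space [simp]: "points (proj_space s) = proj_points s"
  by (simp_all add: proj_space_def)

lemma zariski_nbhd_ball:
  assumes "\<forall>\<^sub>F y in zariski_at s x. R (span {y})" "x \<noteq> 0"
  obtains U where "zariski_open s U" "span {x} \<in> U" "\<And>p. p \<in> U \<Longrightarrow> R p"
proof -
  obtain U where U: "zariski_open s U" "span {x} \<in> U"
      "\<And>y. span {y} \<in> U \<Longrightarrow> y \<noteq> 0 \<and> R (span {y})" "U \<subseteq> proj_points s"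
    by (rule zariski_nbhd[OF assms]) (rule that)
  have "\<forall>p\<in>U. R p" unfolding ball_open_iff[OF U(1)] using U(3) by blast
  then show thesis using that U by blast
qed

lemma germ_eq_iff:
  assumes "x \<noteq> 0"
  shows "(\<exists>U. zariski_open s U \<and> span {x} \<in> U \<and> (\<forall>q\<in>U. R q)) \<longleftrightarrow>
    (\<forall>\<^sub>F y in zariski_at s x. R (span {y}))"
proof
  assume "\<exists>U. zariski_open s U \<and> span {x} \<in> U \<and> (\<forall>q\<in>U. R q)"
  then obtain U where U: "zariski_open s U" "span {x} \<in> U" "\<forall>q\<in>U. R q" by blast
  show "\<forall>\<^sub>F y in zariski_at s x. R (span {y})"
    using zariski_openD[OF U(1,2)] by eventually_elim (use U(3) in blast)
next
  assume ev: "\<forall>\<^sub>F y in zariski_at s x. R (span {y})"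
  show "\<exists>U. zariski_open s U \<and> span {x} \<in> U \<and> (\<forall>q\<in>U. R q)"
    by (rule zariski_nbhd_ball[OF ev assms]) blast
qed

lemma regular_nbhd_iff:
  assumes "x \<noteq> 0"
  shows "(\<exists>U. zariski_open s U \<and> span {x} \<in> U \<and> regular (proj_space s) U f \<and> (\<forall>q\<in>U. R q)) \<longleftrightarrow>
    rat_germ s 0 x (\<lambda>y. f (span {y})) \<and> (\<forall>\<^sub>F y in zariski_at s x. R (span {y}))"
proof
  assume "\<exists>U. zariski_open s U \<and> span {x} \<in> U \<and> regular (proj_space s) U f \<and> (\<forall>q\<in>U. R q)"
  then obtain U where U: "zariski_open s U" "span {x} \<in> U" "regular (proj_space s) U f" "\<forall>q\<in>U. R q"
    by blast
  then have "\<forall>\<^sub>F y in zariski_at s x. R (span {y})" using germ_eq_iff[OF assms, of R] by blast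
  then show "rat_germ s 0 x (\<lambda>y. f (span {y})) \<and> (\<forall>\<^sub>F y in zariski_at s x. R (span {y}))"
    using U(2,3) regular_proj_space_iff[OF U(1)] by blast
next
  assume a: "rat_germ s 0 x (\<lambda>y. f (span {y})) \<and> (\<forall>\<^sub>F y in zariski_at s x. R (span {y}))"
  obtain U where U: "zariski_open s U" "span {x} \<in> U"
      "\<And>y. span {y} \<in> U \<Longrightarrow> y \<noteq> 0 \<and> rat_germ s 0 y (\<lambda>y. f (span {y})) \<and> R (span {y})"
      "U \<subseteq> proj_points s"
    by (rule zariski_nbhd[OF eventually_conj[OF eventually_rat_germ[OF conjunct1[OF a]] conjunct2[OF a]] assms])
       (rule that)
  have "regular (proj_space s) U f" using U(3) by (simp add: regular_proj_space_iff[OF U(1)])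
  moreover have "\<forall>q\<in>U. R q" unfolding ball_open_iff[OF U(1)] using U(3) by blast
  ultimately show "\<exists>U. zariski_open s U \<and> span {x} \<in> U \<and> regular (proj_space s) U f \<and> (\<forall>q\<in>U. R q)"
    using U(1,2) by blast
qed

lemma stalk_iff:
  assumes "x \<noteq> 0"
  shows "f \<in> stalk (proj_space s) (span {x}) \<longleftrightarrow> rat_germ s 0 x (\<lambda>y. f (span {y}))"
  using regular_nbhd_iff[OF assms, of f "\<lambda>_. True"] by (simp add: stalk_def)

lemma ideal_stalk_iff:
  assumes "x \<noteq> 0"
  shows "f \<in> ideal_stalk (proj_space s) X (span {x}) \<longleftrightarrow> rat_germ s 0 x (\<lambda>y. f (span {y})) \<and>
    (\<forall>\<^sub>F y in zariski_at s x. span {y} \<in> X \<longrightarrow> f (span {y}) = 0)"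
proof -
  have "(\<forall>q\<in>U \<inter> X. f q = 0) \<longleftrightarrow> (\<forall>q\<in>U. q \<in> X \<longrightarrow> f q = 0)" for U by blast
  then show ?thesis
    using regular_nbhd_iff[OF assms, of f "\<lambda>q. q \<in> X \<longrightarrow> f q = 0"] by (simp add: ideal_stalk_def)
qed

text \<open>
  The function on points induced by a function on vectors; it is meaningful when the latter is
  constant along punctured lines.
\<close>

definition proj_fun :: "('v \<Rightarrow> 'k) \<Rightarrow> 'v set \<Rightarrow> 'k" where
  "proj_fun F l = F (SOME x. x \<in> l \<and> x \<noteq> 0)"

lemma proj_fun_span:
  assumes "\<And>c. c \<noteq> 0 \<Longrightarrow> F (s c x) = F x" "x \<noteq> 0"
  shows "proj_fun F (span {x}) = F x"
proof -
  define y where "y = (SOME y. y \<in> span {x} \<and> y \<noteq> 0)"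
  have "y \<in> span {x} \<and> y \<noteq> 0"
    unfolding y_def by (rule someI[of _ x]) (simp add: span_base assms)
  then obtain c where c: "y = s c x" "y \<noteq> 0" using in_span_singleton by blast
  then have "c \<noteq> 0" by auto
  then show ?thesis using assms(1)[of c] c(1) by (simp add: proj_fun_def flip: y_def)
qed

lemma homogeneous_fraction_scale:
  "homogeneous s d P \<Longrightarrow> homogeneous s d Q \<Longrightarrow> c \<noteq> 0 \<Longrightarrow> P (s c x) / Q (s c x) = P x / Q x"
  by (simp add: homogeneous_def)

lemma proj_fun_fraction:
  "homogeneous s d P \<Longrightarrow> homogeneous s d Q \<Longrightarrow> x \<noteq> 0 \<Longrightarrow>
   proj_fun (\<lambda>y. P y / Q y) (span {x}) = P x / Q x"
  using proj_fun_span[of "\<lambda>y. P y / Q y" x] homogeneous_fraction_scale by blast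

lemma rat_germ_proj_fun:
  assumes A: "rat_germ s 0 x A" and x: "x \<noteq> 0"
  obtains g where "g \<in> stalk (proj_space s) (span {x})"
    "\<forall>\<^sub>F y in zariski_at s x. g (span {y}) = A y"
proof -
  obtain e P Q where 1: "homogeneous s (0 + e) P" "homogeneous s e Q" "Q x \<noteq> 0"
    "\<forall>\<^sub>F y in zariski_at s x. A y = P y / Q y" using A by (auto simp: rat_germ_def)
  have ev: "\<forall>\<^sub>F y in zariski_at s x. proj_fun (\<lambda>y. P y / Q y) (span {y}) = A y"
    using eventually_nonzero[OF x] 1(4) by eventually_elim (use proj_fun_fraction 1(1,2) in simp)
  show thesis
    using that[OF _ ev] rat_germ_cong[OF A ev] by (simp add: stalk_iff[OF x])
qed

abbreviation normal_fibre :: "'v set set \<Rightarrow> 'v set \<Rightarrow> (('v set \<Rightarrow> 'k) \<Rightarrow> 'k) set" where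
  "normal_fibre X p \<equiv> fibre (normal_bundle (proj_space s) X) p"

lemma normal_fibre_iff:
  "\<theta> \<in> normal_fibre X p \<longleftrightarrow>
     (let I = ideal_stalk (proj_space s) X p in
      (\<forall>f\<in>I. \<forall>g\<in>I. (\<exists>U. zariski_open s U \<and> p \<in> U \<and> (\<forall>q\<in>U. f q = g q)) \<longrightarrow> \<theta> f = \<theta> g) \<and>
      (\<forall>f\<in>I. \<forall>g\<in>I. \<theta> (\<lambda>q. f q + g q) = \<theta> f + \<theta> g) \<and>
      (\<forall>a\<in>stalk (proj_space s) p. \<forall>f\<in>I. \<theta> (\<lambda>q. a q * f q) = a p * \<theta> f) \<and>
      (\<forall>f. f \<notin> I \<longrightarrow> \<theta> f = 0))"
  by (simp add: normal_bundle_def Let_def)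

lemma ideal_stalk_zero: "x \<noteq> 0 \<Longrightarrow> (\<lambda>_. 0) \<in> ideal_stalk (proj_space s) X (span {x})"
  by (simp add: ideal_stalk_iff rat_germ_const)

lemma ideal_stalk_add:
  assumes x: "x \<noteq> 0" and "f \<in> ideal_stalk (proj_space s) X (span {x})"
    "g \<in> ideal_stalk (proj_space s) X (span {x})"
  shows "(\<lambda>q. f q + g q) \<in> ideal_stalk (proj_space s) X (span {x})"
  using assms(2,3) unfolding ideal_stalk_iff[OF x]
  by (auto intro: rat_germ_add elim: eventually_elim2)

lemma ideal_stalk_mult:
  assumes x: "x \<noteq> 0" and "a \<in> stalk (proj_space s) (span {x})"
    "g \<in> ideal_stalk (proj_space s) X (span {x})"
  shows "(\<lambda>q. a q * g q) \<in> ideal_stalk (proj_space s) X (span {x})"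
  using assms(2,3) rat_germ_mult[of s 0 x _ 0] unfolding ideal_stalk_iff[OF x] stalk_iff[OF x]
  by (auto elim: eventually_mono)

text \<open>
  A normal vector is linear over the local ring and depends only on germs, so its value on a
  combination of equations only involves the values of the coefficients at the point.
\<close>

lemma normal_fibre_combination:
  assumes x: "x \<noteq> 0" and \<theta>: "\<theta> \<in> normal_fibre X (span {x})"
    and fin: "finite I" and a: "\<And>i. i \<in> I \<Longrightarrow> a i \<in> stalk (proj_space s) (span {x})"
    and h: "\<And>i. i \<in> I \<Longrightarrow> h i \<in> ideal_stalk (proj_space s) X (span {x})"
    and f: "f \<in> ideal_stalk (proj_space s) X (span {x})"
    and ev: "\<forall>\<^sub>F y in zariski_at s x. f (span {y}) = (\<Sum>i\<in>I. a i (span {y}) * h i (span {y}))"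
  shows "\<theta> f = (\<Sum>i\<in>I. a i (span {x}) * \<theta> (h i))"
proof -
  note \<theta>' = \<theta>[unfolded normal_fibre_iff Let_def]
  have add: "\<theta> (\<lambda>q. f q + g q) = \<theta> f + \<theta> g"
    if "f \<in> ideal_stalk (proj_space s) X (span {x})" "g \<in> ideal_stalk (proj_space s) X (span {x})" for f g
    using \<theta>' that by blast
  have mult: "\<theta> (\<lambda>q. a q * f q) = a (span {x}) * \<theta> f"
    if "a \<in> stalk (proj_space s) (span {x})" "f \<in> ideal_stalk (proj_space s) X (span {x})" for a f
    using \<theta>' that by blast
  have germ: "\<theta> f = \<theta> g"
    if "f \<in> ideal_stalk (proj_space s) X (span {x})" "g \<in> ideal_stalk (proj_space s) X (span {x})"
      "\<exists>U. zariski_open s U \<and> span {x} \<in> U \<and> (\<forall>q\<in>U. f q = g q)" for f g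
    using \<theta>' that by blast
  have zero: "\<theta> (\<lambda>_. 0) = 0" using add[OF ideal_stalk_zero[OF x] ideal_stalk_zero[OF x]] by simp
  have "(\<lambda>q. \<Sum>i\<in>J. a i q * h i q) \<in> ideal_stalk (proj_space s) X (span {x}) \<and>
    \<theta> (\<lambda>q. \<Sum>i\<in>J. a i q * h i q) = (\<Sum>i\<in>J. a i (span {x}) * \<theta> (h i))" if "J \<subseteq> I" for J
    using finite_subset[OF that fin] that
  proof (induction J rule: finite_induct)
    case empty
    then show ?case using ideal_stalk_zero[OF x] zero by simp
  next
    case (insert i J)
    have i: "(\<lambda>q. a i q * h i q) \<in> ideal_stalk (proj_space s) X (span {x})"
      by (rule ideal_stalk_mult[OF x]) (use a h insert in auto)
    show ?case using insert ideal_stalk_add[OF x i] add[OF i] mult[of "a i" "h i"] a h by simp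
  qed
  from this[OF subset_refl] have
    *: "(\<lambda>q. \<Sum>i\<in>I. a i q * h i q) \<in> ideal_stalk (proj_space s) X (span {x})"
    "\<theta> (\<lambda>q. \<Sum>i\<in>I. a i q * h i q) = (\<Sum>i\<in>I. a i (span {x}) * \<theta> (h i))" by blast+
  have "\<exists>U. zariski_open s U \<and> span {x} \<in> U \<and> (\<forall>q\<in>U. f q = (\<Sum>i\<in>I. a i q * h i q))"
    using ev germ_eq_iff[OF x, of "\<lambda>q. f q = (\<Sum>i\<in>I. a i q * h i q)"] by blast
  from germ[OF f *(1) this] show ?thesis using *(2) by simp
qed

text \<open>
  The derivative of a local equation \<open>f = P/Q\<close> in the direction \<open>u\<close>. At
  a point of \<open>X\<close> the numerator vanishes, so only \<open>P\<close> has to be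
  differentiated. The value zero off the ideal is the convention of \<open>normal_bundle\<close>.
\<close>

definition tangent :: "'v set set \<Rightarrow> 'v \<Rightarrow> 'v \<Rightarrow> ('v set \<Rightarrow> 'k) \<Rightarrow> 'k" where
  "tangent X x u f =
     (if f \<in> ideal_stalk (proj_space s) X (span {x}) then
        THE c. \<exists>d P Q. homogeneous s d P \<and> homogeneous s d Q \<and> Q x \<noteq> 0 \<and>
          (\<forall>\<^sub>F y in zariski_at s x. f (span {y}) = P y / Q y) \<and> c = dir_deriv s P x u / Q x
      else 0)"

lemma tangent_eq:
  assumes x: "x \<noteq> 0" "span {x} \<in> X" and f: "f \<in> ideal_stalk (proj_space s) X (span {x})"
    and P: "homogeneous s d P" and Q: "homogeneous s d Q" "Q x \<noteq> 0"
    and ev: "\<forall>\<^sub>F y in zariski_at s x. f (span {y}) = P y / Q y"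
  shows "P x = 0" "tangent X x u f = dir_deriv s P x u / Q x"
proof -
  have f0: "f (span {x}) = 0"
    using f[unfolded ideal_stalk_iff[OF x(1)]] eventually_zariski_at_self x(2) by blast
  have z: "P x = 0" if "Q x \<noteq> 0" "\<forall>\<^sub>F y in zariski_at s x. f (span {y}) = P y / Q y" for P Q
    using eventually_zariski_at_self[OF that(2)] f0 that(1) by simp
  show "P x = 0" by (rule z[OF Q(2) ev])
  have "(THE c. \<exists>d P Q. homogeneous s d P \<and> homogeneous s d Q \<and> Q x \<noteq> 0 \<and>
          (\<forall>\<^sub>F y in zariski_at s x. f (span {y}) = P y / Q y) \<and> c = dir_deriv s P x u / Q x) =
        dir_deriv s P x u / Q x"
  proof (rule the_equality)
    show "\<exists>d P' Q'. homogeneous s d P' \<and> homogeneous s d Q' \<and> Q' x \<noteq> 0 \<and>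
          (\<forall>\<^sub>F y in zariski_at s x. f (span {y}) = P' y / Q' y) \<and>
          dir_deriv s P x u / Q x = dir_deriv s P' x u / Q' x" using P Q ev by blast
  next
    fix c assume "\<exists>d P Q. homogeneous s d P \<and> homogeneous s d Q \<and> Q x \<noteq> 0 \<and>
          (\<forall>\<^sub>F y in zariski_at s x. f (span {y}) = P y / Q y) \<and> c = dir_deriv s P x u / Q x"
    then obtain d' P' Q' where 1: "homogeneous s d' P'" "homogeneous s d' Q'" "Q' x \<noteq> 0"
      "\<forall>\<^sub>F y in zariski_at s x. f (span {y}) = P' y / Q' y" "c = dir_deriv s P' x u / Q' x" by blast
    have "dir_deriv s P' x u / Q' x = dir_deriv s P x u / Q x"
    proof (rule dir_deriv_fraction_unique)
      show "\<forall>\<^sub>F y in zariski_at s x. Q' y \<noteq> 0 \<and> Q y \<noteq> 0 \<longrightarrow> P' y / Q' y = P y / Q y"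
        using 1(4) ev by eventually_elim simp
    qed (use 1 P Q z[OF 1(3,4)] z[OF Q(2) ev] in \<open>auto simp: homogeneous_def\<close>)
    then show "c = dir_deriv s P x u / Q x" using 1(5) by simp
  qed
  then show "tangent X x u f = dir_deriv s P x u / Q x" using f by (simp add: tangent_def)
qed

lemma ideal_stalk_fraction:
  assumes x: "x \<noteq> 0" and f: "f \<in> ideal_stalk (proj_space s) X (span {x})"
  obtains d P Q where "homogeneous s d P" "homogeneous s d Q" "Q x \<noteq> 0"
    "\<forall>\<^sub>F y in zariski_at s x. Q y \<noteq> 0 \<and> f (span {y}) = P y / Q y"
  using f[unfolded ideal_stalk_iff[OF x]] by (elim conjE rat_germE) (simp add: that)

lemma tangent_in_normal_fibre:
  assumes x: "x \<noteq> 0" "span {x} \<in> X"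
  shows "tangent X x u \<in> normal_fibre X (span {x})"
  unfolding normal_fibre_iff Let_def
proof (intro conjI ballI impI allI)
  let ?I = "ideal_stalk (proj_space s) X (span {x})"
  fix f assume f: "f \<in> ?I"
  obtain d P Q where 1: "homogeneous s d P" "homogeneous s d Q" "Q x \<noteq> 0"
    "\<forall>\<^sub>F y in zariski_at s x. Q y \<noteq> 0 \<and> f (span {y}) = P y / Q y" by (rule ideal_stalk_fraction[OF x(1) f])
  have ev1: "\<forall>\<^sub>F y in zariski_at s x. f (span {y}) = P y / Q y" using 1(4) by eventually_elim simp
  note t1 = tangent_eq[OF x f 1(1-3) ev1]
  have pf: "poly_fun s P" "poly_fun s Q" using 1 by (auto simp: homogeneous_def)
  { fix g assume g: "g \<in> ?I"
    obtain d' P' Q' where 2: "homogeneous s d' P'" "homogeneous s d' Q'" "Q' x \<noteq> 0"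
      "\<forall>\<^sub>F y in zariski_at s x. Q' y \<noteq> 0 \<and> g (span {y}) = P' y / Q' y"
      by (rule ideal_stalk_fraction[OF x(1) g])
    have ev2: "\<forall>\<^sub>F y in zariski_at s x. g (span {y}) = P' y / Q' y" using 2(4) by eventually_elim simp
    note t2 = tangent_eq[OF x g 2(1-3) ev2]
    have pf': "poly_fun s P'" "poly_fun s Q'" using 2 by (auto simp: homogeneous_def)
    { assume "\<exists>U. zariski_open s U \<and> span {x} \<in> U \<and> (\<forall>q\<in>U. f q = g q)"
      then have "\<forall>\<^sub>F y in zariski_at s x. f (span {y}) = g (span {y})"
        using germ_eq_iff[OF x(1), of "\<lambda>q. f q = g q"] by blast
      then have "\<forall>\<^sub>F y in zariski_at s x. g (span {y}) = P y / Q y"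
        using ev1 by eventually_elim simp
      then show "tangent X x u f = tangent X x u g"
        using t1(2) tangent_eq(2)[OF x g 1(1-3)] by simp }
    have "tangent X x u (\<lambda>q. f q + g q) =
        dir_deriv s (\<lambda>y. P y * Q' y + P' y * Q y) x u / (Q x * Q' x)"
    proof (rule tangent_eq(2)[OF x ideal_stalk_add[OF x(1) f g]])
      show "homogeneous s (d + d') (\<lambda>y. P y * Q' y + P' y * Q y)"
        using homogeneous_mult[OF 1(1) 2(2)] homogeneous_mult[OF 2(1) 1(2)]
        by (intro homogeneous_add) (simp_all add: add.commute)
      show "homogeneous s (d + d') (\<lambda>y. Q y * Q' y)" by (rule homogeneous_mult[OF 1(2) 2(2)])
      show "\<forall>\<^sub>F y in zariski_at s x. f (span {y}) + g (span {y}) =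
          (P y * Q' y + P' y * Q y) / (Q y * Q' y)"
        using 1(4) 2(4) by eventually_elim (simp add: add_frac_eq)
    qed (use 1 2 in simp)
    also have "\<dots> = tangent X x u f + tangent X x u g"
      using 1(3) 2(3) t1(1) t2(1) pf pf' unfolding t1(2) t2(2)
      by (simp add: dir_deriv_add dir_deriv_mult poly_fun.mult add_frac_eq)
    finally show "tangent X x u (\<lambda>q. f q + g q) = tangent X x u f + tangent X x u g" . }
  { fix a assume a: "a \<in> stalk (proj_space s) (span {x})"
    obtain e R S where 2: "homogeneous s (0 + e) R" "homogeneous s e S" "S x \<noteq> 0"
      "\<forall>\<^sub>F y in zariski_at s x. S y \<noteq> 0 \<and> a (span {y}) = R y / S y"
      using a[unfolded stalk_iff[OF x(1)]] by (rule rat_germE)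
    have pf': "poly_fun s R" using 2 by (auto simp: homogeneous_def)
    have "tangent X x u (\<lambda>q. a q * f q) = dir_deriv s (\<lambda>y. R y * P y) x u / (S x * Q x)"
    proof (rule tangent_eq(2)[OF x ideal_stalk_mult[OF x(1) a f]])
      show "homogeneous s (e + d) (\<lambda>y. R y * P y)" using homogeneous_mult[OF 2(1) 1(1)] by simp
      show "homogeneous s (e + d) (\<lambda>y. S y * Q y)" by (rule homogeneous_mult[OF 2(2) 1(2)])
      show "\<forall>\<^sub>F y in zariski_at s x. a (span {y}) * f (span {y}) = (R y * P y) / (S y * Q y)"
        using 1(4) 2(4) by eventually_elim simp
    qed (use 1 2 in simp)
    also have "\<dots> = a (span {x}) * tangent X x u f"
      using eventually_zariski_at_self[OF 2(4)] t1(1) pf pf' unfolding t1(2) by (simp add: dir_deriv_mult)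
    finally show "tangent X x u (\<lambda>q. a q * f q) = a (span {x}) * tangent X x u f" . }
qed (simp add: tangent_def)

text \<open>
  Rescaling \<open>x\<close> by \<open>c\<close> divides the tangent vector by \<open>c\<close>;
  the linear form \<open>l\<close> compensates for this, so that a constant direction
  \<open>u\<close> gives a section of the normal bundle over \<open>l \<noteq> 0\<close>.
\<close>

definition tangent_field :: "'v set set \<Rightarrow> ('v \<Rightarrow> 'k) \<Rightarrow> 'v \<Rightarrow> 'v set \<Rightarrow> ('v set \<Rightarrow> 'k) \<Rightarrow> 'k" where
  "tangent_field X l u p f = proj_fun (\<lambda>x. l x * tangent X x u f) p"

lemma tangent_field_span:
  assumes l: "Vector_Spaces.linear s (*) l" and x: "x \<noteq> 0" "span {x} \<in> X"
  shows "tangent_field X l u (span {x}) f = l x * tangent X x u f"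
  unfolding tangent_field_def
proof (rule proj_fun_span[OF _ x(1)])
  fix c :: 'k assume c: "c \<noteq> 0"
  show "l (s c x) * tangent X (s c x) u f = l x * tangent X x u f"
  proof (cases "f \<in> ideal_stalk (proj_space s) X (span {x})")
    case True
    obtain d P Q where 1: "homogeneous s d P" "homogeneous s d Q" "Q x \<noteq> 0"
      "\<forall>\<^sub>F y in zariski_at s x. Q y \<noteq> 0 \<and> f (span {y}) = P y / Q y"
      by (rule ideal_stalk_fraction[OF x(1) True])
    have ev1: "\<forall>\<^sub>F y in zariski_at s x. f (span {y}) = P y / Q y" using 1(4) by eventually_elim simp
    have "tangent X (s c x) u f = dir_deriv s P (s c x) u / Q (s c x)"
      by (rule tangent_eq(2)[OF _ _ _ 1(1,2)])
         (use x c True 1(2,3) ev1 in \<open>auto simp: span_scale_eq zariski_at_scale homogeneous_def\<close>)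
    moreover have "l (s c x) * dir_deriv s P (s c x) u / Q (s c x) = l x * dir_deriv s P x u / Q x"
      by (rule homogeneous_fraction_scale[OF homogeneous_linear_times_dir_deriv[OF 1(1) l] 1(2) c])
    ultimately show ?thesis using tangent_eq(2)[OF x True 1(1-3) ev1] by simp
  qed (simp add: tangent_def span_scale_eq[OF c])
qed

lemma normal_fibre_scale:
  "\<theta> \<in> normal_fibre X p \<Longrightarrow> (\<lambda>f. c * \<theta> f) \<in> normal_fibre X p"
  unfolding normal_fibre_iff Let_def by (simp add: algebra_simps)

lemma tangent_field_section:
  assumes l: "Vector_Spaces.linear s (*) l" and X: "X \<subseteq> proj_points s"
  shows "sections (normal_bundle (proj_space s) X) (basic_open l \<inter> X) (tangent_field X l u)"
proof -
  have hl: "homogeneous s 1 l" by (rule homogeneous_linear[OF l])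
  have "tangent_field X l u p \<in> normal_fibre X p" if "p \<in> basic_open l \<inter> X" for p
  proof -
    have "p \<in> X" "p \<in> proj_points s" using that X by auto
    then obtain x where x: "x \<noteq> 0" "p = span {x}" using proj_points_iff[of p] by auto
    have "tangent_field X l u p = (\<lambda>f. l x * tangent X x u f)"
      unfolding x(2) using tangent_field_span[OF l x(1)] \<open>p \<in> X\<close> x(2) by blast
    then show ?thesis
      using normal_fibre_scale[OF tangent_in_normal_fibre[OF x(1)], of X "l x" u] \<open>p \<in> X\<close> x(2) by simp
  qed
  moreover have "regular (subspace_of (proj_space s) X) (basic_open l \<inter> X \<inter> V) (\<lambda>p. tangent_field X l u p f)"
    if V: "zariski_open s V" "regular (proj_space s) V f" "\<forall>q\<in>V \<inter> X. f q = 0" for V f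
  proof -
    have "\<exists>V' g. zariski_open s V' \<and> p \<in> V' \<and> V' \<inter> X \<subseteq> basic_open l \<inter> X \<inter> V \<and>
        regular (proj_space s) V' g \<and> (\<forall>q\<in>V' \<inter> X. tangent_field X l u q f = g q)"
      if p: "p \<in> basic_open l \<inter> X \<inter> V" for p
    proof -
      have "p \<in> X" "p \<in> proj_points s" using p X by auto
      then obtain x where x: "x \<noteq> 0" "p = span {x}" using proj_points_iff[of p] by auto
      have lx: "l x \<noteq> 0" using p x span_in_basic_open[OF hl, of x] by simp
      have pV: "span {x} \<in> V" using p x by simp
      have "rat_germ s 0 x (\<lambda>y. f (span {y}))"
        using V(2) pV unfolding regular_proj_space_iff[OF V(1)] by blast
      then obtain d P Q where 1: "homogeneous s (0 + d) P" "homogeneous s d Q" "Q x \<noteq> 0"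
        "\<forall>\<^sub>F y in zariski_at s x. Q y \<noteq> 0 \<and> f (span {y}) = P y / Q y" by (rule rat_germE)
      let ?F = "\<lambda>y. l y * dir_deriv s P y u / Q y"
      have hF: "homogeneous s d (\<lambda>y. l y * dir_deriv s P y u)"
        using homogeneous_linear_times_dir_deriv[OF _ l] 1(1) by simp
      have F: "proj_fun ?F (span {y}) = ?F y" if "y \<noteq> 0" for y
        by (rule proj_fun_fraction[OF hF 1(2) that])
      have "\<exists>V'. zariski_open s V' \<and> span {x} \<in> V' \<and> regular (proj_space s) V' (proj_fun ?F) \<and>
         (\<forall>q\<in>V'. q \<in> basic_open l \<inter> V \<and> (q \<in> X \<longrightarrow> tangent_field X l u q f = proj_fun ?F q))"
        unfolding regular_nbhd_iff[OF x(1)]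
      proof
        show "rat_germ s 0 x (\<lambda>y. proj_fun ?F (span {y}))"
        proof (rule rat_germI)
          show "homogeneous s (0 + d) (\<lambda>y. l y * dir_deriv s P y u)" using hF by simp
          show "\<forall>\<^sub>F y in zariski_at s x. proj_fun ?F (span {y}) = ?F y"
            using eventually_nonzero[OF x(1)] by eventually_elim (rule F)
        qed (fact 1)+
        obtain e R where R: "homogeneous s e R" "R x \<noteq> 0"
          "\<And>y. R y \<noteq> 0 \<Longrightarrow> Q y \<noteq> 0 \<and> f (span {y}) = P y / Q y"
          using 1(4) by (auto simp: eventually_zariski_at)
        from eventually_nonzero[OF x(1)] eventually_homogeneous_nonzero[OF hl lx]
          zariski_openD[OF V(1) pV] eventually_homogeneous_nonzero[OF R(1,2)]
        show "\<forall>\<^sub>F y in zariski_at s x. span {y} \<in> basic_open l \<inter> V \<and>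
           (span {y} \<in> X \<longrightarrow> tangent_field X l u (span {y}) f = proj_fun ?F (span {y}))"
        proof eventually_elim
          case (elim y)
          have "tangent_field X l u (span {y}) f = proj_fun ?F (span {y})" if yX: "span {y} \<in> X"
          proof -
            have fy: "f \<in> ideal_stalk (proj_space s) X (span {y})"
              using V elim(3) unfolding ideal_stalk_def by auto
            have "tangent X y u f = dir_deriv s P y u / Q y"
            proof (rule tangent_eq(2)[OF elim(1) yX fy _ 1(2)])
              show "homogeneous s d P" using 1(1) by simp
              show "Q y \<noteq> 0" using R(3)[OF elim(4)] by simp
              show "\<forall>\<^sub>F z in zariski_at s y. f (span {z}) = P z / Q z"
                using eventually_homogeneous_nonzero[OF R(1) elim(4)]
                by eventually_elim (simp add: R(3))
            qed
            then show ?thesis by (simp add: F[OF elim(1)] tangent_field_span[OF l elim(1) yX])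
          qed
          then show ?case using elim(1-3) span_in_basic_open[OF hl, of y] by simp
        qed
      qed
      then show ?thesis unfolding x(2) by blast
    qed
    then show ?thesis by (simp add: subspace_of_def)
  qed
  ultimately show ?thesis by (simp add: normal_bundle_def Let_def)
qed

text \<open>
  First order Taylor expansion with rational coefficients. The point \<open>a w\<close> and the
  increments \<open>c i w\<close> are themselves rational of degree 0 in \<open>w\<close>, and the
  induction shows that the coefficients \<open>A i\<close> are so too.
\<close>

lemma poly_fun_taylor:
  assumes F: "poly_fun s F" and fin: "finite I"
    and a: "\<And>l. Vector_Spaces.linear s (*) l \<Longrightarrow> rat_germ s 0 x (\<lambda>w. l (a w))"
    and c: "\<And>i. i \<in> I \<Longrightarrow> rat_germ s 0 x (c i)"
  shows "rat_germ s 0 x (\<lambda>w. F (a w)) \<and> rat_germ s 0 x (\<lambda>w. F (a w + (\<Sum>i\<in>I. s (c i w) (v i)))) \<and>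
    (\<exists>A. (\<forall>i\<in>I. rat_germ s 0 x (A i)) \<and>
      (\<forall>w. F (a w + (\<Sum>i\<in>I. s (c i w) (v i))) = F (a w) + (\<Sum>i\<in>I. c i w * A i w)))"
  using F
proof (induction rule: poly_fun.induct)
  case (const k)
  show ?case by (auto intro: rat_germ_const exI[of _ "\<lambda>_ _. 0"])
next
  case (linear l)
  interpret l: Vector_Spaces.linear s "(*)" l by fact
  have eq: "l (a w + (\<Sum>i\<in>I. s (c i w) (v i))) = l (a w) + (\<Sum>i\<in>I. c i w * l (v i))" for w
    by (simp add: l.add l.sum l.scale)
  have "rat_germ s 0 x (\<lambda>w. \<Sum>i\<in>I. c i w * l (v i))"
    using rat_germ_mult[OF c rat_germ_const] by (intro rat_germ_sum) simp
  then have "rat_germ s 0 x (\<lambda>w. l (a w) + (\<Sum>i\<in>I. c i w * l (v i)))"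
    by (rule rat_germ_add[OF a[OF linear]])
  then show ?case
    unfolding eq using a[OF linear] rat_germ_const[of s x "l (v _)"]
    by (intro conjI exI[of _ "\<lambda>i _. l (v i)"]) (auto intro: rat_germ_const)
next
  case (add f g)
  then obtain A B where
    AB: "\<forall>i\<in>I. rat_germ s 0 x (A i)" "\<forall>w. f (a w + (\<Sum>i\<in>I. s (c i w) (v i))) = f (a w) + (\<Sum>i\<in>I. c i w * A i w)"
    "\<forall>i\<in>I. rat_germ s 0 x (B i)" "\<forall>w. g (a w + (\<Sum>i\<in>I. s (c i w) (v i))) = g (a w) + (\<Sum>i\<in>I. c i w * B i w)"
    by blast
  show ?case
  proof (intro conjI exI[of _ "\<lambda>i w. A i w + B i w"])
    show "\<forall>i\<in>I. rat_germ s 0 x (\<lambda>w. A i w + B i w)" using AB by (auto intro: rat_germ_add)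
    show "\<forall>w. f (a w + (\<Sum>i\<in>I. s (c i w) (v i))) + g (a w + (\<Sum>i\<in>I. s (c i w) (v i))) =
      f (a w) + g (a w) + (\<Sum>i\<in>I. c i w * (A i w + B i w))"
      using AB by (simp add: algebra_simps sum.distrib)
  qed (use add.IH in \<open>auto intro: rat_germ_add\<close>)
next
  case (mult f g)
  then obtain A B where
    AB: "\<forall>i\<in>I. rat_germ s 0 x (A i)" "\<forall>w. f (a w + (\<Sum>i\<in>I. s (c i w) (v i))) = f (a w) + (\<Sum>i\<in>I. c i w * A i w)"
    "\<forall>i\<in>I. rat_germ s 0 x (B i)" "\<forall>w. g (a w + (\<Sum>i\<in>I. s (c i w) (v i))) = g (a w) + (\<Sum>i\<in>I. c i w * B i w)"
    by blast
  let ?b = "\<lambda>w. a w + (\<Sum>i\<in>I. s (c i w) (v i))"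
  have m: "rat_germ s 0 x (\<lambda>w. F w * G w)" if "rat_germ s 0 x F" "rat_germ s 0 x G" for F G
    using rat_germ_mult[OF that] by simp
  show ?case
  proof (intro conjI exI[of _ "\<lambda>i w. A i w * g (?b w) + f (a w) * B i w"])
    show "\<forall>i\<in>I. rat_germ s 0 x (\<lambda>w. A i w * g (?b w) + f (a w) * B i w)"
      using AB mult.IH by (auto intro!: rat_germ_add m)
    have "f (?b w) * g (?b w) = f (a w) * g (a w) + (\<Sum>i\<in>I. c i w * (A i w * g (?b w) + f (a w) * B i w))" for w
    proof -
      have "(\<Sum>i\<in>I. c i w * (A i w * g (?b w) + f (a w) * B i w)) =
        (\<Sum>i\<in>I. c i w * A i w) * g (?b w) + f (a w) * (\<Sum>i\<in>I. c i w * B i w)"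
        by (simp add: sum_distrib_left sum_distrib_right sum.distrib algebra_simps)
      also have "\<dots> = (f (?b w) - f (a w)) * g (?b w) + f (a w) * (g (?b w) - g (a w))"
        using AB(2,4) by simp
      finally show ?thesis by (simp add: algebra_simps)
    qed
    then show "\<forall>w. f (?b w) * g (?b w) = f (a w) * g (a w) +
      (\<Sum>i\<in>I. c i w * (A i w * g (?b w) + f (a w) * B i w))" by blast
  qed (use mult.IH in \<open>auto intro: m\<close>)
qed

end

section \<open>The cone over the Veronese variety\<close>

text \<open>
  The product of the linear forms \<open>A\<close> and \<open>B\<close>, as a linear form on
  \<open>Sym\<^sup>2 V\<close>.
\<close>

definition polar_form ::
  "('k::field \<Rightarrow> 'w::ab_group_add \<Rightarrow> 'w) \<Rightarrow> ('v \<Rightarrow> 'v \<Rightarrow> 'w) \<Rightarrow> ('v \<Rightarrow> 'k) \<Rightarrow> ('v \<Rightarrow> 'k) \<Rightarrow> 'w \<Rightarrow> 'k" where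
  "polar_form sW mul A B =
     (THE f. Vector_Spaces.linear sW (*) f \<and> (\<forall>x y. f (mul x y) = (A x * B y + A y * B x) / 2))"

locale veronese_cone = V: char0_space sV + W: char0_space sW
  for sV :: "'k::field_char_0 \<Rightarrow> 'v::ab_group_add \<Rightarrow> 'v"
    and sW :: "'k \<Rightarrow> 'w::ab_group_add \<Rightarrow> 'w" +
  fixes mul :: "'v \<Rightarrow> 'v \<Rightarrow> 'w"
  assumes sq: "symmetric_square sV sW mul"
begin

abbreviation "br \<equiv> polar_form sW mul"

lemma scalar_vector_space: "vector_space ((*) :: 'k \<Rightarrow> 'k \<Rightarrow> 'k)"
  by unfold_locales (auto simp: algebra_simps)

lemma mul_bilinear: "symmetric_bilinear sV sW mul"
  using sq by (simp add: symmetric_square_def)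

lemmas mul_simps = symmetric_bilinear_simps[OF mul_bilinear]

lemma mul_linear: "Vector_Spaces.linear sV sW (\<lambda>x. mul x y)"
  using mul_bilinear by (simp add: symmetric_bilinear_def)

lemma linear_on_Sym_ext:
  assumes "Vector_Spaces.linear sW sU f" "Vector_Spaces.linear sW sU g"
    "\<And>x y. f (mul x y) = g (mul x y)"
  shows "f = g"
proof -
  have "symmetric_bilinear sV sU (\<lambda>x y. f (mul x y))"
    using linear_comp[OF mul_linear assms(1)] mul_simps(5) by (simp add: symmetric_bilinear_def)
  from symmetric_square_universal[OF sq this] show ?thesis using assms by metis
qed

lemma polar_form:
  assumes A: "Vector_Spaces.linear sV (*) A" and B: "Vector_Spaces.linear sV (*) B"
  shows linear_polar_form: "Vector_Spaces.linear sW (*) (br A B)"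
    and polar_form_mul: "br A B (mul x y) = (A x * B y + A y * B x) / 2"
proof -
  have "symmetric_bilinear sV (*) (\<lambda>x y. (A x * B y + A y * B x) / 2)"
    using A B by (auto simp: symmetric_bilinear_def Vector_Spaces.linear_iff field_simps)
  then have "\<exists>!f. Vector_Spaces.linear sW (*) f \<and> (\<forall>x y. f (mul x y) = (A x * B y + A y * B x) / 2)"
    using sq unfolding symmetric_square_def by blast
  from theI'[OF this] show "Vector_Spaces.linear sW (*) (br A B)"
    "br A B (mul x y) = (A x * B y + A y * B x) / 2" unfolding polar_form_def by blast+
qed

lemma mul_self_nonzero: "x \<noteq> 0 \<Longrightarrow> mul x x \<noteq> 0"
proof
  assume "x \<noteq> 0" and 0: "mul x x = 0"
  obtain f where f: "Vector_Spaces.linear sV (*) f" "f x = (1::'k)"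
    using V.nonzero_functional[OF \<open>x \<noteq> 0\<close>] .
  interpret l: Vector_Spaces.linear sW "(*)" "br f f" by (rule linear_polar_form[OF f(1) f(1)])
  show False using polar_form_mul[OF f(1) f(1), of x x] f(2) 0 by (simp add: l.zero)
qed

definition image_points :: "'w set set" where
  "image_points = {W.span {mul x x} |x. x \<noteq> 0}"

lemma span_mul_in_image: "x \<noteq> 0 \<Longrightarrow> W.span {mul x x} \<in> image_points"
  by (auto simp: image_points_def)

lemma image_points_subset: "image_points \<subseteq> proj_points sW"
  using mul_self_nonzero W.span_in_proj_points by (auto simp: image_points_def)

end

text \<open>
  A basis \<open>b\<close> of \<open>V\<close>, indexed by \<open>0, ..., n\<close>, with its dual
  basis \<open>\<beta>\<close>. It determines the affine chart of \<open>\<P>(W)\<close> on which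
  \<open>lam\<close>, the square of \<open>\<beta>\<^sub>0\<close>, does not vanish.
\<close>

locale veronese_frame = veronese_cone sV sW mul
  for sV :: "'k::field_char_0 \<Rightarrow> 'v::ab_group_add \<Rightarrow> 'v"
    and sW :: "'k \<Rightarrow> 'w::ab_group_add \<Rightarrow> 'w"
    and mul :: "'v \<Rightarrow> 'v \<Rightarrow> 'w" +
  fixes n :: nat and b :: "nat \<Rightarrow> 'v" and \<beta> :: "nat \<Rightarrow> 'v \<Rightarrow> 'k"
  assumes coord_linear: "i \<le> n \<Longrightarrow> Vector_Spaces.linear sV (*) (\<beta> i)"
    and coord_basis: "i \<le> n \<Longrightarrow> j \<le> n \<Longrightarrow> \<beta> i (b j) = (if i = j then 1 else 0)"
    and expand: "x = (\<Sum>i\<le>n. sV (\<beta> i x) (b i))"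
begin

lemma homogeneous_mul_self:
  assumes "homogeneous sW d Q"
  shows "homogeneous sV (2 * d) (\<lambda>x. Q (mul x x))"
proof -
  have "poly_fun sV (\<lambda>x. Q (mul x x))" if "poly_fun sW Q" for Q
    using that
  proof induction
    case (linear f)
    have "symmetric_bilinear sV (*) (\<lambda>x y. f (mul x y))"
      using linear_comp[OF mul_linear linear] mul_simps(5) by (simp add: symmetric_bilinear_def)
    from homogeneous_quadratic[OF this _ expand coord_linear] show ?case
      by (simp add: homogeneous_def)
  qed (auto intro: poly_fun.intros)
  then show ?thesis using assms
    by (simp add: homogeneous_def mul_simps power_mult power2_eq_square power_mult_distrib)
qed

abbreviation "lam \<equiv> br (\<beta> 0) (\<beta> 0)"

text \<open>
  The entries \<open>br (\<beta> i) (\<beta> j) w\<close> form the symmetric matrix of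
  \<open>w\<close>, and \<open>X\<close> consists of the matrices of rank 1; it lies on the zero
  set of these minors.
\<close>

definition minor :: "nat \<Rightarrow> nat \<Rightarrow> 'w \<Rightarrow> 'k" where
  "minor i j w = lam w * br (\<beta> i) (\<beta> j) w - br (\<beta> 0) (\<beta> i) w * br (\<beta> 0) (\<beta> j) w"

text \<open>
  In the affine coordinates \<open>y\<^bsub>ij\<^esub>\<close> of the chart this is
  \<open>y\<^bsub>ij\<^esub> - y\<^bsub>0i\<^esub> y\<^bsub>0j\<^esub>\<close>.
\<close>

definition graph_eq :: "nat \<Rightarrow> nat \<Rightarrow> 'w set \<Rightarrow> 'k" where
  "graph_eq i j = W.proj_fun (\<lambda>w. minor i j w / lam w ^ 2)"

abbreviation "idx \<equiv> {1..n} \<times> {1..n}"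

lemma br_linear: "i \<le> n \<Longrightarrow> j \<le> n \<Longrightarrow> Vector_Spaces.linear sW (*) (br (\<beta> i) (\<beta> j))"
  by (rule linear_polar_form[OF coord_linear coord_linear])

lemma br_mul: "i \<le> n \<Longrightarrow> j \<le> n \<Longrightarrow>
    br (\<beta> i) (\<beta> j) (mul x y) = (\<beta> i x * \<beta> j y + \<beta> i y * \<beta> j x) / 2"
  by (rule polar_form_mul[OF coord_linear coord_linear])

lemma br_commute: "br (\<beta> i) (\<beta> j) = br (\<beta> j) (\<beta> i)"
  unfolding polar_form_def by (simp add: ac_simps)

lemma minor_commute: "minor i j = minor j i"
  unfolding minor_def by (simp add: br_commute[of i j] mult.commute fun_eq_iff)

lemma graph_eq_commute: "graph_eq i j = graph_eq j i"
  unfolding graph_eq_def by (simp add: minor_commute[of i j])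

lemma br_basis: "i \<le> n \<Longrightarrow> j \<le> n \<Longrightarrow> k \<le> n \<Longrightarrow> l \<le> n \<Longrightarrow>
    br (\<beta> i) (\<beta> j) (mul (b k) (b l)) =
      ((if i = k \<and> j = l then 1 else 0) + (if i = l \<and> j = k then 1 else 0)) / 2"
proof -
  assume n: "i \<le> n" "j \<le> n" "k \<le> n" "l \<le> n"
  have *: "(if P then 1 else 0) * (if Q then 1 else 0) = (if P \<and> Q then 1 else (0::'k))" for P Q
    by simp
  show ?thesis
    unfolding br_mul[OF n(1,2)] coord_basis[OF n(1,3)] coord_basis[OF n(2,4)]
      coord_basis[OF n(1,4)] coord_basis[OF n(2,3)] * ..
qed

lemma mul_expand: "mul x y = (\<Sum>i\<le>n. \<Sum>j\<le>n. sW (\<beta> i x * \<beta> j y) (mul (b i) (b j)))"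
proof -
  interpret L: Vector_Spaces.linear sV sW "\<lambda>x. mul x z" for z by (rule mul_linear)
  have 1: "mul x y = (\<Sum>i\<le>n. sW (\<beta> i x) (mul (b i) y))" for x y
    using arg_cong[OF expand[of x], of "\<lambda>z. mul z y"] by (simp only: L.sum L.scale)
  have 2: "mul (b i) y = (\<Sum>j\<le>n. sW (\<beta> j y) (mul (b i) (b j)))" for i
    using 1[of y "b i"] by (simp only: mul_simps(5)[of _ "b i"])
  have "mul x y = (\<Sum>i\<le>n. sW (\<beta> i x) (mul (b i) y))" by (rule 1)
  also have "\<dots> = (\<Sum>i\<le>n. sW (\<beta> i x) (\<Sum>j\<le>n. sW (\<beta> j y) (mul (b i) (b j))))"
    by (rule sum.cong[OF refl], rule arg_cong[OF 2])
  also have "\<dots> = (\<Sum>i\<le>n. \<Sum>j\<le>n. sW (\<beta> i x * \<beta> j y) (mul (b i) (b j)))"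
    by (simp add: W.scale_sum_right)
  finally show ?thesis .
qed

text \<open>
  The sum over ordered pairs, with the symmetric coefficients \<open>br (\<beta> i) (\<beta> j)
  u\<close>, avoids factors 2 off the diagonal.
\<close>

lemma Sym_expand: "u = (\<Sum>i\<le>n. \<Sum>j\<le>n. sW (br (\<beta> i) (\<beta> j) u) (mul (b i) (b j)))"
proof -
  let ?f = "\<lambda>u. \<Sum>i\<le>n. \<Sum>j\<le>n. sW (br (\<beta> i) (\<beta> j) u) (mul (b i) (b j))"
  have "(\<lambda>u. u) = ?f"
  proof (rule linear_on_Sym_ext)
    show "Vector_Spaces.linear sW sW (\<lambda>u. u)"
      using W.is_vector_space by (simp add: Vector_Spaces.linear_iff)
    show "Vector_Spaces.linear sW sW ?f"
      using W.is_vector_space br_linear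
      by (simp add: Vector_Spaces.linear_iff W.scale_left_distrib sum.distrib W.scale_sum_right)
    fix x y
    have "?f (mul x y) = (\<Sum>i\<le>n. \<Sum>j\<le>n. sW ((\<beta> i x * \<beta> j y + \<beta> i y * \<beta> j x) / 2) (mul (b i) (b j)))"
      by (simp add: br_mul)
    also have "\<dots> = sW (1/2) (\<Sum>i\<le>n. \<Sum>j\<le>n. sW (\<beta> i x * \<beta> j y) (mul (b i) (b j))) +
        sW (1/2) (\<Sum>i\<le>n. \<Sum>j\<le>n. sW (\<beta> i y * \<beta> j x) (mul (b i) (b j)))"
      by (simp add: add_divide_distrib W.scale_left_distrib W.scale_sum_right sum.distrib)
    also have "\<dots> = sW (1/2) (mul x y) + sW (1/2) (mul y x)"
      by (simp only: mul_expand[symmetric])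
    also have "\<dots> = mul x y"
      by (simp add: mul_simps(5)[of y x] flip: W.scale_left_distrib)
    finally show "mul x y = ?f (mul x y)" by simp
  qed
  then show ?thesis by (rule fun_cong)
qed

lemma homogeneous_br: "i \<le> n \<Longrightarrow> j \<le> n \<Longrightarrow> homogeneous sW 1 (br (\<beta> i) (\<beta> j))"
  by (rule homogeneous_linear[OF br_linear])

lemma homogeneous_minor: "i \<le> n \<Longrightarrow> j \<le> n \<Longrightarrow> homogeneous sW 2 (minor i j)"
  unfolding minor_def
  using homogeneous_mult[OF homogeneous_br homogeneous_br]
  by (intro homogeneous_diff) (simp_all flip: one_add_one)

lemma homogeneous_lam_sq: "homogeneous sW 2 (\<lambda>w. lam w ^ 2)"
  using homogeneous_power[OF homogeneous_br[of 0 0], of 2] by simp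

lemma lam_mul_self: "lam (mul x x) = \<beta> 0 x ^ 2"
  by (simp add: br_mul power2_eq_square)

lemma minor_mul_self: "i \<le> n \<Longrightarrow> j \<le> n \<Longrightarrow> minor i j (mul x x) = 0"
  by (simp add: minor_def br_mul)

lemma graph_eq_span: "i \<le> n \<Longrightarrow> j \<le> n \<Longrightarrow> w \<noteq> 0 \<Longrightarrow> graph_eq i j (W.span {w}) = minor i j w / lam w ^ 2"
  unfolding graph_eq_def by (rule W.proj_fun_fraction[OF homogeneous_minor homogeneous_lam_sq])

lemma graph_eq_germ: "i \<le> n \<Longrightarrow> j \<le> n \<Longrightarrow> w \<noteq> 0 \<Longrightarrow>
    \<forall>\<^sub>F y in zariski_at sW w. graph_eq i j (W.span {y}) = minor i j y / lam y ^ 2"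
  using W.eventually_nonzero[of w] by (auto elim!: eventually_mono simp: graph_eq_span)

lemma graph_eq_vanishes: "i \<le> n \<Longrightarrow> j \<le> n \<Longrightarrow> p \<in> image_points \<Longrightarrow> graph_eq i j p = 0"
  by (auto simp: image_points_def graph_eq_span mul_self_nonzero minor_mul_self)

lemma graph_eq_regular:
  assumes "i \<le> n" "j \<le> n"
  shows "regular (proj_space sW) (W.basic_open lam) (graph_eq i j)"
  unfolding W.regular_proj_space_iff[OF W.basic_open_open[OF homogeneous_br[of 0 0, OF le0 le0]]]
proof (intro allI impI)
  fix w assume "W.span {w} \<in> W.basic_open lam"
  then have w: "w \<noteq> 0" "lam w \<noteq> 0" using W.span_in_basic_open[OF homogeneous_br[of 0 0, OF le0 le0]] by auto
  show "rat_germ sW 0 w (\<lambda>y. graph_eq i j (W.span {y}))"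
    by (rule rat_germI[OF _ homogeneous_lam_sq _ graph_eq_germ]) (simp_all add: w assms homogeneous_minor[OF assms, unfolded numeral_2_eq_2])
qed

lemma graph_eq_in_ideal:
  assumes "i \<le> n" "j \<le> n" "w \<noteq> 0" "lam w \<noteq> 0"
  shows "graph_eq i j \<in> ideal_stalk (proj_space sW) image_points (W.span {w})"
proof -
  have "W.span {w} \<in> W.basic_open lam"
    using W.span_in_basic_open[OF homogeneous_br[of 0 0, OF le0 le0]] assms by blast
  then show ?thesis
    using graph_eq_regular[OF assms(1,2)] graph_eq_vanishes[OF assms(1,2)]
      W.basic_open_open[OF homogeneous_br[of 0 0, OF le0 le0]]
    unfolding ideal_stalk_def by auto
qed

lemma dir_deriv_minor:
  assumes "i \<le> n" "j \<le> n"
  shows "dir_deriv sW (minor i j) w u = lam u * br (\<beta> i) (\<beta> j) w + lam w * br (\<beta> i) (\<beta> j) u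
     - (br (\<beta> 0) (\<beta> i) u * br (\<beta> 0) (\<beta> j) w + br (\<beta> 0) (\<beta> i) w * br (\<beta> 0) (\<beta> j) u)"
proof -
  have p: "poly_fun sW (br (\<beta> i) (\<beta> j))" if "i \<le> n" "j \<le> n" for i j
    using homogeneous_br[OF that] by (simp add: homogeneous_def)
  show ?thesis
    unfolding minor_def using assms
    by (simp add: W.dir_deriv_diff W.dir_deriv_mult W.dir_deriv_linear poly_fun.mult p br_linear)
qed

lemma tangent_graph_eq:
  assumes "i \<le> n" "j \<le> n" and x: "\<beta> 0 x \<noteq> 0"
  shows "W.tangent image_points (mul x x) u (graph_eq i j) = dir_deriv sW (minor i j) (mul x x) u / \<beta> 0 x ^ 4"
proof -
  interpret L: Vector_Spaces.linear sV "(*)" "\<beta> 0" by (simp add: coord_linear)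
  have x0: "x \<noteq> 0" using x L.zero by auto
  have w: "mul x x \<noteq> 0" "lam (mul x x) \<noteq> 0" using mul_self_nonzero[OF x0] x lam_mul_self by auto
  have "W.tangent image_points (mul x x) u (graph_eq i j) = dir_deriv sW (minor i j) (mul x x) u / lam (mul x x) ^ 2"
    by (rule W.tangent_eq(2)[OF w(1) span_mul_in_image[OF x0] graph_eq_in_ideal[OF assms(1,2) w]
          homogeneous_minor[OF assms(1,2)] homogeneous_lam_sq _ graph_eq_germ[OF assms(1,2) w(1)]])
       (use w in simp)
  then show ?thesis by (simp add: lam_mul_self power_mult[symmetric])
qed

end

section \<open>Local equations and the frame of the normal bundle\<close>

lemma homogeneous_linear_comp:
  assumes "homogeneous sV d f" "Vector_Spaces.linear sW sV e"
  shows "homogeneous sW d (\<lambda>x. f (e x))"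
  using assms poly_fun_linear_comp[OF _ assms(2)]
  by (auto simp: homogeneous_def Vector_Spaces.linear_iff)

text \<open>
  The degree in \<open>x\<close> of the coordinate on the normal space at \<open>[xx]\<close> that
  belongs to the indices \<open>k\<close> and \<open>l\<close>: 2 for the representative
  \<open>xx\<close>, and 1 for each index 1, whose coordinate on \<open>V/x\<close> is linear in
  \<open>x\<close>.
\<close>

definition pair_degree :: "nat \<Rightarrow> nat \<Rightarrow> nat" where
  "pair_degree k l = 2 + (if k = 1 then 1 else 0) + (if l = 1 then 1 else 0)"

lemma sum_kronecker:
  assumes "i \<le> (n::nat)"
  shows "(\<Sum>j\<le>n. c j * (if i = j then 1 else 0)) = (c i :: 'k::comm_semiring_1)"
proof -
  have "(\<Sum>j\<le>n. c j * (if i = j then 1 else 0)) = (\<Sum>j\<le>n. if i = j then c j else 0)"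
    by (rule sum.cong) auto
  then show ?thesis using assms by simp
qed

context veronese_frame begin

text \<open>
  A point of the cone over \<open>X\<close> with the same affine coordinates
  \<open>y\<^bsub>0i\<^esub>\<close> as \<open>w\<close>: this is the projection of the chart onto
  the graph.
\<close>

definition sq_part :: "'w \<Rightarrow> 'w" where
  "sq_part w = (let y = \<Sum>i\<le>n. sV (br (\<beta> 0) (\<beta> i) w) (b i) in mul y y)"

text \<open>
  The difference between a point and its projection to the graph has the minors as coordinates;
  those with an index 0 vanish.
\<close>

lemma sum_minor_expand:
  "sW (lam w) w = sq_part w + (\<Sum>q\<in>idx. sW (minor (fst q) (snd q) w) (mul (b (fst q)) (b (snd q))))"
proof -
  define y where "y = (\<Sum>i\<le>n. sV (br (\<beta> 0) (\<beta> i) w) (b i))"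
  have y: "\<beta> i y = br (\<beta> 0) (\<beta> i) w" if "i \<le> n" for i
  proof -
    interpret L: Vector_Spaces.linear sV "(*)" "\<beta> i" by (rule coord_linear[OF that])
    have "\<beta> i y = (\<Sum>j\<le>n. br (\<beta> 0) (\<beta> j) w * (if i = j then 1 else 0))"
      unfolding y_def using that by (simp add: L.sum L.scale coord_basis)
    then show ?thesis unfolding sum_kronecker[OF that] .
  qed
  have "sq_part w = (\<Sum>i\<le>n. \<Sum>j\<le>n. sW (br (\<beta> 0) (\<beta> i) w * br (\<beta> 0) (\<beta> j) w) (mul (b i) (b j)))"
    unfolding sq_part_def Let_def y_def[symmetric] mul_expand[of y y] by (simp add: y)
  moreover have "sW (lam w) w = (\<Sum>i\<le>n. \<Sum>j\<le>n. sW (lam w * br (\<beta> i) (\<beta> j) w) (mul (b i) (b j)))"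
    using arg_cong[OF Sym_expand[of w], of "sW (lam w)"] by (simp add: W.scale_sum_right)
  ultimately have "sW (lam w) w - sq_part w = (\<Sum>i\<le>n. \<Sum>j\<le>n. sW (minor i j w) (mul (b i) (b j)))"
    by (simp add: minor_def W.scale_left_diff_distrib sum_subtractf)
  also have "\<dots> = (\<Sum>q\<in>{..n} \<times> {..n}. sW (minor (fst q) (snd q) w) (mul (b (fst q)) (b (snd q))))"
    by (simp add: sum.cartesian_product split_def)
  also have "\<dots> = (\<Sum>q\<in>idx. sW (minor (fst q) (snd q) w) (mul (b (fst q)) (b (snd q))))"
  proof (rule sum.mono_neutral_right)
    show "\<forall>q\<in>{..n} \<times> {..n} - idx. sW (minor (fst q) (snd q) w) (mul (b (fst q)) (b (snd q))) = 0"
    proof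
      fix q assume "q \<in> {..n} \<times> {..n} - idx"
      then have "fst q = 0 \<or> snd q = 0" by (cases q) auto
      moreover have "minor 0 j w = 0" for j by (simp add: minor_def)
      ultimately have "minor (fst q) (snd q) w = 0" using minor_commute by metis
      then show "sW (minor (fst q) (snd q) w) (mul (b (fst q)) (b (snd q))) = 0" by simp
    qed
  qed auto
  finally show ?thesis by (simp add: algebra_simps)
qed

lemma homogeneous_sq_part:
  assumes "homogeneous sW d Q"
  shows "homogeneous sW (2 * d) (\<lambda>w. Q (sq_part w))"
proof -
  have "Vector_Spaces.linear sW sV (\<lambda>w. \<Sum>i\<le>n. sV (br (\<beta> 0) (\<beta> i) w) (b i))"
    using V.is_vector_space W.is_vector_space br_linear
    by (simp add: Vector_Spaces.linear_iff V.scale_left_distrib sum.distrib V.scale_sum_right)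
  from homogeneous_linear_comp[OF homogeneous_mul_self[OF assms] this] show ?thesis
    by (simp add: sq_part_def Let_def)
qed

lemma sq_part_mul_self: "sq_part (mul x x) = sW (\<beta> 0 x ^ 2) (mul x x)"
proof -
  have "(\<Sum>i\<le>n. sV (br (\<beta> 0) (\<beta> i) (mul x x)) (b i)) = sV (\<beta> 0 x) (\<Sum>i\<le>n. sV (\<beta> i x) (b i))"
    by (simp add: br_mul V.scale_sum_right mult.commute)
  also have "\<dots> = sV (\<beta> 0 x) x" by (simp only: expand[symmetric])
  finally show ?thesis by (simp add: sq_part_def mul_simps power2_eq_square)
qed

lemma span_sq_part:
  assumes "lam w \<noteq> 0"
  shows "W.span {sq_part w} \<in> image_points"
proof -
  interpret L: Vector_Spaces.linear sV "(*)" "\<beta> 0" by (simp add: coord_linear)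
  let ?y = "\<Sum>i\<le>n. sV (br (\<beta> 0) (\<beta> i) w) (b i)"
  have "\<beta> 0 ?y = (\<Sum>j\<le>n. br (\<beta> 0) (\<beta> j) w * (if 0 = j then 1 else 0))"
    by (simp add: L.sum L.scale coord_basis)
  then have "\<beta> 0 ?y \<noteq> 0" using assms unfolding sum_kronecker[OF le0] by simp
  then have "?y \<noteq> 0" by (metis L.zero)
  then show ?thesis using span_mul_in_image unfolding sq_part_def Let_def by blast
qed

lemma nonzero_if_coord: "\<beta> 0 x \<noteq> 0 \<Longrightarrow> x \<noteq> 0"
proof -
  assume "\<beta> 0 x \<noteq> 0"
  interpret L: Vector_Spaces.linear sV "(*)" "\<beta> 0" by (simp add: coord_linear)
  show ?thesis using \<open>\<beta> 0 x \<noteq> 0\<close> L.zero by auto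
qed

text \<open>
  Expand the numerator \<open>P\<close> of \<open>f\<close> around the projection of
  \<open>w\<close> to the graph. The constant term vanishes because \<open>f\<close> vanishes on
  \<open>X\<close>, and the increments of the expansion are the equations of the graph.
\<close>

lemma conormal_generated:
  assumes x: "\<beta> 0 x \<noteq> 0"
    and f: "f \<in> ideal_stalk (proj_space sW) image_points (W.span {mul x x})"
  shows "\<exists>a. (\<forall>q\<in>idx. a q \<in> stalk (proj_space sW) (W.span {mul x x})) \<and>
    (\<forall>\<^sub>F w in zariski_at sW (mul x x).
       f (W.span {w}) = (\<Sum>q\<in>idx. a q (W.span {w}) * graph_eq (fst q) (snd q) (W.span {w})))"
proof -
  define w0 where "w0 = mul x x"
  have w0: "w0 \<noteq> 0" using mul_self_nonzero nonzero_if_coord[OF x] by (simp add: w0_def)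
  have lam0: "lam w0 \<noteq> 0" using x by (simp add: w0_def lam_mul_self)
  obtain d P Q where PQ: "homogeneous sW d P" "homogeneous sW d Q" "Q w0 \<noteq> 0"
    "\<forall>\<^sub>F w in zariski_at sW w0. Q w \<noteq> 0 \<and> f (W.span {w}) = P w / Q w"
    using W.ideal_stalk_fraction[OF w0] f unfolding w0_def by blast
  have van: "\<forall>\<^sub>F w in zariski_at sW w0. W.span {w} \<in> image_points \<longrightarrow> f (W.span {w}) = 0"
    using f unfolding w0_def[symmetric] W.ideal_stalk_iff[OF w0] by blast
  have "zariski_at sW (sq_part w0) = zariski_at sW w0"
    unfolding w0_def sq_part_mul_self by (rule W.zariski_at_scale) (use x in simp)
  with eventually_conj[OF PQ(4) van]
  have "\<forall>\<^sub>F w in zariski_at sW (sq_part w0). (Q w \<noteq> 0 \<and> f (W.span {w}) = P w / Q w) \<and>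
      (W.span {w} \<in> image_points \<longrightarrow> f (W.span {w}) = 0)" by simp
  from eventually_zariski_at_comp[where g=sq_part, OF _ this] homogeneous_sq_part
  have sqev: "\<forall>\<^sub>F w in zariski_at sW w0. (Q (sq_part w) \<noteq> 0 \<and>
      f (W.span {sq_part w}) = P (sq_part w) / Q (sq_part w)) \<and>
      (W.span {sq_part w} \<in> image_points \<longrightarrow> f (W.span {sq_part w}) = 0)" by blast
  have hl: "homogeneous sW 1 lam" by (simp add: homogeneous_br[of 0 0, simplified])
  have evl: "\<forall>\<^sub>F w in zariski_at sW w0. lam w \<noteq> 0" by (rule eventually_homogeneous_nonzero[OF hl lam0])
  have P0: "\<forall>\<^sub>F w in zariski_at sW w0. P (sq_part w) = 0"
    using sqev evl by eventually_elim (use span_sq_part in auto)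
  \<comment> \<open>Normalized to degree 0, so that \<open>a w + (\<Sum>q\<in>idx. sW (c q w) (v q))\<close> is \<open>w\<close> scaled to \<open>lam = 1\<close>.\<close>
  define a where "a w = sW (1 / lam w ^ 2) (sq_part w)" for w
  define c where "c q w = minor (fst q) (snd q) w / lam w ^ 2" for q w
  define v where "v q = mul (b (fst q)) (b (snd q))" for q
  have gl: "rat_germ sW 0 w0 (\<lambda>w. F w / lam w ^ 2)" if "homogeneous sW 2 F" for F
    by (rule rat_germ_divide_homogeneous[OF rat_germ_homogeneous homogeneous_lam_sq])
       (simp_all only: add_0 that lam0 power_eq_0_iff not_False_eq_True simp_thms)
  have ga: "rat_germ sW 0 w0 (\<lambda>w. l (a w))" if l: "Vector_Spaces.linear sW (*) l" for l
  proof -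
    have "l (a w) = l (sq_part w) / lam w ^ 2" for w
      using l by (simp add: a_def Vector_Spaces.linear_iff)
    then show ?thesis using gl[OF homogeneous_sq_part[OF homogeneous_linear[OF l], unfolded mult_1_right]]
      by simp
  qed
  have gc: "rat_germ sW 0 w0 (c q)" if "q \<in> idx" for q
  proof -
    have "homogeneous sW 2 (minor (fst q) (snd q))" by (rule homogeneous_minor) (use that in auto)
    from gl[OF this] show ?thesis by (simp add: c_def[abs_def])
  qed
  have "poly_fun sW P" using PQ(1) by (simp add: homogeneous_def)
  moreover have "finite idx" by simp
  ultimately have "\<exists>A. (\<forall>q\<in>idx. rat_germ sW 0 w0 (A q)) \<and>
    (\<forall>w. P (a w + (\<Sum>q\<in>idx. sW (c q w) (v q))) = P (a w) + (\<Sum>q\<in>idx. c q w * A q w))"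
    using W.poly_fun_taylor[where I=idx and v=v and a=a and c=c and x=w0 and F=P] ga gc by blast
  then obtain A where A: "\<forall>q\<in>idx. rat_germ sW 0 w0 (A q)"
    "\<forall>w. P (a w + (\<Sum>q\<in>idx. sW (c q w) (v q))) = P (a w) + (\<Sum>q\<in>idx. c q w * A q w)" by blast
  have pt: "a w + (\<Sum>q\<in>idx. sW (c q w) (v q)) = sW (1 / lam w) w" if "lam w \<noteq> 0" for w
  proof -
    have "sW (1 / lam w) w = sW (1 / lam w ^ 2) (sW (lam w) w)"
      using that by (simp add: power2_eq_square)
    also have "\<dots> = a w + (\<Sum>q\<in>idx. sW (c q w) (v q))"
      unfolding sum_minor_expand[of w] W.scale_right_distrib W.scale_sum_right
      by (simp add: a_def c_def v_def)
    finally show ?thesis by simp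
  qed
  define B where "B q w = A q w * lam w ^ d / Q w" for q w
  have gB: "rat_germ sW 0 w0 (B q)" if "q \<in> idx" for q
    unfolding B_def[abs_def]
  proof (rule rat_germ_divide_homogeneous[OF _ PQ(2,3)])
    have "homogeneous sW d (\<lambda>w. lam w ^ d)" using homogeneous_power[OF hl, of d] by simp
    then show "rat_germ sW (0 + d) w0 (\<lambda>w. A q w * lam w ^ d)"
      using rat_germ_mult[OF _ rat_germ_homogeneous] A(1) that by blast
  qed
  have "\<forall>q\<in>idx. \<exists>g. g \<in> stalk (proj_space sW) (W.span {w0}) \<and>
    (\<forall>\<^sub>F w in zariski_at sW w0. g (W.span {w}) = B q w)"
    using W.rat_germ_proj_fun[OF gB w0] by metis
  then obtain g where g: "\<forall>q\<in>idx. g q \<in> stalk (proj_space sW) (W.span {w0}) \<and>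
    (\<forall>\<^sub>F w in zariski_at sW w0. g q (W.span {w}) = B q w)" by metis
  have "\<forall>\<^sub>F w in zariski_at sW w0. \<forall>q\<in>idx. g q (W.span {w}) = B q w"
    by (rule eventually_ball_finite) (use g in auto)
  with PQ(4) evl P0 W.eventually_nonzero[OF w0]
  have "\<forall>\<^sub>F w in zariski_at sW w0.
       f (W.span {w}) = (\<Sum>q\<in>idx. g q (W.span {w}) * graph_eq (fst q) (snd q) (W.span {w}))"
  proof eventually_elim
    case (elim w)
    have hc: "graph_eq (fst q) (snd q) (W.span {w}) = c q w" if "q \<in> idx" for q
      unfolding c_def by (rule graph_eq_span) (use that elim in auto)
    have hP: "P (sW r z) = r ^ d * P z" for r z using PQ(1) by (simp add: homogeneous_def)
    have "P (sW (1 / lam w) w) = P (a w) + (\<Sum>q\<in>idx. c q w * A q w)"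
      using A(2)[rule_format, of w] unfolding pt[OF elim(2)] .
    then have "(1 / lam w) ^ d * P w = (1 / lam w ^ 2) ^ d * P (sq_part w) + (\<Sum>q\<in>idx. c q w * A q w)"
      unfolding a_def hP .
    then have "P w = lam w ^ d * (\<Sum>q\<in>idx. c q w * A q w)"
      using elim(2,3) by (simp add: field_simps)
    then have "f (W.span {w}) = (\<Sum>q\<in>idx. B q w * c q w)"
      using elim(1) by (simp add: B_def sum_distrib_left sum_divide_distrib mult_ac)
    also have "\<dots> = (\<Sum>q\<in>idx. g q (W.span {w}) * graph_eq (fst q) (snd q) (W.span {w}))"
      by (rule sum.cong[OF refl]) (simp only: hc bspec[OF elim(5)])
    finally show ?case .
  qed
  then show ?thesis using g unfolding w0_def[symmetric] by (intro exI[of _ g]) blast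
qed

lemma tangent_field_graph_eq:
  assumes x: "\<beta> 0 x \<noteq> 0" and kl: "k \<le> n" "l \<le> n" and u: "\<And>i. i \<le> n \<Longrightarrow> br (\<beta> 0) (\<beta> i) u = 0"
  shows "lam (mul x x) * W.tangent image_points (mul x x) u (graph_eq k l) = br (\<beta> k) (\<beta> l) u"
proof -
  have "dir_deriv sW (minor k l) (mul x x) u = \<beta> 0 x ^ 2 * br (\<beta> k) (\<beta> l) u"
    unfolding dir_deriv_minor[OF kl] using u kl by (simp add: lam_mul_self)
  then show ?thesis
    using x by (simp add: tangent_graph_eq[OF kl x] lam_mul_self eval_nat_numeral)
qed

text \<open>
  The linear forms \<open>br (\<beta> k) (\<beta> l)\<close> are dual to the products of basis
  vectors only up to symmetrization, which does not matter for symmetric coefficients.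
\<close>

lemma sum_idx_symmetric:
  assumes sym: "\<And>i j. G (i, j) = G (j, i)" and kl: "k \<in> {1..n}" "l \<in> {1..n}"
  shows "(\<Sum>q\<in>idx. G q * br (\<beta> k) (\<beta> l) (mul (b (fst q)) (b (snd q)))) = (G (k, l) :: 'k)"
proof -
  have "(\<Sum>q\<in>idx. G q * br (\<beta> k) (\<beta> l) (mul (b (fst q)) (b (snd q)))) =
    (\<Sum>q\<in>idx. (if (k, l) = q then G q / 2 else 0) + (if (l, k) = q then G q / 2 else 0))"
  proof (rule sum.cong[OF refl])
    fix q assume q: "q \<in> idx"
    obtain i j where ij: "q = (i, j)" by (cases q)
    have br: "br (\<beta> k) (\<beta> l) (mul (b i) (b j)) =
        ((if k = i \<and> l = j then 1 else 0) + (if k = j \<and> l = i then 1 else 0)) / 2"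
      by (rule br_basis) (use q kl ij in auto)
    have "c * ((of_bool P + of_bool Q) / 2) = (if P then c / 2 else 0) + (if Q then c / 2 else 0)"
      for c :: 'k and P Q by (cases P; cases Q) simp_all
    then show "G q * br (\<beta> k) (\<beta> l) (mul (b (fst q)) (b (snd q))) =
        (if (k, l) = q then G q / 2 else 0) + (if (l, k) = q then G q / 2 else 0)"
      unfolding ij fst_conv snd_conv br prod.inject of_bool_def by (simp only: conj_commute)
  qed
  also have "\<dots> = G (k, l) / 2 + G (l, k) / 2"
    using kl by (simp add: sum.distrib sum.delta)
  also have "\<dots> = G (k, l)" using sym[of l k] by simp
  finally show ?thesis .
qed

lemma br_zero_basis: "q \<in> idx \<Longrightarrow> i \<le> n \<Longrightarrow> br (\<beta> 0) (\<beta> i) (mul (b (fst q)) (b (snd q))) = 0"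
  by (cases q) (auto simp: br_basis)

text \<open>
  Both sides are determined by their values on the generators of the ideal, and the tangent
  vectors in the directions of products of basis vectors are dual to these generators.
\<close>

lemma normal_frame:
  assumes x: "\<beta> 0 x \<noteq> 0" and \<theta>: "\<theta> \<in> W.normal_fibre image_points (W.span {mul x x})"
  shows "\<theta> f = (\<Sum>q\<in>idx. \<theta> (graph_eq (fst q) (snd q)) *
    (lam (mul x x) * W.tangent image_points (mul x x) (mul (b (fst q)) (b (snd q))) f))"
proof (cases "f \<in> ideal_stalk (proj_space sW) image_points (W.span {mul x x})")
  case False
  then have "\<theta> f = 0" using \<theta> unfolding W.normal_fibre_iff Let_def by blast
  then show ?thesis using False by (simp add: W.tangent_def)
next
  case True
  define w0 where "w0 = mul x x"
  have x0: "x \<noteq> 0" by (rule nonzero_if_coord[OF x])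
  have w0: "w0 \<noteq> 0" "lam w0 \<noteq> 0" "W.span {w0} \<in> image_points"
    using mul_self_nonzero[OF x0] x span_mul_in_image[OF x0] by (simp_all add: w0_def lam_mul_self)
  obtain a where a': "(\<forall>q\<in>idx. a q \<in> stalk (proj_space sW) (W.span {w0})) \<and>
    (\<forall>\<^sub>F w in zariski_at sW w0.
       f (W.span {w}) = (\<Sum>q\<in>idx. a q (W.span {w}) * graph_eq (fst q) (snd q) (W.span {w})))"
    using conormal_generated[OF x True] unfolding w0_def[symmetric] by (rule exE)
  note a = bspec[OF conjunct1[OF a']] conjunct2[OF a']
  have graph_eq: "graph_eq (fst q) (snd q) \<in> ideal_stalk (proj_space sW) image_points (W.span {w0})" if "q \<in> idx" for q
    using that by (intro graph_eq_in_ideal w0) auto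
  have comb: "\<eta> f = (\<Sum>q\<in>idx. a q (W.span {w0}) * \<eta> (graph_eq (fst q) (snd q)))"
    if "\<eta> \<in> W.normal_fibre image_points (W.span {w0})" for \<eta>
    by (rule W.normal_fibre_combination[OF w0(1) that _ a(1) graph_eq _ a(2)])
       (use True in \<open>simp_all add: w0_def\<close>)
  let ?t = "\<lambda>q f. lam w0 * W.tangent image_points w0 (mul (b (fst q)) (b (snd q))) f"
  have t: "?t q f = (\<Sum>r\<in>idx. a r (W.span {w0}) *
      br (\<beta> (fst r)) (\<beta> (snd r)) (mul (b (fst q)) (b (snd q))))" if q: "q \<in> idx" for q
  proof -
    have "?t q \<in> W.normal_fibre image_points (W.span {w0})"
      by (rule W.normal_fibre_scale[OF W.tangent_in_normal_fibre[OF w0(1,3)]])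
    from comb[OF this] have "?t q f = (\<Sum>r\<in>idx. a r (W.span {w0}) * ?t q (graph_eq (fst r) (snd r)))" .
    also have "\<dots> = (\<Sum>r\<in>idx. a r (W.span {w0}) *
        br (\<beta> (fst r)) (\<beta> (snd r)) (mul (b (fst q)) (b (snd q))))"
    proof (rule sum.cong[OF refl])
      fix r assume "r \<in> idx"
      then have "fst r \<le> n" "snd r \<le> n" by auto
      from tangent_field_graph_eq[OF x this br_zero_basis[OF q]]
      show "a r (W.span {w0}) * ?t q (graph_eq (fst r) (snd r)) = a r (W.span {w0}) *
          br (\<beta> (fst r)) (\<beta> (snd r)) (mul (b (fst q)) (b (snd q)))"
        by (simp only: w0_def)
    qed
    finally show ?thesis .
  qed
  have "(\<Sum>q\<in>idx. \<theta> (graph_eq (fst q) (snd q)) * ?t q f) =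
    (\<Sum>q\<in>idx. \<Sum>r\<in>idx. a r (W.span {w0}) * (\<theta> (graph_eq (fst q) (snd q)) *
      br (\<beta> (fst r)) (\<beta> (snd r)) (mul (b (fst q)) (b (snd q)))))"
    by (rule sum.cong[OF refl]) (simp only: t sum_distrib_left mult.left_commute)
  also have "\<dots> = (\<Sum>r\<in>idx. a r (W.span {w0}) * (\<Sum>q\<in>idx. \<theta> (graph_eq (fst q) (snd q)) *
      br (\<beta> (fst r)) (\<beta> (snd r)) (mul (b (fst q)) (b (snd q)))))"
    by (subst sum.swap) (simp add: sum_distrib_left)
  also have "\<dots> = (\<Sum>r\<in>idx. a r (W.span {w0}) * \<theta> (graph_eq (fst r) (snd r)))"
  proof (rule sum.cong[OF refl])
    fix r assume "r \<in> idx"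
    then have "fst r \<in> {1..n}" "snd r \<in> {1..n}" by auto
    from sum_idx_symmetric[of "\<lambda>q. \<theta> (graph_eq (fst q) (snd q))", OF _ this]
    show "a r (W.span {w0}) * (\<Sum>q\<in>idx. \<theta> (graph_eq (fst q) (snd q)) *
      br (\<beta> (fst r)) (\<beta> (snd r)) (mul (b (fst q)) (b (snd q)))) =
      a r (W.span {w0}) * \<theta> (graph_eq (fst r) (snd r))"
      by (simp only: fst_conv snd_conv graph_eq_commute)
  qed
  also have "\<dots> = \<theta> f" by (rule comb[symmetric]) (use \<theta> in \<open>simp add: w0_def\<close>)
  finally show ?thesis by (simp add: w0_def)
qed

text \<open>
  The tangent vector in the direction \<open>\<Sum>q\<in>idx. sW (G q) (mul (b (fst q)) (b (snd
  q)))\<close>, scaled by \<open>lam\<close>, has the prescribed values.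
\<close>

lemma normal_vector_exists:
  assumes x: "\<beta> 0 x \<noteq> 0" and sym: "\<And>i j. G (i, j) = G (j, i)"
  obtains \<theta> where "\<theta> \<in> W.normal_fibre image_points (W.span {mul x x})"
    "\<And>k l. k \<in> {1..n} \<Longrightarrow> l \<in> {1..n} \<Longrightarrow> \<theta> (graph_eq k l) = (G (k, l) :: 'k)"
proof -
  define u where "u = (\<Sum>q\<in>idx. sW (G q) (mul (b (fst q)) (b (snd q))))"
  have bu: "br (\<beta> k) (\<beta> l) u = (\<Sum>q\<in>idx. G q * br (\<beta> k) (\<beta> l) (mul (b (fst q)) (b (snd q))))"
    if "k \<le> n" "l \<le> n" for k l
  proof -
    interpret L: Vector_Spaces.linear sW "(*)" "br (\<beta> k) (\<beta> l)" by (rule br_linear[OF that])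
    show ?thesis by (simp add: u_def L.sum L.scale)
  qed
  have x0: "x \<noteq> 0" by (rule nonzero_if_coord[OF x])
  show thesis
  proof (rule that)
    show "(\<lambda>f. lam (mul x x) * W.tangent image_points (mul x x) u f) \<in>
      W.normal_fibre image_points (W.span {mul x x})"
      by (rule W.normal_fibre_scale[OF W.tangent_in_normal_fibre[OF mul_self_nonzero[OF x0] span_mul_in_image[OF x0]]])
    fix k l assume kl: "k \<in> {1..n}" "l \<in> {1..n}"
    have "br (\<beta> 0) (\<beta> i) u = 0" if "i \<le> n" for i
      using br_zero_basis[OF _ that] bu[OF le0 that] by (simp add: sum.neutral)
    then show "lam (mul x x) * W.tangent image_points (mul x x) u (graph_eq k l) = G (k, l)"
      using tangent_field_graph_eq[OF x] kl bu sum_idx_symmetric[where G=G, OF sym kl] by auto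
  qed
qed

text \<open>
  The coordinates on \<open>V/x\<close> for a point \<open>x\<close> of the line: the determinant
  with \<open>x\<close> for the first one, and the coordinates that vanish on the line for the
  others.
\<close>

definition cross :: "nat \<Rightarrow> 'v \<Rightarrow> 'v \<Rightarrow> 'k" where
  "cross k x = (if k = 1 then (\<lambda>y. \<beta> 0 x * \<beta> 1 y - \<beta> 1 x * \<beta> 0 y) else \<beta> k)"

text \<open>
  The right hand side does not involve the chart, except through \<open>cross\<close>, which is
  the same for both charts of the line. Both sides are linear in \<open>u\<close>, so it suffices
  to compare them on products.
\<close>

lemma tangent_graph_eq_invariant:
  assumes x: "\<beta> 0 x \<noteq> 0" "\<And>i. i \<in> {2..n} \<Longrightarrow> \<beta> i x = 0" and kl: "k \<in> {1..n}" "l \<in> {1..n}"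
  shows "\<beta> 0 x ^ pair_degree k l * W.tangent image_points (mul x x) u (graph_eq k l) =
    br (cross k x) (cross l x) u"
proof -
  have kl': "k \<le> n" "l \<le> n" "1 \<le> n" using kl by auto
  have cl: "Vector_Spaces.linear sV (*) (cross i x)" if "i \<in> {1..n}" for i
    using that coord_linear[of i] coord_linear[of 0] coord_linear[of 1] kl'
    by (auto simp: cross_def Vector_Spaces.linear_iff algebra_simps)
  have "(\<lambda>u. \<beta> 0 x ^ pair_degree k l / \<beta> 0 x ^ 4 * dir_deriv sW (minor k l) (mul x x) u) = br (cross k x) (cross l x)"
  proof (rule linear_on_Sym_ext)
    have pH: "poly_fun sW (minor k l)" using homogeneous_minor[OF kl'(1,2)] by (simp add: homogeneous_def)
    show "Vector_Spaces.linear sW (*) (\<lambda>u. \<beta> 0 x ^ pair_degree k l / \<beta> 0 x ^ 4 * dir_deriv sW (minor k l) (mul x x) u)"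
      using W.is_vector_space scalar_vector_space W.dir_deriv_direction_add[OF pH] W.dir_deriv_direction_scale[OF pH]
      by (simp add: Vector_Spaces.linear_iff algebra_simps add_divide_distrib)
    show "Vector_Spaces.linear sW (*) (br (cross k x) (cross l x))"
      by (rule linear_polar_form[OF cl[OF kl(1)] cl[OF kl(2)]])
    fix y z
    show "\<beta> 0 x ^ pair_degree k l / \<beta> 0 x ^ 4 * dir_deriv sW (minor k l) (mul x x) (mul y z) =
        br (cross k x) (cross l x) (mul y z)"
      unfolding polar_form_mul[OF cl[OF kl(1)] cl[OF kl(2)]] dir_deriv_minor[OF kl'(1,2)]
      using x(1) x(2)[of k] x(2)[of l] kl
      by (cases "k = 1"; cases "l = 1")
        (simp_all add: cross_def pair_degree_def br_mul kl' field_simps eval_nat_numeral)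
  qed
  from fun_cong[OF this, of u] show ?thesis
    by (simp add: tangent_graph_eq[OF kl'(1,2) x(1)])
qed

end

section \<open>Regular sections along the line\<close>

text \<open>
  A chart of the line: the coordinates \<open>\<beta>\<^sub>2, ..., \<beta>\<^sub>n\<close> vanish
  on the image of \<open>e\<close>, the plane whose projectivization is the line.
\<close>

locale veronese_line = veronese_frame sV sW mul n b \<beta>
  for sV :: "'k::field_char_0 \<Rightarrow> 'v::ab_group_add \<Rightarrow> 'v"
    and sW :: "'k \<Rightarrow> 'w::ab_group_add \<Rightarrow> 'w"
    and mul :: "'v \<Rightarrow> 'v \<Rightarrow> 'w"
    and n :: nat and b :: "nat \<Rightarrow> 'v" and \<beta> :: "nat \<Rightarrow> 'v \<Rightarrow> 'k" +
  fixes e :: "'k ^ 2 \<Rightarrow> 'v" and v :: "'v set \<Rightarrow> 'w set" and \<phi> :: "('k ^ 2) set \<Rightarrow> 'v set"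
    and L :: "'v set set"
  assumes e_linear: "Vector_Spaces.linear (*s) sV e" and e_inj: "inj e"
    and coord_e: "i \<in> {2..n} \<Longrightarrow> \<beta> i (e z) = 0"
    and v_eq: "l \<in> proj_points sV \<Longrightarrow> x \<in> l - {0} \<Longrightarrow> v l = module.span sW {mul x x}"
    and phi_eq: "p \<in> proj_points (*s) \<Longrightarrow> \<phi> p = e ` p"
    and L_eq: "L = \<phi> ` proj_points (*s)"
begin

sublocale P: char0_space "(*s) :: 'k \<Rightarrow> 'k ^ 2 \<Rightarrow> 'k ^ 2"
  by (simp add: char0_space_def vec.vector_space_axioms)

sublocale e: Vector_Spaces.linear "(*s)" sV e
  by (rule e_linear)

lemma e_nonzero: "z \<noteq> 0 \<Longrightarrow> e z \<noteq> 0"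
  using e_inj e.zero by (metis injD)

lemma phi_span: "z \<noteq> 0 \<Longrightarrow> \<phi> (vec.span {z}) = V.span {e z}"
  using phi_eq[OF P.span_in_proj_points, of z] e.span_image[of "{z}"] by simp

lemma v_span: "x \<noteq> 0 \<Longrightarrow> v (V.span {x}) = W.span {mul x x}"
  by (rule v_eq[OF V.span_in_proj_points]) (simp_all add: V.span_base)

abbreviation "sqe z \<equiv> mul (e z) (e z)"

lemma v_phi_span: "z \<noteq> 0 \<Longrightarrow> v (\<phi> (vec.span {z})) = W.span {sqe z}"
  by (simp add: phi_span v_span e_nonzero)

text \<open>
  Continuity and pull-back of regular functions at one point, for a map from the projective line.
  For \<open>evaluates\<close> the condition is that sections, evaluated at the fixed index
  \<open>x\<close>, have regular pull-backs. Both are passed along the nested pull-backs of the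
  theorem, which therefore need not be described as bundles.
\<close>

definition pulls_back :: "('p, 'k) fspace \<Rightarrow> (('k ^ 2) set \<Rightarrow> 'p) \<Rightarrow> 'k ^ 2 \<Rightarrow> bool" where
  "pulls_back B \<psi> z0 \<longleftrightarrow> (\<forall>V. opens B V \<longrightarrow> \<psi> (vec.span {z0}) \<in> V \<longrightarrow>
     (\<forall>\<^sub>F z in zariski_at (*s) z0. \<psi> (vec.span {z}) \<in> V) \<and>
     (\<forall>f. regular B V f \<longrightarrow> rat_germ (*s) 0 z0 (\<lambda>z. f (\<psi> (vec.span {z})))))"

definition evaluates :: "('p, 'k, 'x) vbundle \<Rightarrow> (('k ^ 2) set \<Rightarrow> 'p) \<Rightarrow> 'k ^ 2 \<Rightarrow> 'x \<Rightarrow> bool" where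
  "evaluates E \<psi> z0 x \<longleftrightarrow> (\<forall>V t. opens (base E) V \<longrightarrow> sections E V t \<longrightarrow> \<psi> (vec.span {z0}) \<in> V \<longrightarrow>
     rat_germ (*s) 0 z0 (\<lambda>z. t (\<psi> (vec.span {z})) x))"

lemma pulls_back_proj_space:
  fixes sU :: "'k \<Rightarrow> 'u::ab_group_add \<Rightarrow> 'u"
  assumes "vector_space sU" and z0: "z0 \<noteq> 0"
    and \<psi>: "\<And>z. z \<noteq> 0 \<Longrightarrow> \<psi> (vec.span {z}) = module.span sU {g z}"
    and g: "\<And>d Q. homogeneous sU d Q \<Longrightarrow> homogeneous (*s) (m * d) (\<lambda>z. Q (g z))"
  shows "pulls_back (proj_space sU) \<psi> z0"
proof -
  interpret U: char0_space sU by (simp add: char0_space_def assms)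
  show ?thesis
    unfolding pulls_back_def
  proof (intro allI impI conjI)
    fix V assume V: "opens (proj_space sU) V" "\<psi> (vec.span {z0}) \<in> V"
    then have V': "zariski_open sU V" "U.span {g z0} \<in> V" using \<psi>[OF z0] by simp_all
    have "\<forall>\<^sub>F z in zariski_at (*s) z0. U.span {g z} \<in> V"
      by (rule eventually_zariski_at_comp[where g=g and P="\<lambda>y. U.span {y} \<in> V", OF _ U.zariski_openD[OF V']])
         (use g in blast)
    with P.eventually_nonzero[OF z0]
    show "\<forall>\<^sub>F z in zariski_at (*s) z0. \<psi> (vec.span {z}) \<in> V"
      by eventually_elim (simp add: \<psi>)
    fix f assume "regular (proj_space sU) V f"
    then have "rat_germ sU 0 (g z0) (\<lambda>y. f (U.span {y}))"
      using V'(2) unfolding U.regular_proj_space_iff[OF V'(1)] by blast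
    from rat_germ_comp[where g=g, OF g this]
    have "rat_germ (*s) 0 z0 (\<lambda>z. f (U.span {g z}))" by simp
    then show "rat_germ (*s) 0 z0 (\<lambda>z. f (\<psi> (vec.span {z})))"
    proof (rule rat_germ_cong)
      show "\<forall>\<^sub>F z in zariski_at (*s) z0. f (\<psi> (vec.span {z})) = f (U.span {g z})"
        using P.eventually_nonzero[OF z0] by eventually_elim (simp add: \<psi>)
    qed
  qed
qed

lemma pulls_back_subspace:
  assumes z0: "z0 \<noteq> 0" and B: "pulls_back B \<psi> z0" and X: "\<And>z. z \<noteq> 0 \<Longrightarrow> \<psi> (vec.span {z}) \<in> X"
  shows "pulls_back (subspace_of B X) \<psi> z0"
  unfolding pulls_back_def
proof (intro allI impI conjI)
  fix V assume V: "opens (subspace_of B X) V" "\<psi> (vec.span {z0}) \<in> V"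
  then obtain V' where V': "opens B V'" "V = V' \<inter> X" by (auto simp: subspace_of_def)
  have in_X: "\<forall>\<^sub>F z in zariski_at (*s) z0. \<psi> (vec.span {z}) \<in> X"
    using P.eventually_nonzero[OF z0] by eventually_elim (rule X)
  have "\<forall>\<^sub>F z in zariski_at (*s) z0. \<psi> (vec.span {z}) \<in> V'"
    using B V' V(2) unfolding pulls_back_def by blast
  with in_X show "\<forall>\<^sub>F z in zariski_at (*s) z0. \<psi> (vec.span {z}) \<in> V"
    by eventually_elim (simp add: V')
  fix f assume "regular (subspace_of B X) V f"
  then obtain V'' g where g: "opens B V''" "\<psi> (vec.span {z0}) \<in> V''" "regular B V'' g"
    "\<forall>q\<in>V'' \<inter> X. f q = g q" using V(2) by (auto simp: subspace_of_def)
  have *: "rat_germ (*s) 0 z0 (\<lambda>z. g (\<psi> (vec.span {z})))"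
    "\<forall>\<^sub>F z in zariski_at (*s) z0. \<psi> (vec.span {z}) \<in> V''"
    using B g(1-3) unfolding pulls_back_def by blast+
  from *(1) show "rat_germ (*s) 0 z0 (\<lambda>z. f (\<psi> (vec.span {z})))"
  proof (rule rat_germ_cong)
    show "\<forall>\<^sub>F z in zariski_at (*s) z0. f (\<psi> (vec.span {z})) = g (\<psi> (vec.span {z}))"
      using *(2) in_X by eventually_elim (simp add: g(4))
  qed
qed

lemma evaluates_pullback:
  assumes E: "evaluates E (\<lambda>p. f (\<psi> p)) z0 x" and B: "pulls_back B \<psi> z0"
  shows "evaluates (pullback B f E) \<psi> z0 x"
  unfolding evaluates_def
proof (intro allI impI)
  fix U s assume U: "opens (base (pullback B f E)) U" "sections (pullback B f E) U s" "\<psi> (vec.span {z0}) \<in> U"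
  from U(2,3) obtain U' V m a t where *: "opens B U'" "\<psi> (vec.span {z0}) \<in> U'" "opens (base E) V"
    "f ` U' \<subseteq> V" "\<forall>i<m. regular B U' (a i) \<and> sections E V (t i)"
    "\<forall>r\<in>U'. s r = (\<lambda>x. \<Sum>i<(m::nat). a i r * t i (f r) x)"
    unfolding pullback_def vbundle.simps by blast
  have in_U': "\<forall>\<^sub>F z in zariski_at (*s) z0. \<psi> (vec.span {z}) \<in> U'"
    using B *(1,2) unfolding pulls_back_def by blast
  have "rat_germ (*s) 0 z0 (\<lambda>z. \<Sum>i<m. a i (\<psi> (vec.span {z})) * t i (f (\<psi> (vec.span {z}))) x)"
  proof (rule rat_germ_sum)
    fix i assume "i \<in> {..<m}"
    then have i: "regular B U' (a i)" "sections E V (t i)" using *(5) by auto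
    have fV: "f (\<psi> (vec.span {z0})) \<in> V" using *(2,4) by blast
    have "rat_germ (*s) 0 z0 (\<lambda>z. a i (\<psi> (vec.span {z})))"
      using B *(1,2) i(1) unfolding pulls_back_def by blast
    moreover have "rat_germ (*s) 0 z0 (\<lambda>z. t i (f (\<psi> (vec.span {z}))) x)"
      using E[unfolded evaluates_def, rule_format, OF *(3) i(2) fV] .
    ultimately show "rat_germ (*s) 0 z0 (\<lambda>z. a i (\<psi> (vec.span {z})) * t i (f (\<psi> (vec.span {z}))) x)"
      using rat_germ_mult[of "(*s)" 0 z0 _ 0] by simp
  qed
  then show "rat_germ (*s) 0 z0 (\<lambda>z. s (\<psi> (vec.span {z})) x)"
  proof (rule rat_germ_cong)
    show "\<forall>\<^sub>F z in zariski_at (*s) z0. s (\<psi> (vec.span {z})) x =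
        (\<Sum>i<m. a i (\<psi> (vec.span {z})) * t i (f (\<psi> (vec.span {z}))) x)"
      using in_U' by eventually_elim (simp add: *(6))
  qed
qed

abbreviation "NX \<equiv> normal_bundle (proj_space sW) image_points"

abbreviation "NL \<equiv> pullback P1 \<phi> (restrict_bundle (pullback (proj_space sV) v NX) L)"

lemma homogeneous_e: "homogeneous sV d Q \<Longrightarrow> homogeneous (*s) (1 * d) (\<lambda>z. Q (e z))"
  using homogeneous_linear_comp[OF _ e_linear] by simp

lemma homogeneous_sqe: "homogeneous sW d Q \<Longrightarrow> homogeneous (*s) (2 * d) (\<lambda>z. Q (sqe z))"
  using homogeneous_linear_comp[OF homogeneous_mul_self e_linear] .

lemma homogeneous_id: "homogeneous (*s) d Q \<Longrightarrow> homogeneous (*s) (1 * d) (\<lambda>z. Q z)"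
  by simp

lemma base_NX: "base NX = subspace_of (proj_space sW) image_points"
  by (simp add: normal_bundle_def Let_def)

text \<open>
  By definition of the normal bundle, the value of a regular section on a regular function that
  vanishes on \<open>X\<close> is regular.
\<close>

lemma evaluates_normal_bundle:
  assumes z0: "z0 \<noteq> 0" "\<beta> 0 (e z0) \<noteq> 0" and kl: "k \<le> n" "l \<le> n"
  shows "evaluates NX (\<lambda>p. v (\<phi> p)) z0 (graph_eq k l)"
  unfolding evaluates_def
proof (intro allI impI)
  have hl: "homogeneous sW 1 lam" by (simp add: homogeneous_br[of 0 0, simplified])
  fix V t assume V: "opens (base NX) V" "sections NX V t" "v (\<phi> (vec.span {z0})) \<in> V"
  have pb: "pulls_back (subspace_of (proj_space sW) image_points) (\<lambda>p. v (\<phi> p)) z0"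
  proof (rule pulls_back_subspace[OF z0(1)])
    show "pulls_back (proj_space sW) (\<lambda>p. v (\<phi> p)) z0"
      by (rule pulls_back_proj_space[where \<psi>="\<lambda>p. v (\<phi> p)" and g="\<lambda>z. sqe z", OF W.is_vector_space z0(1) v_phi_span homogeneous_sqe])
    show "v (\<phi> (vec.span {z})) \<in> image_points" if "z \<noteq> 0" for z
      using v_phi_span[OF that] span_mul_in_image[OF e_nonzero[OF that]] by simp
  qed
  have "regular (subspace_of (proj_space sW) image_points) (V \<inter> W.basic_open lam) (\<lambda>p. t p (graph_eq k l))"
    using V(2) W.basic_open_open[OF hl] graph_eq_regular[OF kl] graph_eq_vanishes[OF kl]
    by (auto simp: normal_bundle_def Let_def)
  moreover have "opens (subspace_of (proj_space sW) image_points) (V \<inter> W.basic_open lam)"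
  proof -
    obtain V0 where V0: "zariski_open sW V0" "V = V0 \<inter> image_points"
      using V(1) unfolding base_NX by (auto simp: subspace_of_def)
    have "zariski_open sW (V0 \<inter> W.basic_open lam)"
      using V0(1) W.basic_open_open[OF hl]
      by (auto simp: W.zariski_open_iff intro: eventually_conj)
    then show ?thesis unfolding subspace_of_def V0(2) by auto
  qed
  moreover have "v (\<phi> (vec.span {z0})) \<in> V \<inter> W.basic_open lam"
    using V(3) v_phi_span[OF z0(1)] mul_self_nonzero[OF e_nonzero[OF z0(1)]] z0(2)
      W.span_in_basic_open[OF hl, of "sqe z0"] by (simp add: lam_mul_self)
  ultimately show "rat_germ (*s) 0 z0 (\<lambda>z. t (v (\<phi> (vec.span {z}))) (graph_eq k l))"
    using pb unfolding pulls_back_def by blast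
qed

lemma base_pullback [simp]: "base (pullback B f E) = B"
  by (simp add: pullback_def)

lemma evaluates_NL:
  assumes z0: "z0 \<noteq> 0" "\<beta> 0 (e z0) \<noteq> 0" and kl: "k \<le> n" "l \<le> n"
  shows "evaluates NL (\<lambda>p. p) z0 (graph_eq k l)"
proof (rule evaluates_pullback)
  have V: "pulls_back (proj_space sV) \<phi> z0"
    by (rule pulls_back_proj_space[where \<psi>=\<phi> and g=e, OF V.is_vector_space z0(1) phi_span homogeneous_e])
  have "evaluates (pullback (proj_space sV) v NX) \<phi> z0 (graph_eq k l)"
    by (rule evaluates_pullback[OF evaluates_normal_bundle[OF z0 kl] V])
  moreover have "pulls_back (subspace_of (proj_space sV) L) \<phi> z0"
    by (rule pulls_back_subspace[OF z0(1) V]) (auto simp: L_eq intro: P.span_in_proj_points)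
  ultimately show "evaluates (restrict_bundle (pullback (proj_space sV) v NX) L) \<phi> z0 (graph_eq k l)"
    by (simp add: evaluates_pullback)
  show "pulls_back P1 (\<lambda>p. p) z0"
    by (rule pulls_back_proj_space[where \<psi>="\<lambda>p. p" and g="\<lambda>z. z", OF P.is_vector_space z0(1) refl homogeneous_id])
qed

lemma NL_section_germ:
  assumes "zariski_open (*s) U" "sections NL U s" "vec.span {z0} \<in> U" "\<beta> 0 (e z0) \<noteq> 0" "k \<le> n" "l \<le> n"
  shows "rat_germ (*s) 0 z0 (\<lambda>z. s (vec.span {z}) (graph_eq k l))"
proof -
  have "z0 \<noteq> 0" using assms(4) nonzero_if_coord e.zero by metis
  from evaluates_NL[OF this assms(4-6)] show ?thesis
    using assms(1-3) unfolding evaluates_def by simp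
qed

text \<open>
  The pull-back of a section is generated by itself, with coefficient 1.
\<close>

lemma sections_pullback_pulled:
  assumes "sections E V t" "opens (base E) V" "opens B U" "f ` U \<subseteq> V" "regular B U (\<lambda>_. 1)"
  shows "sections (pullback B f E) U (\<lambda>q. t (f q))"
proof -
  have "\<exists>U' V m a t'. opens B U' \<and> q \<in> U' \<and> U' \<subseteq> U \<and> opens (base E) V \<and> f ` U' \<subseteq> V \<and>
          (\<forall>i<(m::nat). regular B U' (a i) \<and> sections E V (t' i)) \<and>
          (\<forall>r\<in>U'. t (f r) = (\<lambda>x. \<Sum>i<m. a i r * t' i (f r) x))" if "q \<in> U" for q
    by (rule exI[of _ U], rule exI[of _ V], rule exI[of _ 1], rule exI[of _ "\<lambda>_ _. 1"], rule exI[of _ "\<lambda>_. t"])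
       (use assms that in simp)
  then show ?thesis unfolding pullback_def vbundle.simps by blast
qed

lemma frame_section_on_line:
  assumes q: "q \<in> idx"
  shows "sections (restrict_bundle (pullback (proj_space sV) v NX) L) (V.basic_open (\<beta> 0) \<inter> L)
    (\<lambda>l. W.tangent_field image_points lam (mul (b (fst q)) (b (snd q))) (v l))"
proof -
  have hb: "homogeneous sV 1 (\<beta> 0)" by (rule homogeneous_linear[OF coord_linear]) simp
  have hl: "homogeneous sW 1 lam" by (simp add: homogeneous_br[of 0 0, simplified])
  have one: "regular (proj_space sV) U (\<lambda>_. 1)" if "zariski_open sV U" for U
    using that by (simp add: V.regular_proj_space_iff rat_germ_const)
  have op: "zariski_open sV (V.basic_open (\<beta> 0))" by (rule V.basic_open_open[OF hb])
  have im: "v ` V.basic_open (\<beta> 0) \<subseteq> W.basic_open lam \<inter> image_points"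
    using v_span span_mul_in_image mul_self_nonzero
    by (auto simp: V.basic_open_def W.span_in_basic_open[OF hl] lam_mul_self)
  have 1: "sections (pullback (proj_space sV) v NX) (V.basic_open (\<beta> 0))
    (\<lambda>l. W.tangent_field image_points lam (mul (b (fst q)) (b (snd q))) (v l))"
  proof (rule sections_pullback_pulled[OF W.tangent_field_section[OF br_linear[OF le0 le0] image_points_subset]])
    show "opens (base NX) (W.basic_open lam \<inter> image_points)"
      unfolding base_NX using W.basic_open_open[OF hl] by (auto simp: subspace_of_def)
  qed (use op im one in auto)
  show ?thesis
  proof (rule sections_pullback_pulled[OF 1])
    show "opens (subspace_of (base (pullback (proj_space sV) v NX)) L) (V.basic_open (\<beta> 0) \<inter> L)"
      using op by (auto simp: subspace_of_def)
    show "regular (subspace_of (base (pullback (proj_space sV) v NX)) L) (V.basic_open (\<beta> 0) \<inter> L) (\<lambda>_. 1)"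
      using op one[OF op] unfolding base_pullback subspace_of_def fspace.simps V.opens_proj_space by blast
  qed (use op in auto)
qed

text \<open>
  The sum in \<open>normal_frame\<close> exhibits \<open>s\<close> near the point as a combination
  of pulled back sections, and its coefficients are the values of \<open>s\<close> on the
  equations.
\<close>

lemma NL_section_local:
  assumes U: "zariski_open (*s) U" "vec.span {z0} \<in> U" and z0: "\<beta> 0 (e z0) \<noteq> 0"
    and s: "\<And>p. p \<in> U \<Longrightarrow> s p \<in> W.normal_fibre image_points (v (\<phi> p))"
    and germ: "\<And>k l. k \<in> {1..n} \<Longrightarrow> l \<in> {1..n} \<Longrightarrow> rat_germ (*s) 0 z0 (\<lambda>z. s (vec.span {z}) (graph_eq k l))"
  shows "\<exists>U' V m a t.
          opens P1 U' \<and> vec.span {z0} \<in> U' \<and> U' \<subseteq> U \<and>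
          opens (base (restrict_bundle (pullback (proj_space sV) v NX) L)) V \<and> \<phi> ` U' \<subseteq> V \<and>
          (\<forall>i<(m::nat). regular P1 U' (a i) \<and> sections (restrict_bundle (pullback (proj_space sV) v NX) L) V (t i)) \<and>
          (\<forall>r\<in>U'. s r = (\<lambda>x. \<Sum>i<m. a i r * t i (\<phi> r) x))"
proof -
  have nz: "z0 \<noteq> 0" using z0 nonzero_if_coord e.zero by metis
  have hb: "homogeneous sV 1 (\<beta> 0)" by (rule homogeneous_linear[OF coord_linear]) simp
  have g: "\<forall>\<^sub>F z in zariski_at (*s) z0. \<forall>q\<in>idx. rat_germ (*s) 0 z (\<lambda>z. s (vec.span {z}) (graph_eq (fst q) (snd q)))"
    by (rule eventually_ball_finite) (auto intro!: P.eventually_rat_germ germ)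
  have bz: "\<forall>\<^sub>F z in zariski_at (*s) z0. \<beta> 0 (e z) \<noteq> 0"
    by (rule eventually_homogeneous_nonzero[OF homogeneous_e[OF hb] z0])
  obtain U' where U': "zariski_open (*s) U'" "vec.span {z0} \<in> U'"
    "\<And>z. vec.span {z} \<in> U' \<Longrightarrow> z \<noteq> 0 \<and> (\<forall>q\<in>idx. rat_germ (*s) 0 z (\<lambda>z. s (vec.span {z}) (graph_eq (fst q) (snd q)))) \<and>
      \<beta> 0 (e z) \<noteq> 0 \<and> vec.span {z} \<in> U"
    "U' \<subseteq> proj_points (*s)"
    by (rule P.zariski_nbhd[OF eventually_conj[OF g eventually_conj[OF bz P.zariski_openD[OF U]]] nz]) (rule that)
  define V where "V = V.basic_open (\<beta> 0) \<inter> L"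
  have reg: "regular P1 U' (\<lambda>r. s r (graph_eq (fst q) (snd q)))" if "q \<in> idx" for q
    using U'(3) that by (simp only: P.regular_proj_space_iff[OF U'(1)]) blast
  have in_U: "\<forall>r\<in>U'. r \<in> U" unfolding P.ball_open_iff[OF U'(1)] using U'(3) by blast
  have phiV: "\<forall>r\<in>U'. \<phi> r \<in> V"
    unfolding P.ball_open_iff[OF U'(1)]
  proof (intro allI impI)
    fix z assume z: "vec.span {z} \<in> U'"
    have "\<phi> (vec.span {z}) \<in> L" using z U'(4) by (auto simp: L_eq)
    moreover have "\<phi> (vec.span {z}) \<in> V.basic_open (\<beta> 0)"
      using U'(3)[OF z] by (simp add: phi_span V.span_in_basic_open[OF hb] e_nonzero)
    ultimately show "\<phi> (vec.span {z}) \<in> V" by (simp add: V_def)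
  qed
  have eq: "\<forall>r\<in>U'. \<forall>f. s r f = (\<Sum>q\<in>idx. s r (graph_eq (fst q) (snd q)) *
      W.tangent_field image_points lam (mul (b (fst q)) (b (snd q))) (v (\<phi> r)) f)"
    unfolding P.ball_open_iff[OF U'(1)]
  proof (intro allI impI)
    fix z f assume "vec.span {z} \<in> U'"
    from U'(3)[OF this] have z: "z \<noteq> 0" "\<beta> 0 (e z) \<noteq> 0" "vec.span {z} \<in> U" by auto
    have "s (vec.span {z}) \<in> W.normal_fibre image_points (W.span {sqe z})"
      using s[OF z(3)] v_phi_span[OF z(1)] by simp
    from normal_frame[OF z(2) this]
    show "s (vec.span {z}) f = (\<Sum>q\<in>idx. s (vec.span {z}) (graph_eq (fst q) (snd q)) *
      W.tangent_field image_points lam (mul (b (fst q)) (b (snd q))) (v (\<phi> (vec.span {z}))) f)"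
      unfolding v_phi_span[OF z(1)]
        W.tangent_field_span[OF br_linear[OF le0 le0] mul_self_nonzero[OF e_nonzero[OF z(1)]]
          span_mul_in_image[OF e_nonzero[OF z(1)]]] .
  qed
  obtain \<kappa> where \<kappa>: "bij_betw \<kappa> {0..<card idx} idx"
    using ex_bij_betw_nat_finite[of idx] by blast
  have \<kappa>_in: "\<kappa> i \<in> idx" if "i < card idx" for i
    using bij_betwE[OF \<kappa>] that by auto
  show ?thesis
  proof (intro exI conjI)
    show "opens P1 U'" using U'(1) by simp
    show "vec.span {z0} \<in> U'" by (rule U'(2))
    show "U' \<subseteq> U" using in_U by blast
    show "opens (base (restrict_bundle (pullback (proj_space sV) v NX) L)) V"
      using V.basic_open_open[OF hb] unfolding V_def by (auto simp: subspace_of_def)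
    show "\<phi> ` U' \<subseteq> V" using phiV by blast
    show "\<forall>i<card idx. regular P1 U' (\<lambda>r. s r (graph_eq (fst (\<kappa> i)) (snd (\<kappa> i)))) \<and>
      sections (restrict_bundle (pullback (proj_space sV) v NX) L) V
        (\<lambda>l. W.tangent_field image_points lam (mul (b (fst (\<kappa> i))) (b (snd (\<kappa> i)))) (v l))"
      unfolding V_def using reg[OF \<kappa>_in] frame_section_on_line[OF \<kappa>_in] by blast
    show "\<forall>r\<in>U'. s r = (\<lambda>x. \<Sum>i<card idx. s r (graph_eq (fst (\<kappa> i)) (snd (\<kappa> i))) *
        W.tangent_field image_points lam (mul (b (fst (\<kappa> i))) (b (snd (\<kappa> i)))) (v (\<phi> r)) x)"
    proof (intro ballI ext)
      fix r x assume r: "r \<in> U'"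
      show "s r x = (\<Sum>i<card idx. s r (graph_eq (fst (\<kappa> i)) (snd (\<kappa> i))) *
        W.tangent_field image_points lam (mul (b (fst (\<kappa> i))) (b (snd (\<kappa> i)))) (v (\<phi> r)) x)"
        using bspec[OF eq r, rule_format, of x] sum.reindex_bij_betw[OF \<kappa>,
          of "\<lambda>q. s r (graph_eq (fst q) (snd q)) *
            W.tangent_field image_points lam (mul (b (fst q)) (b (snd q))) (v (\<phi> r)) x"]
        by (simp only: atLeast0LessThan)
    qed
  qed
qed

text \<open>
  Multiplication by the invertible function \<open>\<beta>\<^sub>0\<^sup>d\<close> trivializes
  \<open>\<O>(d)\<close> on the chart.
\<close>

lemma germ_times_coord_power:
  assumes z0: "\<beta> 0 (e z0) \<noteq> 0"
    and F: "\<forall>\<^sub>F z in zariski_at (*s) z0. F z = \<beta> 0 (e z) ^ d * G z"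
  shows "rat_germ (*s) d z0 F \<longleftrightarrow> rat_germ (*s) 0 z0 G"
proof -
  have hb: "homogeneous sV 1 (\<beta> 0)" by (rule homogeneous_linear[OF coord_linear]) simp
  have hp: "homogeneous (*s) d (\<lambda>z. \<beta> 0 (e z) ^ d)"
    using homogeneous_power[OF homogeneous_e[OF hb], of d] by simp
  show ?thesis
  proof
    assume "rat_germ (*s) d z0 F"
    then have "rat_germ (*s) 0 z0 (\<lambda>z. F z / \<beta> 0 (e z) ^ d)"
      by (intro rat_germ_divide_homogeneous[OF _ hp]) (use z0 in simp_all)
    then show "rat_germ (*s) 0 z0 G"
    proof (rule rat_germ_cong)
      show "\<forall>\<^sub>F z in zariski_at (*s) z0. G z = F z / \<beta> 0 (e z) ^ d"
        using F eventually_homogeneous_nonzero[OF homogeneous_e[OF hb] z0]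
        by eventually_elim simp
    qed
  next
    assume "rat_germ (*s) 0 z0 G"
    from rat_germ_mult[OF rat_germ_homogeneous[OF hp] this]
    have "rat_germ (*s) d z0 (\<lambda>z. \<beta> 0 (e z) ^ d * G z)" by simp
    then show "rat_germ (*s) d z0 F" by (rule rat_germ_cong) (rule F)
  qed
qed

end

section \<open>The splitting on the line\<close>

text \<open>
  The pairs \<open>2 \<le> k \<le> l < m + 2\<close>. Together with the pairs \<open>(1,
  l)\<close> they index the summands of \<open>Sym\<^sup>2(V/x)\<close>, listed in the order of
  the degrees 2, 3, 4.
\<close>

primrec upper_pairs :: "nat \<Rightarrow> (nat \<times> nat) list" where
  "upper_pairs 0 = []"
| "upper_pairs (Suc m) = upper_pairs m @ map (\<lambda>k. (k, m + 2)) [2..<m + 3]"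

lemma length_upper_pairs: "length (upper_pairs m) = Suc m * m div 2"
proof (induction m)
  case (Suc m)
  have "Suc (Suc m) * Suc m = Suc m * m + Suc m * 2" by simp
  then have "Suc (Suc m) * Suc m div 2 = Suc m * m div 2 + Suc m"
    by (metis div_mult_self1 add.commute zero_neq_numeral)
  then show ?case using Suc by simp
qed simp

lemma set_upper_pairs: "set (upper_pairs m) = {(k, l). 2 \<le> k \<and> k \<le> l \<and> l < m + 2}"
proof (induction m)
  case (Suc m)
  have "(\<lambda>k. (k, m + 2)) ` {2..<m + 3} = {(k, l). 2 \<le> k \<and> k \<le> l \<and> l = m + 2}" by auto
  with Suc show ?case by (auto simp del: upt_Suc)
qed auto

lemma distinct_upper_pairs: "distinct (upper_pairs m)"
  by (induction m) (auto simp: distinct_map inj_on_def set_upper_pairs simp del: upt_Suc)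

definition index_pairs :: "nat \<Rightarrow> (nat \<times> nat) list" where
  "index_pairs n = upper_pairs (n - 1) @ map (\<lambda>l. (1, l)) [2..<Suc n] @ [(1, 1)]"

lemma index_pairs_degrees:
  assumes "n \<ge> 1"
  shows "map (\<lambda>(k, l). pair_degree k l) (index_pairs n) =
    replicate (n * (n - 1) div 2) 2 @ replicate (n - 1) 3 @ [4]"
proof -
  have "map (\<lambda>(k, l). pair_degree k l) (upper_pairs (n - 1)) = replicate (n * (n - 1) div 2) 2"
    by (rule replicate_eqI)
       (use assms in \<open>auto simp: length_upper_pairs set_upper_pairs pair_degree_def\<close>)
  moreover have "map (\<lambda>l. pair_degree 1 l) [2..<Suc n] = replicate (n - 1) 3"
    by (rule replicate_eqI) (auto simp: pair_degree_def simp del: upt_Suc)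
  ultimately show ?thesis
    by (simp add: index_pairs_def pair_degree_def[of "Suc 0" "Suc 0"] comp_def del: upt_Suc)
qed

lemma set_index_pairs:
  assumes "n \<ge> 1"
  shows "set (index_pairs n) = {(k, l). 1 \<le> k \<and> k \<le> l \<and> l \<le> n}"
proof -
  have "(\<lambda>l. (1, l)) ` {2..<Suc n} = {(k, l). k = (1::nat) \<and> 2 \<le> l \<and> l \<le> n}" by auto
  moreover have "n - 1 + 2 = Suc n" using assms by simp
  ultimately have "set (index_pairs n) = {(k, l). (2::nat) \<le> k \<and> k \<le> l \<and> l < Suc n} \<union>
      ({(k, l). k = 1 \<and> 2 \<le> l \<and> l \<le> n} \<union> {(1, 1)})"
    by (simp only: index_pairs_def set_append set_map set_upt set_upper_pairs list.set)
  also have "\<dots> = {(k, l). 1 \<le> k \<and> k \<le> l \<and> l \<le> n}"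
  proof (rule set_eqI)
    fix q :: "nat \<times> nat"
    show "q \<in> {(k, l). 2 \<le> k \<and> k \<le> l \<and> l < Suc n} \<union>
      ({(k, l). k = 1 \<and> 2 \<le> l \<and> l \<le> n} \<union> {(1, 1)}) \<longleftrightarrow>
      q \<in> {(k, l). 1 \<le> k \<and> k \<le> l \<and> l \<le> n}"
      using assms by (cases q) (simp, arith)
  qed
  finally show ?thesis .
qed

lemma distinct_index_pairs: "distinct (index_pairs n)"
  by (auto simp: index_pairs_def distinct_upper_pairs set_upper_pairs distinct_map inj_on_def
      simp del: upt_Suc)

context char0_space begin

text \<open>
  Extend \<open>v0, v1\<close> to a basis and number it. When these two span the plane of the
  line, the remaining coordinates vanish on it.
\<close>

lemma adapted_coordinates:
  assumes dim: "dim UNIV = n + 1" and ind: "independent {v0, v1}" and ne: "v0 \<noteq> v1"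
  obtains a \<alpha> where "a 0 = v0" "a (1::nat) = v1"
    "\<And>i. i \<le> n \<Longrightarrow> Vector_Spaces.linear s (*) (\<alpha> i)"
    "\<And>i j. i \<le> n \<Longrightarrow> j \<le> n \<Longrightarrow> \<alpha> i (a j) = (if i = j then 1 else (0::'k))"
    "\<And>x. x = (\<Sum>i\<le>n. s (\<alpha> i x) (a i))"
proof -
  obtain B0 where B0: "independent B0" "UNIV \<subseteq> span B0" "card B0 = n + 1"
    using basis_exists[of UNIV] dim by metis
  then have fB0: "finite B0" using card.infinite by fastforce
  define B where "B = extend_basis {v0, v1}"
  have B: "{v0, v1} \<subseteq> B" "independent B" "span B = UNIV"
    unfolding B_def using extend_basis_superset[OF ind] independent_extend_basis[OF ind] span_extend_basis[OF ind]
    by auto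
  have fB: "finite B" using independent_span_bound[OF fB0 B(2)] B0(2) by auto
  have "dim UNIV = card B" using dim_eq_card[of B UNIV] B by simp
  then have cB: "card B = n + 1" using dim by simp
  have "card (B - {v0, v1}) = n - 1" using B(1) ne cB fB by (simp add: card_Diff_subset)
  moreover have n1: "n \<ge> 1" using card_mono[OF fB B(1)] ne cB by simp
  ultimately have "card {2..n} = card (B - {v0, v1})" by simp
  then obtain g where g: "bij_betw g {2..n} (B - {v0, v1})"
    using finite_same_card_bij[of "{2..n}" "B - {v0, v1}"] fB by auto
  define a where "a i = (if i = 0 then v0 else if i = 1 then v1 else g i)" for i
  have "bij_betw a ({0, 1} \<union> {2..n}) ({v0, v1} \<union> (B - {v0, v1}))"
  proof (rule bij_betw_combine)
    show "bij_betw a {0, 1} {v0, v1}" using ne by (auto simp: bij_betw_def a_def inj_on_def)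
    show "bij_betw a {2..n} (B - {v0, v1})"
      using g by (rule bij_betw_cong[THEN iffD1, rotated]) (auto simp: a_def)
  qed auto
  moreover have "{0, 1} \<union> {2..n} = {..n}" using n1 by auto
  moreover have "{v0, v1} \<union> (B - {v0, v1}) = B" using B(1) by auto
  ultimately have a: "bij_betw a {..n} B" by simp
  define \<alpha> where "\<alpha> i x = representation B x (a i)" for i x
  show thesis
  proof (rule that[of a \<alpha>])
    show "a 0 = v0" "a 1 = v1" by (simp_all add: a_def)
    show "Vector_Spaces.linear s (*) (\<alpha> i)" for i
      unfolding Vector_Spaces.linear_iff \<alpha>_def
      using representation_add[OF B(2)] representation_scale[OF B(2)] B(3) is_vector_space
      by (auto simp: vector_space_def module_def algebra_simps)
    show "\<alpha> i (a j) = (if i = j then 1 else 0)" if "i \<le> n" "j \<le> n" for i j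
    proof -
      have "a j \<in> B" using a that by (auto simp: bij_betw_def)
      moreover have "a i = a j \<longleftrightarrow> i = j" using a that by (auto simp: bij_betw_def inj_on_def)
      ultimately show ?thesis unfolding \<alpha>_def using representation_basis[OF B(2)] by auto
    qed
    show "x = (\<Sum>i\<le>n. s (\<alpha> i x) (a i))" for x
    proof -
      have "(\<Sum>i\<le>n. s (\<alpha> i x) (a i)) = (\<Sum>w\<in>B. s (representation B x w) w)"
        unfolding \<alpha>_def by (rule sum.reindex_bij_betw[OF a])
      also have "\<dots> = x" by (rule sum_representation_eq) (use B fB in auto)
      finally show ?thesis by simp
    qed
  qed
qed

end

text \<open>
  A basis \<open>a 0, a 1\<close> of the plane gives two charts, with first basis vector \<open>a
  0\<close> and \<open>a 1\<close>. A sign in the second chart makes the determinant \<open>cross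
  1 x\<close> the same in both.
\<close>

locale veronese_two_charts =
  C0: veronese_line sV sW mul n a \<alpha> e v \<phi> L +
  C1: veronese_line sV sW mul n a' \<alpha>' e v \<phi> L
  for sV :: "'k::field_char_0 \<Rightarrow> 'v::ab_group_add \<Rightarrow> 'v"
    and sW :: "'k \<Rightarrow> 'w::ab_group_add \<Rightarrow> 'w"
    and mul n a \<alpha> a' \<alpha>' e v \<phi> L +
  assumes n2: "n \<ge> 2"
    and cover: "z \<noteq> 0 \<Longrightarrow> \<alpha> 0 (e z) \<noteq> 0 \<or> \<alpha>' 0 (e z) \<noteq> 0"
    and same_cross: "k \<in> {1..n} \<Longrightarrow> C0.cross k x = C1.cross k x"
begin

abbreviation "fib p \<equiv> C0.W.normal_fibre C0.image_points (v (\<phi> p))"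

text \<open>
  The coordinate of \<open>\<theta>\<close> on \<open>Sym\<^sup>2(V/x)\<close> with the given pair
  of indices, as a homogeneous function of a representative \<open>z\<close> of the point,
  computed in the first chart if possible. Each chart makes it visibly linear in
  \<open>\<theta>\<close> and homogeneous in \<open>z\<close>.
\<close>

definition coeff_along :: "nat \<times> nat \<Rightarrow> (('w set \<Rightarrow> 'k) \<Rightarrow> 'k) \<Rightarrow> 'k ^ 2 \<Rightarrow> 'k" where
  "coeff_along q \<theta> z = (case q of (k, l) \<Rightarrow>
     if \<alpha> 0 (e z) \<noteq> 0 then \<alpha> 0 (e z) ^ pair_degree k l * \<theta> (C0.graph_eq k l)
     else \<alpha>' 0 (e z) ^ pair_degree k l * \<theta> (C1.graph_eq k l))"

text \<open>
  Every normal vector is a combination of tangent vectors, for which the coordinate has a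
  description without charts.
\<close>

lemma charts_agree:
  assumes z: "\<alpha> 0 (e z) \<noteq> 0" "\<alpha>' 0 (e z) \<noteq> 0" and \<theta>: "\<theta> \<in> fib (vec.span {z})"
    and kl: "k \<in> {1..n}" "l \<in> {1..n}"
  shows "\<alpha>' 0 (e z) ^ pair_degree k l * \<theta> (C1.graph_eq k l) = \<alpha> 0 (e z) ^ pair_degree k l * \<theta> (C0.graph_eq k l)"
proof -
  have nz: "z \<noteq> 0" using z(1) C0.nonzero_if_coord C0.e.zero by metis
  let ?w = "mul (e z) (e z)"
  have \<theta>': "\<theta> \<in> C0.W.normal_fibre C0.image_points (C0.W.span {?w})"
    using \<theta> C0.v_phi_span[OF nz] by simp
  let ?T = "\<lambda>q. C0.W.tangent C0.image_points ?w (mul (a (fst q)) (a (snd q)))"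
  have eq: "\<theta> f = (\<Sum>q\<in>C0.idx. \<theta> (C0.graph_eq (fst q) (snd q)) * (C0.lam ?w * ?T q f))" for f
    by (rule C0.normal_frame[OF z(1) \<theta>'])
  have inv: "\<alpha>' 0 (e z) ^ pair_degree k l * ?T q (C1.graph_eq k l) = \<alpha> 0 (e z) ^ pair_degree k l * ?T q (C0.graph_eq k l)" for q
    using C0.tangent_graph_eq_invariant[OF z(1) C0.coord_e kl] C1.tangent_graph_eq_invariant[OF z(2) C1.coord_e kl]
    by (simp add: same_cross[OF kl(1)] same_cross[OF kl(2)])
  have "\<alpha>' 0 (e z) ^ pair_degree k l * \<theta> (C1.graph_eq k l) = (\<Sum>q\<in>C0.idx. \<theta> (C0.graph_eq (fst q) (snd q)) *
      (C0.lam ?w * (\<alpha>' 0 (e z) ^ pair_degree k l * ?T q (C1.graph_eq k l))))"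
    unfolding eq[of "C1.graph_eq k l"] sum_distrib_left by (rule sum.cong[OF refl]) (simp only: mult_ac)
  also have "\<dots> = \<alpha> 0 (e z) ^ pair_degree k l * \<theta> (C0.graph_eq k l)"
    unfolding inv eq[of "C0.graph_eq k l"] sum_distrib_left by (rule sum.cong[OF refl]) (simp only: mult_ac)
  finally show ?thesis .
qed

lemma coeff_along_chart0: "\<alpha> 0 (e z) \<noteq> 0 \<Longrightarrow>
    coeff_along (k, l) \<theta> z = \<alpha> 0 (e z) ^ pair_degree k l * \<theta> (C0.graph_eq k l)"
  by (simp add: coeff_along_def)

lemma coeff_along_chart1:
  "\<alpha>' 0 (e z) \<noteq> 0 \<Longrightarrow> \<theta> \<in> fib (vec.span {z}) \<Longrightarrow> k \<in> {1..n} \<Longrightarrow> l \<in> {1..n} \<Longrightarrow>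
    coeff_along (k, l) \<theta> z = \<alpha>' 0 (e z) ^ pair_degree k l * \<theta> (C1.graph_eq k l)"
  using charts_agree[of z \<theta> k l] by (auto simp: coeff_along_def)

lemma coord_scale: "\<alpha> 0 (e (c *s z)) = c * \<alpha> 0 (e z)" "\<alpha>' 0 (e (c *s z)) = c * \<alpha>' 0 (e z)"
  using C0.coord_linear[of 0] C1.coord_linear[of 0]
  by (simp_all add: C0.e.scale Vector_Spaces.linear_iff)

lemma coeff_along_scale: "coeff_along q \<theta> (c *s z) = c ^ (case q of (k, l) \<Rightarrow> pair_degree k l) * coeff_along q \<theta> z"
proof (cases q)
  case (Pair k l)
  show ?thesis
  proof (cases "c = 0")
    case True
    have "\<alpha> 0 (e (c *s z)) = 0" "\<alpha>' 0 (e (c *s z)) = 0" unfolding coord_scale True by simp_all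
    then show ?thesis by (simp add: Pair coeff_along_def True pair_degree_def)
  next
    case False
    then show ?thesis by (simp add: Pair coeff_along_def coord_scale power_mult_distrib)
  qed
qed

lemma coeff_along_add: "coeff_along q (\<lambda>x. \<theta> x + \<eta> x) z = coeff_along q \<theta> z + coeff_along q \<eta> z"
  by (cases q) (simp add: coeff_along_def algebra_simps)

lemma coeff_along_smult: "coeff_along q (\<lambda>x. c * \<theta> x) z = c * coeff_along q \<theta> z"
  by (cases q) (simp add: coeff_along_def algebra_simps)

text \<open>
  In a chart, the coordinates are the values on the equations up to a nonzero factor.
\<close>

lemma coeff_along_determines:
  assumes z: "z \<noteq> 0" and \<theta>: "\<theta> \<in> fib (vec.span {z})" "\<eta> \<in> fib (vec.span {z})"
    and eq: "\<And>q. q \<in> set (index_pairs n) \<Longrightarrow> coeff_along q \<theta> z = coeff_along q \<eta> z"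
  shows "\<theta> = \<eta>"
proof -
  have eq': "coeff_along (k, l) \<theta> z = coeff_along (k, l) \<eta> z" if "k \<in> {1..n}" "l \<in> {1..n}" for k l
  proof -
    have "coeff_along (k, l) \<theta> z = coeff_along (l, k) \<theta> z" for \<theta>
      by (simp add: coeff_along_def C0.graph_eq_commute[of k l] C1.graph_eq_commute[of k l] pair_degree_def)
    moreover have "(k, l) \<in> set (index_pairs n) \<or> (l, k) \<in> set (index_pairs n)"
      using that n2 by (auto simp: set_index_pairs)
    ultimately show ?thesis using eq by metis
  qed
  consider "\<alpha> 0 (e z) \<noteq> 0" | "\<alpha>' 0 (e z) \<noteq> 0" using cover[OF z] by blast
  then show ?thesis
  proof cases
    case 1
    have graph_eq: "\<theta> (C0.graph_eq (fst q) (snd q)) = \<eta> (C0.graph_eq (fst q) (snd q))" if "q \<in> C0.idx" for q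
      using eq'[of "fst q" "snd q"] that 1 by (auto simp: coeff_along_chart0)
    note fr = C0.normal_frame[OF 1, folded C0.v_phi_span[OF z]]
    show ?thesis
    proof
      fix f
      show "\<theta> f = \<eta> f"
        unfolding fr[OF \<theta>(1), of f] fr[OF \<theta>(2), of f]
        by (rule sum.cong[OF refl]) (simp only: graph_eq)
    qed
  next
    case 2
    have graph_eq: "\<theta> (C1.graph_eq (fst q) (snd q)) = \<eta> (C1.graph_eq (fst q) (snd q))" if "q \<in> C0.idx" for q
      using eq'[of "fst q" "snd q"] that 2 \<theta> by (auto simp: coeff_along_chart1)
    note fr = C1.normal_frame[OF 2, folded C1.v_phi_span[OF z]]
    show ?thesis
    proof
      fix f
      show "\<theta> f = \<eta> f"
        unfolding fr[OF \<theta>(1), of f] fr[OF \<theta>(2), of f]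
        by (rule sum.cong[OF refl]) (simp only: graph_eq)
    qed
  qed
qed

lemma coeff_along_surjective:
  assumes z: "z \<noteq> 0"
  shows "\<exists>\<theta>\<in>fib (vec.span {z}). \<forall>q\<in>set (index_pairs n). coeff_along q \<theta> z = c q"
proof -
  \<comment> \<open>The list only has the pairs \<open>k \<le> l\<close>; extend \<open>c\<close> symmetrically.\<close>
  define c' where "c' q = (case q of (k, l) \<Rightarrow> c (min k l, max k l))" for q :: "nat \<times> nat"
  have c': "c' q = c q" if q: "q \<in> set (index_pairs n)" for q
  proof -
    obtain k l where kl: "q = (k, l)" by fastforce
    then have "k \<le> l" using q n2 by (simp add: set_index_pairs)
    then show ?thesis by (simp add: kl c'_def min_absorb1 max_absorb2)
  qed
  have rng: "fst q \<in> {1..n} \<and> snd q \<in> {1..n}" if "q \<in> set (index_pairs n)" for q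
    using that n2 unfolding set_index_pairs[OF order.trans[OF one_le_numeral n2]] by auto
  consider "\<alpha> 0 (e z) \<noteq> 0" | "\<alpha>' 0 (e z) \<noteq> 0" using cover[OF z] by blast
  then show ?thesis
  proof cases
    case 1
    define G where "G q = (case q of (k, l) \<Rightarrow> c' (k, l) / \<alpha> 0 (e z) ^ pair_degree k l)" for q
    have "G (i, j) = G (j, i)" for i j by (simp add: G_def c'_def pair_degree_def min.commute max.commute)
    from C0.normal_vector_exists[where G=G, OF 1 this] obtain \<theta> where
      \<theta>: "\<theta> \<in> fib (vec.span {z})" "\<And>k l. k \<in> {1..n} \<Longrightarrow> l \<in> {1..n} \<Longrightarrow> \<theta> (C0.graph_eq k l) = G (k, l)"
      unfolding C0.v_phi_span[OF z] by blast
    have "coeff_along q \<theta> z = c q" if "q \<in> set (index_pairs n)" for q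
    proof -
      obtain k l where kl: "q = (k, l)" by fastforce
      show ?thesis using rng[OF that] 1 c'[OF that] by (simp add: kl coeff_along_chart0 \<theta>(2) G_def)
    qed
    then show ?thesis using \<theta>(1) by blast
  next
    case 2
    define G where "G q = (case q of (k, l) \<Rightarrow> c' (k, l) / \<alpha>' 0 (e z) ^ pair_degree k l)" for q
    have "G (i, j) = G (j, i)" for i j by (simp add: G_def c'_def pair_degree_def min.commute max.commute)
    from C1.normal_vector_exists[where G=G, OF 2 this] obtain \<theta> where
      \<theta>: "\<theta> \<in> fib (vec.span {z})" "\<And>k l. k \<in> {1..n} \<Longrightarrow> l \<in> {1..n} \<Longrightarrow> \<theta> (C1.graph_eq k l) = G (k, l)"
      unfolding C0.v_phi_span[OF z] by blast
    have "coeff_along q \<theta> z = c q" if "q \<in> set (index_pairs n)" for q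
    proof -
      obtain k l where kl: "q = (k, l)" by fastforce
      show ?thesis using rng[OF that] 2 c'[OF that] by (simp add: kl coeff_along_chart1 \<theta> G_def)
    qed
    then show ?thesis using \<theta>(1) by blast
  qed
qed


abbreviation "Lsum \<equiv> direct_sum P1 (map (twisting_bundle (*s)) (map (\<lambda>(k, l). pair_degree k l) (index_pairs n)))
  :: (('k ^ 2) set, 'k, nat \<times> ('k ^ 2)) vbundle"

text \<open>
  The normal vectors in coordinates, extended by zero as the fibres of \<open>\<O>(d)\<close> and
  of direct sums demand.
\<close>

definition \<Phi> :: "('k ^ 2) set \<Rightarrow> (('w set \<Rightarrow> 'k) \<Rightarrow> 'k) \<Rightarrow> nat \<times> ('k ^ 2) \<Rightarrow> 'k" where
  "\<Phi> p \<theta> = (\<lambda>(m, z). if m < length (index_pairs n) \<and> z \<in> p then coeff_along (index_pairs n ! m) \<theta> z else 0)"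

lemma germs_chart0:
  assumes z0: "\<alpha> 0 (e z0) \<noteq> 0"
  shows "rat_germ (*s) (pair_degree k l) z0 (\<lambda>z. coeff_along (k, l) (s (vec.span {z})) z) \<longleftrightarrow>
    rat_germ (*s) 0 z0 (\<lambda>z. s (vec.span {z}) (C0.graph_eq k l))"
proof (rule C0.germ_times_coord_power[OF z0])
  have hb: "homogeneous sV 1 (\<alpha> 0)" by (rule homogeneous_linear[OF C0.coord_linear]) simp
  show "\<forall>\<^sub>F z in zariski_at (*s) z0. coeff_along (k, l) (s (vec.span {z})) z =
      \<alpha> 0 (e z) ^ pair_degree k l * s (vec.span {z}) (C0.graph_eq k l)"
    using eventually_homogeneous_nonzero[OF C0.homogeneous_e[OF hb] z0]
    by eventually_elim (rule coeff_along_chart0)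
qed

lemma germs_chart1:
  assumes U: "zariski_open (*s) U" "vec.span {z0} \<in> U" and z0: "\<alpha>' 0 (e z0) \<noteq> 0"
    and s: "\<And>p. p \<in> U \<Longrightarrow> s p \<in> fib p" and kl: "k \<in> {1..n}" "l \<in> {1..n}"
  shows "rat_germ (*s) (pair_degree k l) z0 (\<lambda>z. coeff_along (k, l) (s (vec.span {z})) z) \<longleftrightarrow>
    rat_germ (*s) 0 z0 (\<lambda>z. s (vec.span {z}) (C1.graph_eq k l))"
proof (rule C1.germ_times_coord_power[OF z0])
  have hb: "homogeneous sV 1 (\<alpha>' 0)" by (rule homogeneous_linear[OF C1.coord_linear]) simp
  show "\<forall>\<^sub>F z in zariski_at (*s) z0. coeff_along (k, l) (s (vec.span {z})) z =
      \<alpha>' 0 (e z) ^ pair_degree k l * s (vec.span {z}) (C1.graph_eq k l)"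
    using eventually_homogeneous_nonzero[OF C1.homogeneous_e[OF hb] z0] C0.P.zariski_openD[OF U]
    by eventually_elim (rule coeff_along_chart1[OF _ s kl])
qed

text \<open>
  At each point choose a chart that contains it. There the coordinates have germs of the right
  degrees if and only if the values on the equations have germs of degree 0.
\<close>

lemma sections_NL_iff:
  assumes U: "zariski_open (*s) U" and s: "\<And>p. p \<in> U \<Longrightarrow> s p \<in> fib p"
  shows "sections C0.NL U s \<longleftrightarrow> (\<forall>z. vec.span {z} \<in> U \<longrightarrow> (\<forall>(k, l)\<in>set (index_pairs n).
    rat_germ (*s) (pair_degree k l) z (\<lambda>z. coeff_along (k, l) (s (vec.span {z})) z)))"
proof (intro iffI allI impI ballI)
  fix z q assume sec: "sections C0.NL U s" and z: "vec.span {z} \<in> U" and q: "q \<in> set (index_pairs n)"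
  obtain k l where kl: "q = (k, l)" "k \<in> {1..n}" "l \<in> {1..n}" "k \<le> n" "l \<le> n"
    using q n2 by (auto simp: set_index_pairs)
  have "z \<noteq> 0" using z U C0.P.zero_in_proj_point by (auto simp: zariski_open_def)
  then consider "\<alpha> 0 (e z) \<noteq> 0" | "\<alpha>' 0 (e z) \<noteq> 0" using cover by blast
  then have "rat_germ (*s) (pair_degree k l) z (\<lambda>z. coeff_along (k, l) (s (vec.span {z})) z)"
  proof cases
    case 1
    show ?thesis by (rule iffD2[OF germs_chart0[where k=k and l=l and s=s, OF 1] C0.NL_section_germ[OF U sec z 1 kl(4,5)]])
  next
    case 2
    show ?thesis by (rule iffD2[OF germs_chart1[where k=k and l=l and s=s, OF U z 2 s kl(2,3)] C1.NL_section_germ[OF U sec z 2 kl(4,5)]])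
  qed
  then show "case q of (k, l) \<Rightarrow> rat_germ (*s) (pair_degree k l) z (\<lambda>z. coeff_along (k, l) (s (vec.span {z})) z)"
    by (simp add: kl(1))
next
  assume germs: "\<forall>z. vec.span {z} \<in> U \<longrightarrow> (\<forall>(k, l)\<in>set (index_pairs n).
    rat_germ (*s) (pair_degree k l) z (\<lambda>z. coeff_along (k, l) (s (vec.span {z})) z))"
  have g: "rat_germ (*s) (pair_degree k l) z (\<lambda>z. coeff_along (k, l) (s (vec.span {z})) z)"
    if "vec.span {z} \<in> U" "k \<in> {1..n}" "l \<in> {1..n}" for z k l
  proof (cases "k \<le> l")
    case True
    then have "(k, l) \<in> set (index_pairs n)" using that n2 by (simp add: set_index_pairs)
    then show ?thesis using germs that(1) by fastforce
  next
    case False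
    then have "(l, k) \<in> set (index_pairs n)" using that n2 by (simp add: set_index_pairs)
    then have "rat_germ (*s) (pair_degree l k) z (\<lambda>z. coeff_along (l, k) (s (vec.span {z})) z)"
      using germs that(1) by fastforce
    moreover have "coeff_along (l, k) = coeff_along (k, l)" "pair_degree l k = pair_degree k l"
      by (simp_all add: coeff_along_def fun_eq_iff C0.graph_eq_commute[of k l] C1.graph_eq_commute[of k l] pair_degree_def)
    ultimately show ?thesis by simp
  qed
  let ?R = "restrict_bundle (pullback (proj_space sV) v C0.NX) L"
  have "\<forall>q\<in>U. \<exists>U' V m a t.
          opens P1 U' \<and> q \<in> U' \<and> U' \<subseteq> U \<and> opens (base ?R) V \<and> \<phi> ` U' \<subseteq> V \<and>
          (\<forall>i<(m::nat). regular P1 U' (a i) \<and> sections ?R V (t i)) \<and>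
          (\<forall>r\<in>U'. s r = (\<lambda>x. \<Sum>i<m. a i r * t i (\<phi> r) x))"
    unfolding C0.P.ball_open_iff[OF U, of "\<lambda>q. \<exists>U' V m a t.
          opens P1 U' \<and> q \<in> U' \<and> U' \<subseteq> U \<and> opens (base ?R) V \<and> \<phi> ` U' \<subseteq> V \<and>
          (\<forall>i<(m::nat). regular P1 U' (a i) \<and> sections ?R V (t i)) \<and>
          (\<forall>r\<in>U'. s r = (\<lambda>x. \<Sum>i<m. a i r * t i (\<phi> r) x))"]
  proof (intro allI impI)
    fix z assume z: "vec.span {z} \<in> U"
    have "z \<noteq> 0" using z U C0.P.zero_in_proj_point by (auto simp: zariski_open_def)
    then consider "\<alpha> 0 (e z) \<noteq> 0" | "\<alpha>' 0 (e z) \<noteq> 0" using cover by blast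
    then show "\<exists>U' V m a t.
          opens P1 U' \<and> vec.span {z} \<in> U' \<and> U' \<subseteq> U \<and> opens (base ?R) V \<and> \<phi> ` U' \<subseteq> V \<and>
          (\<forall>i<(m::nat). regular P1 U' (a i) \<and> sections ?R V (t i)) \<and>
          (\<forall>r\<in>U'. s r = (\<lambda>x. \<Sum>i<m. a i r * t i (\<phi> r) x))"
    proof cases
      case 1
      show ?thesis
        by (rule C0.NL_section_local[OF U z 1 s]) (use g[OF z] germs_chart0[OF 1, where s=s] in blast)+
    next
      case 2
      show ?thesis
        by (rule C1.NL_section_local[OF U z 2 s]) (use g[OF z] germs_chart1[where s=s, OF U z 2 s] in blast)+
    qed
  qed
  then show "sections C0.NL U s"
    by (subst pullback_def) (simp only: vbundle.simps)
qed

text \<open>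
  A normal vector is determined by its coordinates at one representative of the point, which can
  be prescribed arbitrarily, and the coordinates are homogeneous of the right degrees; so
  \<open>\<Phi>\<close> is bijective on fibres. It respects sections by
  \<open>sections_NL_iff\<close>.
\<close>

theorem normal_bundle_iso: "bundle_iso C0.NL Lsum"
  unfolding bundle_iso_def
proof (intro conjI exI[of _ \<Phi>] ballI allI impI)
  let ?xs = "index_pairs n" and ?M = "length (index_pairs n)"
  let ?d = "\<lambda>m. case ?xs ! m of (k, l) \<Rightarrow> pair_degree k l"
  show "base C0.NL = base Lsum" by (simp add: direct_sum_def)
  have fibE: "fibre C0.NL p = fib p" for p by (simp add: pullback_def)
  have fibF: "fibre Lsum p = {g. (\<forall>m<?M. (\<lambda>x. g (m, x)) \<in> fibre (twisting_bundle (*s) (?d m)) p) \<and>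
      (\<forall>m x. ?M \<le> m \<longrightarrow> g (m, x) = 0)}" for p
    by (simp add: direct_sum_def)
  have closed: "c *s x \<in> p" if "p \<in> proj_points (*s)" "x \<in> p" for p c and x :: "'k ^ 2"
    using that by (auto simp: C0.P.proj_points_iff vec.span_scale)
  have \<Phi>_fibre: "(\<lambda>x. \<Phi> p \<theta> (m, x)) \<in> fibre (twisting_bundle (*s) (?d m)) p"
    if "p \<in> proj_points (*s)" "m < ?M" for p \<theta> m
    using that closed[OF that(1)] by (auto simp: twisting_bundle_def \<Phi>_def coeff_along_scale)
  {
    fix p assume "p \<in> points (base C0.NL)"
    then have p: "p \<in> proj_points (*s)" by simp
    then obtain z where z: "z \<noteq> 0" "p = vec.span {z}" using C0.P.proj_points_iff[of p] by auto
    have zp: "z \<in> p" by (simp add: z vec.span_base)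
    have \<Phi>z: "\<Phi> p \<theta> (m, z) = coeff_along (?xs ! m) \<theta> z" if "m < ?M" for \<theta> m using that zp by (simp add: \<Phi>_def)
    show "bij_betw (\<Phi> p) (fibre C0.NL p) (fibre Lsum p)"
      unfolding bij_betw_def
    proof (intro conjI subset_antisym subsetI)
      show "inj_on (\<Phi> p) (fibre C0.NL p)"
      proof (rule inj_onI)
        fix \<theta> \<eta> assume "\<theta> \<in> fibre C0.NL p" "\<eta> \<in> fibre C0.NL p" and eq: "\<Phi> p \<theta> = \<Phi> p \<eta>"
        then have m: "\<theta> \<in> fib (vec.span {z})" "\<eta> \<in> fib (vec.span {z})" unfolding fibE z(2) by blast+
        show "\<theta> = \<eta>"
        proof (rule coeff_along_determines[OF z(1) m])
          fix q assume "q \<in> set ?xs"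
          then obtain m where "m < ?M" "?xs ! m = q" by (auto simp: in_set_conv_nth)
          then show "coeff_along q \<theta> z = coeff_along q \<eta> z" using \<Phi>z eq by metis
        qed
      qed
    next
      fix g assume "g \<in> \<Phi> p ` fibre C0.NL p"
      then obtain \<theta> where g: "g = \<Phi> p \<theta>" by blast
      show "g \<in> fibre Lsum p"
        unfolding fibF g mem_Collect_eq using \<Phi>_fibre[OF p, of _ \<theta>] by (simp add: \<Phi>_def)
    next
      fix g assume g: "g \<in> fibre Lsum p"
      define c where "c q = g (inv_into {..<?M} ((!) ?xs) q, z)" for q
      obtain \<theta> where \<theta>: "\<theta> \<in> fib (vec.span {z})" "\<And>q. q \<in> set ?xs \<Longrightarrow> coeff_along q \<theta> z = c q"
        using coeff_along_surjective[OF z(1), of c] by blast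
      have inj: "inj_on ((!) ?xs) {..<?M}"
        by (rule inj_on_nth[OF distinct_index_pairs]) simp
      have gz: "g (m, z) = coeff_along (?xs ! m) \<theta> z" if "m < ?M" for m
        using \<theta>(2)[of "?xs ! m"] that inv_into_f_f[OF inj, of m] by (simp add: c_def)
      have "g (m, x) = \<Phi> p \<theta> (m, x)" for m x
      proof (cases "m < ?M")
        case True
        then have gm: "(\<lambda>x. g (m, x)) \<in> fibre (twisting_bundle (*s) (?d m)) p" using g[unfolded fibF] by blast
        show ?thesis
        proof (cases "x \<in> p")
          case xp: True
          then obtain r where "x = r *s z" using z(2) C0.P.in_span_singleton by blast
          then have "g (m, x) = r ^ ?d m * g (m, z)"
            using gm zp by (simp add: twisting_bundle_def)
          also have "\<dots> = coeff_along (?xs ! m) \<theta> x" by (simp add: \<open>x = r *s z\<close> coeff_along_scale gz[OF True])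
          finally show ?thesis using True xp by (simp add: \<Phi>_def)
        next
          case False
          then show ?thesis using gm by (simp add: twisting_bundle_def \<Phi>_def)
        qed
      next
        case False
        then show ?thesis using g[unfolded fibF] by (simp add: \<Phi>_def)
      qed
      then have "g = \<Phi> p \<theta>" by auto
      then show "g \<in> \<Phi> p ` fibre C0.NL p" using \<theta>(1) unfolding fibE z(2) by blast
    qed
    show "\<Phi> p (\<lambda>x. \<theta> x + \<eta> x) = (\<lambda>y. \<Phi> p \<theta> y + \<Phi> p \<eta> y)" for \<theta> \<eta>
      by (rule ext) (simp add: \<Phi>_def coeff_along_add split: prod.splits)
    show "\<Phi> p (\<lambda>x. c * \<theta> x) = (\<lambda>y. c * \<Phi> p \<theta> y)" for c \<theta>
      by (rule ext) (simp add: \<Phi>_def coeff_along_smult split: prod.splits)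
  }
  fix U s assume U': "opens (base C0.NL) U" and s': "\<forall>p\<in>U. s p \<in> fibre C0.NL p"
  have U: "zariski_open (*s) U"
    using U' unfolding C0.base_pullback C0.P.opens_proj_space .
  have s: "s p \<in> fib p" if "p \<in> U" for p
    using s'[rule_format, OF that] unfolding fibE .
  have Up: "p \<in> proj_points (*s)" if "p \<in> U" for p using U that by (auto simp: zariski_open_def)
  have "sections Lsum U (\<lambda>p. \<Phi> p (s p)) \<longleftrightarrow>
      (\<forall>m<?M. sections (twisting_bundle (*s) (?d m)) U (\<lambda>p x. \<Phi> p (s p) (m, x)))"
    by (simp add: direct_sum_def \<Phi>_def)
  also have "\<dots> \<longleftrightarrow> (\<forall>m<?M. \<forall>z. vec.span {z} \<in> U \<longrightarrow>
      rat_germ (*s) (?d m) z (\<lambda>z. coeff_along (?xs ! m) (s (vec.span {z})) z))"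
    unfolding C0.P.sections_twisting_iff[OF U]
    using \<Phi>_fibre[OF Up] by (simp add: \<Phi>_def vec.span_base cong: imp_cong)
  also have "\<dots> \<longleftrightarrow> (\<forall>z. vec.span {z} \<in> U \<longrightarrow> (\<forall>(k, l)\<in>set ?xs.
      rat_germ (*s) (pair_degree k l) z (\<lambda>z. coeff_along (k, l) (s (vec.span {z})) z)))"
    by (auto simp: all_set_conv_all_nth split: prod.splits)
  also have "\<dots> \<longleftrightarrow> sections C0.NL U s" by (rule sections_NL_iff[OF U s, symmetric])
  finally show "sections C0.NL U s \<longleftrightarrow> sections Lsum U (\<lambda>p. \<Phi> p (s p))" by blast
qed

end

lemma plane_basis:
  fixes e :: "'k::field ^ 2 \<Rightarrow> 'v::ab_group_add"
  assumes "Vector_Spaces.linear (*s) sV e" "inj e"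
  shows "\<not> module.dependent sV {e (axis 1 1), e (axis 2 1)}"
    and "e (axis 1 1) \<noteq> e (axis 2 1)" and "e z = sV (z $ 1) (e (axis 1 1)) + sV (z $ 2) (e (axis 2 1))"
proof -
  interpret e: Vector_Spaces.linear "(*s)" sV e by fact
  have "vec.independent {axis 1 1, axis 2 (1::'k) :: 'k ^ 2}"
    by (rule vec.independent_mono[OF independent_cart_basis]) (auto simp: cart_basis_def)
  from e.independent_injective_image[OF this inj_on_subset[OF assms(2) subset_UNIV]]
  show "\<not> module.dependent sV {e (axis 1 1), e (axis 2 1)}" by simp
  show "e (axis 1 1) \<noteq> e (axis 2 1)"
    using assms(2) by (auto simp: inj_eq axis_eq_axis)
  have "z = z $ 1 *s axis 1 1 + z $ 2 *s axis 2 1"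
    by (simp add: vec_eq_iff axis_def forall_2)
  then have "e z = e (z $ 1 *s axis 1 1 + z $ 2 *s axis 2 1)" by simp
  then show "e z = sV (z $ 1) (e (axis 1 1)) + sV (z $ 2) (e (axis 2 1))"
    by (simp only: e.add e.scale)
qed

theorem theorem1p2:
  fixes scaleV :: "'k::{alg_closed_field, field_char_0} \<Rightarrow> 'v::ab_group_add \<Rightarrow> 'v"
    and scaleW :: "'k \<Rightarrow> 'w::ab_group_add \<Rightarrow> 'w"
    and mul :: "'v \<Rightarrow> 'v \<Rightarrow> 'w"
    and n :: nat
    and v :: "'v set \<Rightarrow> 'w set"
    and X :: "'w set set"
    and L :: "'v set set"
    and \<phi> :: "('k ^ 2) set \<Rightarrow> 'v set"
  assumes "vector_space scaleV" and "vector_space.dim scaleV UNIV = n + 1" and "n \<ge> 2"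
    and "vector_space scaleW" and "symmetric_square scaleV scaleW mul"
    and "veronese2 scaleV scaleW v"
    and "X = v ` points (proj_space scaleV)"
    and "is_line scaleV L"
    and "line_identification scaleV L \<phi>"
  shows "bundle_iso
     (pullback P1 \<phi>
       (restrict_bundle
         (pullback (proj_space scaleV) v (normal_bundle (proj_space scaleW) X)) L))
     (direct_sum P1
       (replicate (n * (n - 1) div 2) (twisting_bundle (*s) 2) @
        replicate (n - 1) (twisting_bundle (*s) 3) @
        [twisting_bundle (*s) 4]))"
proof -
  interpret V: char0_space scaleV by (simp add: char0_space_def assms)
  interpret W: char0_space scaleW by (simp add: char0_space_def assms)
  obtain e where e: "Vector_Spaces.linear (*s) scaleV e" "inj e"
    and \<phi>: "\<And>p. p \<in> points P1 \<Longrightarrow> \<phi> p = e ` p" and L: "L = \<phi> ` points P1"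
    using assms(9) unfolding line_identification_def by blast
  note e_axis = plane_basis[OF e]
  obtain a \<alpha> where a: "a 0 = e (axis 1 1)" "a (1::nat) = e (axis 2 1)"
    and \<alpha>: "\<And>i. i \<le> n \<Longrightarrow> Vector_Spaces.linear scaleV (*) (\<alpha> i)"
    and dual: "\<And>i j. i \<le> n \<Longrightarrow> j \<le> n \<Longrightarrow> \<alpha> i (a j) = (if i = j then 1 else (0::'k))"
    and expand: "\<And>x. x = (\<Sum>i\<le>n. scaleV (\<alpha> i x) (a i))"
    by (rule V.adapted_coordinates[OF assms(2) e_axis(1,2)]) (rule that)
  obtain mul' where mul': "symmetric_square scaleV scaleW mul'"
    and v: "\<And>l x. l \<in> proj_points scaleV \<Longrightarrow> x \<in> l - {0} \<Longrightarrow> v l = W.span {mul' x x}"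
    using veronese2_symmetric_square[OF assms(1,4) finite_atMost expand \<alpha> assms(5,6)] by auto
  \<comment> \<open>The second chart: \<open>\<alpha> 0\<close> and \<open>\<alpha> 1\<close> are exchanged, with a sign that preserves the determinant.\<close>
  define a' where "a' i = (if i = 0 then a 1 else if i = 1 then - a 0 else a i)" for i
  define \<alpha>' where "\<alpha>' i = (if i = 0 then \<alpha> 1 else if i = 1 then (\<lambda>y. - \<alpha> 0 y) else \<alpha> i)" for i
  have n: "0 \<le> n" "1 \<le> n" using assms(3) by auto
  have \<alpha>e: "\<alpha> i (e z) = (if i = 0 then z $ 1 else if i = 1 then z $ 2 else 0)" if i: "i \<le> n" for i z
  proof -
    interpret A: Vector_Spaces.linear scaleV "(*)" "\<alpha> i" by (rule \<alpha>[OF i])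
    show ?thesis
      unfolding e_axis(3)[of z] a[symmetric] A.add A.scale using dual[OF i n(1)] dual[OF i n(2)] by simp
  qed
  have \<alpha>'_linear: "Vector_Spaces.linear scaleV (*) (\<alpha>' i)" if "i \<le> n" for i
    using \<alpha>[OF that] \<alpha>[OF n(1)] \<alpha>[OF n(2)] by (auto simp: \<alpha>'_def Vector_Spaces.linear_iff)
  have minus: "\<alpha> i (- x) = - \<alpha> i x" if "i \<le> n" for i x
  proof -
    interpret A: Vector_Spaces.linear scaleV "(*)" "\<alpha> i" by (rule \<alpha>[OF that])
    show ?thesis by (rule A.neg)
  qed
  have dual': "\<alpha>' i (a' j) = (if i = j then 1 else 0)" if "i \<le> n" "j \<le> n" for i j
    using that n by (simp add: \<alpha>'_def a'_def dual minus)
  have expand': "x = (\<Sum>i\<le>n. scaleV (\<alpha>' i x) (a' i))" for x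
  proof -
    obtain m where m: "n = Suc (Suc m)" using assms(3) by (metis add_2_eq_Suc le_Suc_ex)
    have "(\<Sum>i\<le>n. scaleV (\<alpha>' i x) (a' i)) = (\<Sum>i\<le>n. scaleV (\<alpha> i x) (a i))"
      unfolding m sum.atMost_Suc_shift by (simp add: \<alpha>'_def a'_def algebra_simps)
    then show ?thesis using expand[of x] by simp
  qed
  interpret C0: veronese_line scaleV scaleW mul' n a \<alpha> e v \<phi> L
  proof (intro veronese_line.intro veronese_line_axioms.intro veronese_frame.intro
      veronese_frame_axioms.intro veronese_cone.intro veronese_cone_axioms.intro)
    show "char0_space scaleV" "char0_space scaleW" by unfold_locales
    show "symmetric_square scaleV scaleW mul'" by (rule mul')
    show "Vector_Spaces.linear scaleV (*) (\<alpha> i)" if "i \<le> n" for i using that by (rule \<alpha>)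
    show "\<alpha> i (a j) = (if i = j then 1 else 0)" if "i \<le> n" "j \<le> n" for i j using that by (rule dual)
    show "x = (\<Sum>i\<le>n. scaleV (\<alpha> i x) (a i))" for x by (rule expand)
    show "Vector_Spaces.linear (*s) scaleV e" by (rule e(1))
    show "inj e" by (rule e(2))
    show "\<alpha> i (e z) = 0" if "i \<in> {2..n}" for i z using that by (simp add: \<alpha>e)
    show "v l = W.span {mul' x x}" if "l \<in> proj_points scaleV" "x \<in> l - {0}" for l x
      using that by (rule v)
    show "\<phi> p = e ` p" if "p \<in> proj_points (*s)" for p
      using \<phi>[of p] that by (simp add: proj_space_def)
    show "L = \<phi> ` proj_points (*s)" using L by (simp add: proj_space_def)
  qed
  interpret C1: veronese_line scaleV scaleW mul' n a' \<alpha>' e v \<phi> L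
  proof (intro veronese_line.intro veronese_line_axioms.intro veronese_frame.intro
      veronese_frame_axioms.intro veronese_cone.intro veronese_cone_axioms.intro)
    show "char0_space scaleV" "char0_space scaleW" by unfold_locales
    show "symmetric_square scaleV scaleW mul'" by (rule mul')
    show "Vector_Spaces.linear (*s) scaleV e" by (rule e(1))
    show "inj e" by (rule e(2))
    show "v l = W.span {mul' x x}" if "l \<in> proj_points scaleV" "x \<in> l - {0}" for l x
      using that by (rule v)
    show "\<phi> p = e ` p" if "p \<in> proj_points (*s)" for p
      using \<phi>[of p] that by (simp add: proj_space_def)
    show "L = \<phi> ` proj_points (*s)" using L by (simp add: proj_space_def)
    show "Vector_Spaces.linear scaleV (*) (\<alpha>' i)" if "i \<le> n" for i using that by (rule \<alpha>'_linear)
    show "\<alpha>' i (a' j) = (if i = j then 1 else 0)" if "i \<le> n" "j \<le> n" for i j using that by (rule dual')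
    show "x = (\<Sum>i\<le>n. scaleV (\<alpha>' i x) (a' i))" for x by (rule expand')
    show "\<alpha>' i (e z) = 0" if "i \<in> {2..n}" for i z using that by (simp add: \<alpha>e \<alpha>'_def)
  qed
  interpret veronese_two_charts scaleV scaleW mul' n a \<alpha> a' \<alpha>' e v \<phi> L
  proof
    show "2 \<le> n" by fact
    show "\<alpha> 0 (e z) \<noteq> 0 \<or> \<alpha>' 0 (e z) \<noteq> 0" if "z \<noteq> 0" for z
      using that by (simp add: \<alpha>e[OF n(1)] \<alpha>e[OF n(2), unfolded One_nat_def] \<alpha>'_def vec_eq_iff forall_2)
    show "C0.cross k x = C1.cross k x" if "k \<in> {1..n}" for k x
      using that
      by (auto simp: C0.cross_def C1.cross_def \<alpha>'_def)
  qed
  have "X = C0.image_points"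
  proof -
    have "X = {v (V.span {x}) |x. x \<noteq> 0}"
      using assms(7) V.proj_points_iff by auto
    also have "\<dots> = C0.image_points"
      unfolding C0.image_points_def using C0.v_span by (metis (no_types, opaque_lifting))
    finally show ?thesis .
  qed
  moreover have "map (twisting_bundle ((*s) :: 'k \<Rightarrow> 'k ^ 2 \<Rightarrow> 'k ^ 2)) (map (\<lambda>(k, l). pair_degree k l) (index_pairs n)) =
      replicate (n * (n - 1) div 2) (twisting_bundle (*s) 2) @
        replicate (n - 1) (twisting_bundle (*s) 3) @ [twisting_bundle (*s) 4]"
    by (simp only: index_pairs_degrees[OF n(2)] map_append map_replicate list.map)
  ultimately show ?thesis using normal_bundle_iso by (simp only:)
qed

end
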